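(* For any $n\in\mathbb{N}$, there exists a prime power $q$ such that $\lambda({\rm L}_2(q))>n$.
   Context: For a finite group $G$, an unrefinable chain of length $t$ is a chain of subgroups $G=G_0>G_1>\cdots>G_{t-1}>G_t=1$ in which each $G_i$ is a maximal subgroup of $G_{i-1}$. The depth $\lambda(G)$ is the minimal length of an unrefinable chain of $G$. Here ${\rm L}_2(q)={\rm PSL}_2(q)$. *)

theory Defs
  imports "HOL-Algebra.Algebra" "HOL-Number_Theory.Prime_Powers"
begin

definition maximal_subgroup :: "'a set \<Rightarrow> ('a, 'b) monoid_scheme \<Rightarrow> bool" where
  "maximal_subgroup M G \<longleftrightarrow>
     subgroup M G \<and> M \<noteq> carrier G \<and>
     (\<forall>K. subgroup K G \<longrightarrow> M \<subseteq> K \<longrightarrow> K = M \<or> K = carrier G)"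

definition unrefinable_chain ::
    "('a, 'b) monoid_scheme \<Rightarrow> nat \<Rightarrow> (nat \<Rightarrow> 'a set) \<Rightarrow> bool" where
  "unrefinable_chain G t H \<longleftrightarrow>
     H 0 = carrier G \<and> H t = {\<one>\<^bsub>G\<^esub>} \<and>
     (\<forall>i<t. maximal_subgroup (H (Suc i)) (G\<lparr>carrier := H i\<rparr>))"

text \<open>Meaningful for finite groups, where a chain exists (see \<open>unrefinable_chain_exists\<close> below).\<close>

definition depth :: "('a, 'b) monoid_scheme \<Rightarrow> nat" where
  "depth G = (LEAST t. \<exists>H. unrefinable_chain G t H)"

definition group_center :: "('a, 'b) monoid_scheme \<Rightarrow> 'a set" where
  "group_center G = {z \<in> carrier G. \<forall>g \<in> carrier G. z \<otimes>\<^bsub>G\<^esub> g = g \<otimes>\<^bsub>G\<^esub> z}"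

text \<open>The quadruple \<open>(a, b, c, d)\<close> stands for the matrix with rows \<open>(a, b)\<close> and \<open>(c, d)\<close>.\<close>

definition SL2 :: "('a, 'b) ring_scheme \<Rightarrow> ('a \<times> 'a \<times> 'a \<times> 'a) monoid" where
  "SL2 R = \<lparr>
     carrier = {(a, b, c, d). a \<in> carrier R \<and> b \<in> carrier R \<and> c \<in> carrier R \<and> d \<in> carrier R \<and>
                  a \<otimes>\<^bsub>R\<^esub> d \<ominus>\<^bsub>R\<^esub> b \<otimes>\<^bsub>R\<^esub> c = \<one>\<^bsub>R\<^esub>},
     monoid.mult = (\<lambda>(a, b, c, d) (a', b', c', d').
       (a \<otimes>\<^bsub>R\<^esub> a' \<oplus>\<^bsub>R\<^esub> b \<otimes>\<^bsub>R\<^esub> c', a \<otimes>\<^bsub>R\<^esub> b' \<oplus>\<^bsub>R\<^esub> b \<otimes>\<^bsub>R\<^esub> d',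
        c \<otimes>\<^bsub>R\<^esub> a' \<oplus>\<^bsub>R\<^esub> d \<otimes>\<^bsub>R\<^esub> c', c \<otimes>\<^bsub>R\<^esub> b' \<oplus>\<^bsub>R\<^esub> d \<otimes>\<^bsub>R\<^esub> d')),
     monoid.one = (\<one>\<^bsub>R\<^esub>, \<zero>\<^bsub>R\<^esub>, \<zero>\<^bsub>R\<^esub>, \<one>\<^bsub>R\<^esub>)\<rparr>"

definition PSL2 :: "('a, 'b) ring_scheme \<Rightarrow> ('a \<times> 'a \<times> 'a \<times> 'a) set monoid" where
  "PSL2 R = SL2 R Mod group_center (SL2 R)"

text \<open>For a prime power \<open>q\<close> a field with \<open>q\<close> elements exists and is unique up to isomorphism.
  Being finite, it can be realised with natural numbers as elements, so the choice below is
  meaningful. For other \<open>q\<close> the value is arbitrary.\<close>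

definition GF :: "nat \<Rightarrow> nat ring" where
  "GF q = (SOME F. field F \<and> card (carrier F) = q)"

definition L2 :: "nat \<Rightarrow> (nat \<times> nat \<times> nat \<times> nat) set monoid" where
  "L2 q = PSL2 (GF q)"

lemma unrefinable_chain_exists:
  assumes "group G" "finite (carrier G)"
  shows "\<exists>t H. unrefinable_chain G t H"
  using assms
proof (induction "card (carrier G)" arbitrary: G rule: less_induct)
  case less
  interpret group G by fact
  show ?case
  proof (cases "carrier G = {\<one>\<^bsub>G\<^esub>}")
    case True
    then have "unrefinable_chain G 0 (\<lambda>_. carrier G)"
      by (simp add: unrefinable_chain_def)
    then show ?thesis by blast
  next
    case False
    let ?S = "{M. subgroup M G \<and> M \<noteq> carrier G}"
    have "finite ?S"
      using less.prems(2) by (rule finite_subset[rotated, OF finite_Pow_iff[THEN iffD2]])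
        (auto dest: subgroup.subset)
    moreover have "?S \<noteq> {}"
      using False triv_subgroup by blast
    ultimately obtain M where M: "M \<in> ?S" "\<forall>K\<in>?S. M \<subseteq> K \<longrightarrow> M = K"
      by (meson finite_has_maximal)
    then have max: "maximal_subgroup M G"
      by (auto simp: maximal_subgroup_def)
    have sub: "M \<subset> carrier G"
      using M(1) subgroup.subset by blast
    let ?M = "G\<lparr>carrier := M\<rparr>"
    have "\<exists>t H. unrefinable_chain ?M t H"
    proof (rule less.hyps)
      show "card (carrier ?M) < card (carrier G)"
        using sub less.prems(2) by (simp add: psubset_card_mono)
      show "group ?M"
        using M(1) by (simp add: subgroup.subgroup_is_group)
      show "finite (carrier ?M)"
        using sub less.prems(2) by (auto intro: finite_subset)
    qed
    then obtain t H where H: "unrefinable_chain ?M t H" by blast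
    have "unrefinable_chain G (Suc t) (case_nat (carrier G) H)"
      using H max unfolding unrefinable_chain_def
      by (auto simp: less_Suc_eq_0_disj split: nat.splits)
    then show ?thesis by blast
  qed
qed

lemma SL2_group:
  fixes F (structure)
  assumes "field F"
  shows "group (SL2 F)"
proof -
  interpret field F by fact
  show ?thesis
  proof (rule groupI)
    fix x y assume "x \<in> carrier (SL2 F)" "y \<in> carrier (SL2 F)"
    then obtain a b c d a' b' c' d' where xy: "x = (a, b, c, d)" "y = (a', b', c', d')"
      and cl: "a \<in> carrier F" "b \<in> carrier F" "c \<in> carrier F" "d \<in> carrier F"
        "a' \<in> carrier F" "b' \<in> carrier F" "c' \<in> carrier F" "d' \<in> carrier F"
      and det: "a \<otimes> d \<ominus> b \<otimes> c = \<one>" "a' \<otimes> d' \<ominus> b' \<otimes> c' = \<one>"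
      by (auto simp: SL2_def)
    have "(a \<otimes> a' \<oplus> b \<otimes> c') \<otimes> (c \<otimes> b' \<oplus> d \<otimes> d') \<ominus> (a \<otimes> b' \<oplus> b \<otimes> d') \<otimes> (c \<otimes> a' \<oplus> d \<otimes> c')
      = (a \<otimes> d \<ominus> b \<otimes> c) \<otimes> (a' \<otimes> d' \<ominus> b' \<otimes> c')"
      using cl by algebra
    then show "x \<otimes>\<^bsub>SL2 F\<^esub> y \<in> carrier (SL2 F)"
      using cl det xy by (simp add: SL2_def)
  next
    show "\<one>\<^bsub>SL2 F\<^esub> \<in> carrier (SL2 F)"
      by (simp add: SL2_def a_minus_def)
  next
    fix x y z assume "x \<in> carrier (SL2 F)" "y \<in> carrier (SL2 F)" "z \<in> carrier (SL2 F)"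
    then show "x \<otimes>\<^bsub>SL2 F\<^esub> y \<otimes>\<^bsub>SL2 F\<^esub> z = x \<otimes>\<^bsub>SL2 F\<^esub> (y \<otimes>\<^bsub>SL2 F\<^esub> z)"
      by (auto simp: SL2_def l_distr r_distr m_assoc a_ac)
  next
    fix x assume "x \<in> carrier (SL2 F)"
    then show "\<one>\<^bsub>SL2 F\<^esub> \<otimes>\<^bsub>SL2 F\<^esub> x = x"
      by (auto simp: SL2_def)
  next
    fix x assume "x \<in> carrier (SL2 F)"
    then obtain a b c d where x: "x = (a, b, c, d)"
      and cl: "a \<in> carrier F" "b \<in> carrier F" "c \<in> carrier F" "d \<in> carrier F"
      and det: "a \<otimes> d \<ominus> b \<otimes> c = \<one>"
      by (auto simp: SL2_def)
    have "b \<otimes> c \<in> carrier F" "a \<otimes> d \<in> carrier F" using cl by auto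
    then have "d \<otimes> a \<ominus> (\<ominus> b) \<otimes> (\<ominus> c) = \<one>" "d \<otimes> a \<oplus> (\<ominus> b) \<otimes> c = \<one>"
      "d \<otimes> b \<oplus> (\<ominus> b) \<otimes> d = \<zero>" "(\<ominus> c) \<otimes> a \<oplus> a \<otimes> c = \<zero>" "(\<ominus> c) \<otimes> b \<oplus> a \<otimes> d = \<one>"
      using cl det by (simp_all add: a_minus_def l_minus r_minus m_comm a_comm r_neg l_neg)
    then show "\<exists>y\<in>carrier (SL2 F). y \<otimes>\<^bsub>SL2 F\<^esub> x = \<one>\<^bsub>SL2 F\<^esub>"
      using cl x by (intro bexI[of _ "(d, \<ominus> b, \<ominus> c, a)"]) (auto simp: SL2_def)
  qed
qed

lemma group_center_normal:
  fixes G (structure)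
  assumes "group G"
  shows "group_center G \<lhd> G"
proof -
  interpret group G by fact
  have "subgroup (group_center G) G"
  proof (rule subgroupI)
    fix a assume a: "a \<in> group_center G"
    show "inv a \<in> group_center G"
      unfolding group_center_def
    proof (safe)
      show "inv a \<in> carrier G" using a by (simp add: group_center_def)
      fix g assume g: "g \<in> carrier G"
      have "a \<otimes> inv g = inv g \<otimes> a" "a \<in> carrier G"
        using a g by (auto simp: group_center_def)
      then have "inv (a \<otimes> inv g) = inv (inv g \<otimes> a)" by simp
      then show "inv a \<otimes> g = g \<otimes> inv a"
        using g \<open>a \<in> carrier G\<close> by (simp add: inv_mult_group)
    qed
  next
    fix a b assume ab: "a \<in> group_center G" "b \<in> group_center G"
    then have cl: "a \<in> carrier G" "b \<in> carrier G"
      by (auto simp: group_center_def)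
    have "a \<otimes> b \<otimes> g = g \<otimes> (a \<otimes> b)" if g: "g \<in> carrier G" for g
    proof -
      have a: "a \<otimes> g = g \<otimes> a" and b: "b \<otimes> g = g \<otimes> b"
        using ab g unfolding group_center_def by blast+
      have "a \<otimes> b \<otimes> g = a \<otimes> (b \<otimes> g)"
        using g cl by (simp only: m_assoc)
      also have "\<dots> = a \<otimes> g \<otimes> b"
        unfolding b using g cl by (simp only: m_assoc)
      also have "\<dots> = g \<otimes> (a \<otimes> b)"
        unfolding a using g cl by (simp only: m_assoc)
      finally show ?thesis .
    qed
    then show "a \<otimes> b \<in> group_center G"
      using cl unfolding group_center_def by blast
  next
    show "group_center G \<subseteq> carrier G"
      by (auto simp: group_center_def)
    have "\<one> \<in> group_center G"
      by (simp add: group_center_def)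
    then show "group_center G \<noteq> {}"
      by blast
  qed
  moreover have "\<forall>x\<in>carrier G. group_center G #> x = x <# group_center G"
    unfolding r_coset_def l_coset_def group_center_def by blast
  ultimately show ?thesis
    by (simp add: normalI)
qed

lemma PSL2_group: "field F \<Longrightarrow> group (PSL2 F)"
  unfolding PSL2_def
  by (intro normal.factorgroup_is_group group_center_normal SL2_group)

end

theory Submission
  imports Defs "HOL-Algebra.Algebraic_Closure_Type" "HOL-Library.Z2"
begin

text \<open>
  The fields of order \<open>q = 2 ^ 3 ^ b\<close> do the job: every unrefinable chain of \<open>L\<^sub>2(q)\<close> has
  length at least \<open>b\<close>. In characteristic two the centre of \<open>SL\<^sub>2(q)\<close> is trivial, so the
  argument takes place in \<open>SL\<^sub>2(q)\<close>, by induction on \<open>b\<close>.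

  Consider the second member \<open>M\<close> of a chain. Dickson's description of the subgroups of
  \<open>SL\<^sub>2(2 ^ k)\<close> leaves three possibilities for a maximal subgroup, up to conjugacy.

  \<^item> \<open>M\<close> is a Borel subgroup. It has the cyclic quotient \<open>F\<^sup>*\<close> of order \<open>q - 1\<close>.

  \<^item> \<open>M\<close> is the normaliser of a torus. It contains the torus, of order \<open>q - 1\<close> or \<open>q + 1\<close>, and each
    element of \<open>M\<close> centralises or inverts the torus.

  \<^item> \<open>M\<close> is \<open>SL\<^sub>2(K)\<close> for a subfield \<open>K\<close>. The degree of \<open>K\<close> is a power of 3 as well, so
    maximality forces it to be \<open>3 ^ (b - 1)\<close>, and the induction hypothesis applies to the rest of the
    chain. This is the reason for the exponent \<open>3 ^ b\<close>: the subfields form a chain, and a chain of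
    subgroups cannot jump to a small subfield.

  In the first two cases each step of the chain removes at most one prime factor from the order of the
  torus (\<open>prime_factors_le_chain_length\<close>), and \<open>2 ^ 3 ^ b - 1\<close> and \<open>2 ^ 3 ^ b + 1\<close> both have at
  least \<open>b\<close> prime factors because \<open>x - 1\<close> and \<open>x + 1\<close> properly divide \<open>x ^ 3 - 1\<close> and
  \<open>x ^ 3 + 1\<close>. The exponent 3 rather than 2 is needed for the second of these.

  The classification of subgroups (\<open>subgroup_sl2_cases\<close>) rests on the fact that in \<open>SL\<^sub>2\<close> in
  characteristic two commuting is a transitive relation on the nontrivial elements. A subgroup without
  involutions is then abelian, by counting conjugates of centralisers (\<open>commutative_if_no_fusion\<close>).
  If there are two involutions that do not commute, all involutions are conjugate, and counting them shows that
  every coset of the centraliser of an involution \<open>t\<close> outside the stabiliser of its fixed point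
  contains an involution (\<open>coset_meets_involutions\<close>). If that centraliser has order 2,
  this makes the group dihedral; otherwise it yields enough information on traces to
  recognise the group as \<open>SL\<^sub>2(K)\<close>, where \<open>K\<close> is read off from the unipotent upper
  triangular matrices (\<open>subgroup_eq_sl2\<close>).
\<close>

section \<open>Conjugation, subgroups and unrefinable chains\<close>

lemma (in group) conj_class_card:
  assumes "t \<in> carrier G"
  shows "card ((\<lambda>g. g \<otimes> t \<otimes> inv g) ` carrier G) * card {g \<in> carrier G. g \<otimes> t = t \<otimes> g} = Coset.order G"
proof -
  interpret A: group_action G "carrier G" "\<lambda>g. (\<lambda>h \<in> carrier G. g \<otimes> h \<otimes> (inv g))"
    by (rule action_by_conjugation)
  have 1: "orbit G (\<lambda>g. (\<lambda>h \<in> carrier G. g \<otimes> h \<otimes> (inv g))) t = (\<lambda>g. g \<otimes> t \<otimes> inv g) ` carrier G"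
    using assms by (auto simp: orbit_def)
  have "g \<otimes> t \<otimes> inv g = t \<longleftrightarrow> g \<otimes> t = t \<otimes> g" if "g \<in> carrier G" for g
    using that assms by (metis inv_solve_right m_closed)
  then have 2: "stabilizer G (\<lambda>g. (\<lambda>h \<in> carrier G. g \<otimes> h \<otimes> (inv g))) t
      = {g \<in> carrier G. g \<otimes> t = t \<otimes> g}"
    using assms by (auto simp: stabilizer_def)
  show ?thesis
    using A.orbit_stabilizer_theorem[OF assms] unfolding 1 2 .
qed

lemma (in group) mult_inv_cancel:
  assumes "g \<in> carrier G" "x \<in> carrier G"
  shows "g \<otimes> (inv g \<otimes> x) = x" "inv g \<otimes> (g \<otimes> x) = x"
  using assms by (simp_all add: m_assoc[symmetric])

lemma (in group) subgroup_of_subgroup_iff: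
  assumes "subgroup C G"
  shows "subgroup M (G\<lparr>carrier := C\<rparr>) \<longleftrightarrow> subgroup M G \<and> M \<subseteq> C"
proof
  assume M: "subgroup M (G\<lparr>carrier := C\<rparr>)"
  then show "subgroup M G \<and> M \<subseteq> C"
    using incl_subgroup[OF assms M] subgroup.subset[OF M] by simp
next
  assume "subgroup M G \<and> M \<subseteq> C"
  then show "subgroup M (G\<lparr>carrier := C\<rparr>)" using subgroup_incl assms by blast
qed

lemma (in group) maximal_subgroup_within:
  assumes "subgroup C G"
  shows "maximal_subgroup M (G\<lparr>carrier := C\<rparr>) \<longleftrightarrow>
    subgroup M G \<and> M \<subset> C \<and> (\<forall>K. subgroup K G \<longrightarrow> M \<subseteq> K \<longrightarrow> K \<subseteq> C \<longrightarrow> K = M \<or> K = C)"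
  unfolding maximal_subgroup_def subgroup_of_subgroup_iff[OF assms] by auto

lemma (in group) chain_subgroup:
  assumes "unrefinable_chain G t C" "i \<le> t"
  shows "subgroup (C i) G"
  using assms(2)
proof (induction i)
  case 0
  then show ?case using assms(1) subgroup_self by (simp add: unrefinable_chain_def)
next
  case (Suc i)
  then have "subgroup (C i) G" "maximal_subgroup (C (Suc i)) (G\<lparr>carrier := C i\<rparr>)"
    using assms(1) by (auto simp: unrefinable_chain_def)
  then show ?case using maximal_subgroup_within by blast
qed

lemma (in group) maximal_subgroup_iso_image:
  assumes "group G'" "f \<in> iso G G'" "maximal_subgroup M G"
  shows "maximal_subgroup (f ` M) G'"
proof -
  interpret f: group_hom G G' f
    using assms(1,2) by (simp add: group_hom_def group_hom_axioms_def iso_def is_group)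
  have bij: "bij_betw f (carrier G) (carrier G')" using assms(2) by (simp add: iso_def)
  have M: "subgroup M G" "M \<noteq> carrier G"
    and mx: "\<And>K. subgroup K G \<Longrightarrow> M \<subseteq> K \<Longrightarrow> K = M \<or> K = carrier G"
    using assms(3) by (auto simp: maximal_subgroup_def)
  have Msub: "M \<subseteq> carrier G" using M(1) by (rule subgroup.subset)
  show ?thesis unfolding maximal_subgroup_def
  proof (intro conjI allI impI)
    show "subgroup (f ` M) G'" by (rule f.subgroup_img_is_subgroup[OF M(1)])
    show "f ` M \<noteq> carrier G'"
      using bij_betw_imp_surj_on[OF bij] inj_on_image_eq_iff[OF bij_betw_imp_inj_on[OF bij] Msub subset_refl]
        M(2) by simp
  next
    fix K assume K: "subgroup K G'" "f ` M \<subseteq> K"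
    let ?K = "{x \<in> carrier G. f x \<in> K}"
    interpret K: subgroup K G' by fact
    have "subgroup ?K G" by unfold_locales auto
    moreover have "M \<subseteq> ?K" using Msub K(2) by auto
    ultimately have or: "?K = M \<or> ?K = carrier G" by (rule mx)
    have img: "f ` ?K = K"
    proof
      show "f ` ?K \<subseteq> K" by auto
      show "K \<subseteq> f ` ?K"
      proof
        fix y assume y: "y \<in> K"
        then have "y \<in> f ` carrier G" using K.subset bij_betw_imp_surj_on[OF bij] by blast
        then show "y \<in> f ` ?K" using y by auto
      qed
    qed
    show "K = f ` M \<or> K = carrier G'"
      using or
    proof
      assume "?K = M"
      then show ?thesis using img by simp
    next
      assume "?K = carrier G"
      then show ?thesis using img bij_betw_imp_surj_on[OF bij] by simp
    qed
  qed
qed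

lemma (in group) unrefinable_chain_iso_image:
  assumes "group G'" "f \<in> iso G G'" "unrefinable_chain G t C"
  shows "unrefinable_chain G' t (\<lambda>i. f ` C i)"
proof -
  interpret f: group_hom G G' f
    using assms(1,2) by (simp add: group_hom_def group_hom_axioms_def iso_def is_group)
  have bij: "bij_betw f (carrier G) (carrier G')" using assms(2) by (simp add: iso_def)
  have "maximal_subgroup (f ` C (Suc i)) (G'\<lparr>carrier := f ` C i\<rparr>)" if "i < t" for i
  proof (rule group.maximal_subgroup_iso_image)
    have S: "subgroup (C i) G" using chain_subgroup[OF assms(3)] that by simp
    then show "group (G\<lparr>carrier := C i\<rparr>)" by (rule subgroup_imp_group)
    show "group (G'\<lparr>carrier := f ` C i\<rparr>)"
      using f.H.subgroup_imp_group f.subgroup_img_is_subgroup[OF S] by blast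
    show "f \<in> iso (G\<lparr>carrier := C i\<rparr>) (G'\<lparr>carrier := f ` C i\<rparr>)"
      using subgroup.subset[OF S] bij
      by (auto simp: iso_def hom_def bij_betw_def inj_on_def subset_iff)
    show "maximal_subgroup (C (Suc i)) (G\<lparr>carrier := C i\<rparr>)"
      using assms(3) that by (simp add: unrefinable_chain_def)
  qed
  then show ?thesis
    using assms(3) bij f.hom_one by (auto simp: unrefinable_chain_def bij_betw_def)
qed

lemma (in group) finite_closed_subgroup:
  assumes "S \<subseteq> carrier G" "finite S" "S \<noteq> {}" and closed: "\<And>u v. u \<in> S \<Longrightarrow> v \<in> S \<Longrightarrow> u \<otimes> v \<in> S"
  shows "subgroup S G"
proof -
  have surj: "(\<lambda>y. x \<otimes> y) ` S = S" if "x \<in> S" for x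
    using assms that by (intro endo_inj_surj) (auto simp: inj_on_def subset_iff)
  have one: "\<one> \<in> S"
  proof -
    obtain x where x: "x \<in> S" using assms(3) by blast
    then obtain y where "y \<in> S" "x \<otimes> y = x" using surj[OF x] by (metis image_iff)
    then show ?thesis using x assms(1) by (metis l_cancel_one' subset_iff)
  qed
  have "inv x \<in> S" if x: "x \<in> S" for x
  proof -
    obtain y where "y \<in> S" "x \<otimes> y = \<one>" using surj[OF x] one by (metis image_iff)
    moreover have "x \<in> carrier G" "y \<in> carrier G" using x \<open>y \<in> S\<close> assms(1) by auto
    ultimately show ?thesis using inv_equality[OF inv_comm[of x y]] by simp
  qed
  then show ?thesis using assms one by unfold_locales auto
qed

lemma unrefinable_chain_tail:
  assumes "unrefinable_chain G (Suc t) C"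
  shows "unrefinable_chain (G\<lparr>carrier := C 1\<rparr>) t (\<lambda>i. C (Suc i))"
  using assms by (auto simp: unrefinable_chain_def)

section \<open>Counting prime factors along a chain\<close>

text \<open>
  Take \<open>r\<close> in \<open>R\<close> but not in \<open>P\<close>. If \<open>m\<close> is its order modulo \<open>P\<close> and \<open>p\<close> is a prime factor of
  \<open>m\<close>, then \<open>x = r ^ (m / p)\<close> has order \<open>p\<close> modulo \<open>P\<close>, so \<open>P\<close> together with \<open>x\<close> generates a
  subgroup of order \<open>p * card P\<close>, and that subgroup must be \<open>R\<close>.
\<close>

lemma (in comm_group) no_intermediate_subgroup_prime_index:
  assumes "subgroup P G" "subgroup R G" "P \<subset> R" "finite R"
    and no: "\<And>S. subgroup S G \<Longrightarrow> P \<subseteq> S \<Longrightarrow> S \<subseteq> R \<Longrightarrow> S = P \<or> S = R"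
  shows "\<exists>p. Factorial_Ring.prime p \<and> card R = p * card P"
proof -
  obtain r where r: "r \<in> R" "r \<notin> P" using assms(3) by blast
  have Rs: "R \<subseteq> carrier G" and Ps: "P \<subseteq> carrier G" using assms(1,2)[THEN subgroup.subset] by auto
  have rG: "r \<in> carrier G" using r Rs by auto
  interpret PP: subgroup P G by fact
  have pow_mod: "x [^] i = x [^] (i mod p) \<otimes> (x [^] p) [^] (i div p)"
    if "x \<in> carrier G" for x and i p :: nat
    using that by (metis mod_mult_div_eq nat_pow_mult nat_pow_pow)
  have Ppow: "x [^] (i::nat) \<in> P" if "x \<in> P" for x i
    using that by (induction i) auto
  define m where "m = (LEAST k::nat. 0 < k \<and> r [^] k \<in> P)"
  have "\<exists>k::nat. 0 < k \<and> r [^] k \<in> P"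
  proof -
    interpret RR: group "G\<lparr>carrier := R\<rparr>" using assms(2) by (rule subgroup_imp_group)
    have "r [^]\<^bsub>G\<lparr>carrier := R\<rparr>\<^esub> RR.ord r = \<one>" using r(1) RR.pow_ord_eq_1[of r] by simp
    then have "r [^] RR.ord r = \<one>" by (simp add: nat_pow_consistent[symmetric])
    moreover have "RR.ord r > 0" using RR.ord_ge_1[of r] r(1) assms(4) by force
    ultimately show ?thesis using PP.one_closed by auto
  qed
  then have m: "0 < m" "r [^] m \<in> P" and mmin: "\<And>k. 0 < k \<Longrightarrow> r [^] k \<in> P \<Longrightarrow> m \<le> k"
    unfolding m_def by (metis (mono_tags, lifting) LeastI_ex Least_le)+
  have "m \<noteq> 1" using m r rG by auto
  then obtain p where p: "Factorial_Ring.prime p" "p dvd m" using prime_factor_nat by blast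
  then obtain l where l: "m = p * l" by auto
  have l0: "0 < l" "l < m" using l m(1) prime_gt_1_nat[OF p(1)] by auto
  define x where "x = r [^] l"
  have xG: "x \<in> carrier G" using rG by (simp add: x_def)
  have xP: "x [^] p \<in> P" using rG m(2) by (simp add: x_def l nat_pow_pow mult.commute)
  have xnP: "x [^] i \<notin> P" if "0 < i" "i < p" for i
  proof
    assume "x [^] i \<in> P"
    then have "r [^] (l * i) \<in> P" using rG by (simp add: x_def nat_pow_pow)
    then have "m \<le> l * i" using mmin that(1) l0(1) by simp
    moreover have "l * i < m" using that(2) l0(1) by (simp add: l mult.commute)
    ultimately show False by simp
  qed
  have xR: "x [^] (i::nat) \<in> R" for i
  proof -
    have "y [^] (i::nat) \<in> R" if "y \<in> R" for y i
      using that assms(2) by (induction i) (auto simp: subgroup.one_closed subgroup.m_closed)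
    then show ?thesis using r(1) x_def by metis
  qed
  let ?f = "\<lambda>(i, a). x [^] (i::nat) \<otimes> a"
  define S where "S = ?f ` ({..<p} \<times> P)"
  have SI: "x [^] i \<otimes> a \<in> S" if "a \<in> P" for a and i :: nat
  proof -
    have "x [^] i \<otimes> a = x [^] (i mod p) \<otimes> ((x [^] p) [^] (i div p) \<otimes> a)"
      using that xG Ps by (subst pow_mod[of x i p]) (auto simp: m_assoc subset_iff)
    moreover have "(x [^] p) [^] (i div p) \<otimes> a \<in> P" using Ppow xP that by auto
    moreover have "i mod p < p" using prime_gt_0_nat[OF p(1)] by simp
    ultimately show ?thesis unfolding S_def by (intro image_eqI[of _ _ "(i mod p, (x [^] p) [^] (i div p) \<otimes> a)"]) auto
  qed
  have SR: "S \<subseteq> R"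
    using xR assms(2,3) by (auto simp: S_def intro!: subgroup.m_closed[OF assms(2)])
  have "subgroup S G"
  proof (rule finite_closed_subgroup)
    show "S \<subseteq> carrier G" "finite S" using SR Rs assms(4) finite_subset by auto
    show "S \<noteq> {}" using SI PP.one_closed by blast
    have elem: "\<exists>i::nat. \<exists>a. w = x [^] i \<otimes> a \<and> a \<in> P" if "w \<in> S" for w
      using that unfolding S_def by auto
    fix u v assume "u \<in> S" "v \<in> S"
    then obtain i j :: nat and a b where u: "u = x [^] i \<otimes> a" "a \<in> P" and v: "v = x [^] j \<otimes> b" "b \<in> P"
      using elem by meson
    have "u \<otimes> v = x [^] (i + j) \<otimes> (a \<otimes> b)"
    proof -
      have "a \<in> carrier G" "b \<in> carrier G" using u v Ps by auto
      moreover have "x [^] (i + j) = x [^] i \<otimes> x [^] j" using xG by (simp add: nat_pow_mult)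
      ultimately show ?thesis unfolding u(1) v(1) using xG by (simp add: m_ac)
    qed
    then show "u \<otimes> v \<in> S"
      using SI[of "a \<otimes> b" "i + j"] PP.m_closed[OF u(2) v(2)] by metis
  qed
  moreover have "P \<subseteq> S"
  proof
    fix a assume "a \<in> P" then show "a \<in> S" using SI[of a 0] Ps by auto
  qed
  moreover have "x \<in> S" using SI[of \<one> 1] xG by auto
  moreover have "x \<notin> P" using xnP[of 1] xG prime_gt_1_nat[OF p(1)] by auto
  ultimately have "S = R" using no SR by blast
  moreover have "inj_on ?f ({..<p} \<times> P)"
  proof -
    have key: "i = j" if "x [^] i \<otimes> a = x [^] j \<otimes> b" "a \<in> P" "b \<in> P" "i \<le> j" "j < p" for a b and i j :: nat
    proof (rule ccontr)
      assume "i \<noteq> j"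
      have ab: "a \<in> carrier G" "b \<in> carrier G" using that Ps by auto
      have "x [^] i \<otimes> a = x [^] i \<otimes> (x [^] (j - i) \<otimes> b)"
      proof -
        have "x [^] j = x [^] i \<otimes> x [^] (j - i)" using that xG by (simp add: nat_pow_mult)
        then show ?thesis unfolding that(1) using xG ab by (simp add: m_assoc)
      qed
      then have "x [^] (j - i) \<otimes> b = a" using xG ab by (metis l_cancel m_closed nat_pow_closed)
      then have "x [^] (j - i) = a \<otimes> inv b"
        using xG ab inv_solve_right[of "x [^] (j - i)" a b] by simp
      then have "x [^] (j - i) \<in> P" using that by auto
      then show False using xnP[of "j - i"] \<open>i \<noteq> j\<close> that by auto
    qed
    show ?thesis
    proof (rule inj_onI, safe)
      fix i a j b assume *: "i < p" "a \<in> P" "j < p" "b \<in> P" "x [^] i \<otimes> a = x [^] j \<otimes> b"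
      show ij: "i = j" using * key[of i a j b] key[of j b i a] by (cases "i \<le> j") simp_all
      show "a = b" using *(5) *(2,4) xG Ps unfolding ij by (meson l_cancel nat_pow_closed subsetD)
    qed
  qed
  then have "card S = p * card P" unfolding S_def by (subst card_image) (auto simp: card_cartesian_product)
  ultimately show ?thesis using p by blast
qed

text \<open>
  One step of a chain. The hypothesis on conjugation says that \<open>G\<close> acts on \<open>\<phi> ` N\<close> by the identity and
  inversion, so that preimages of subgroups of \<open>A\<close> are normalised by everything. Any subgroup
  \<open>S\<close> strictly between \<open>\<phi> ` (M \<inter> N)\<close> and \<open>\<phi> ` (C \<inter> N)\<close> would therefore give, with \<open>K\<close> its preimage in
  \<open>C \<inter> N\<close>, a product \<open>M K\<close> strictly between \<open>M\<close> and \<open>C\<close>.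
\<close>

lemma (in group) normal_hom_maximal_index:
  assumes fin: "finite (carrier G)" and N: "subgroup N G" and A: "comm_group A"
    and hom: "\<phi> \<in> hom (G\<lparr>carrier := N\<rparr>) A"
    and conj: "\<And>g n. g \<in> carrier G \<Longrightarrow> n \<in> N \<Longrightarrow>
      g \<otimes> n \<otimes> inv g \<in> N \<and> \<phi> (g \<otimes> n \<otimes> inv g) \<in> {\<phi> n, inv\<^bsub>A\<^esub> \<phi> n}"
    and C: "subgroup C G" and max: "maximal_subgroup M (G\<lparr>carrier := C\<rparr>)"
  shows "card (\<phi> ` (C \<inter> N)) = card (\<phi> ` (M \<inter> N)) \<or>
    (\<exists>p. Factorial_Ring.prime p \<and> card (\<phi> ` (C \<inter> N)) = p * card (\<phi> ` (M \<inter> N)))"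
proof (cases "\<phi> ` (C \<inter> N) = \<phi> ` (M \<inter> N)")
  case False
  interpret A: comm_group A by fact
  interpret N: subgroup N G by fact
  interpret C: subgroup C G by fact
  have M: "subgroup M G" "M \<subset> C"
    and mx: "\<And>K. subgroup K G \<Longrightarrow> M \<subseteq> K \<Longrightarrow> K \<subseteq> C \<Longrightarrow> K = M \<or> K = C"
    using max[unfolded maximal_subgroup_within[OF C]] by auto
  interpret M: subgroup M G by (rule M(1))
  interpret \<phi>: group_hom "G\<lparr>carrier := N\<rparr>" A \<phi>
    using subgroup_imp_group[OF N] A.is_group hom by (simp add: group_hom_def group_hom_axioms_def)
  have \<phi>_mult: "\<phi> (x \<otimes> y) = \<phi> x \<otimes>\<^bsub>A\<^esub> \<phi> y" if "x \<in> N" "y \<in> N" for x y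
    using \<phi>.hom_mult[of x y] that by simp
  have finC: "finite C" using fin C.subset finite_subset by blast
  have img: "subgroup (\<phi> ` (Z \<inter> N)) A" if "subgroup Z G" for Z
  proof (rule \<phi>.subgroup_img_is_subgroup)
    show "subgroup (Z \<inter> N) (G\<lparr>carrier := N\<rparr>)"
      using subgroup_of_subgroup_iff[OF N] subgroups_Inter_pair[OF that N] by blast
  qed
  have "\<exists>p. Factorial_Ring.prime p \<and> card (\<phi> ` (C \<inter> N)) = p * card (\<phi> ` (M \<inter> N))"
  proof (rule A.no_intermediate_subgroup_prime_index)
    show "subgroup (\<phi> ` (M \<inter> N)) A" "subgroup (\<phi> ` (C \<inter> N)) A" using img M(1) C by auto
    show "\<phi> ` (M \<inter> N) \<subset> \<phi> ` (C \<inter> N)" using False M(2) by auto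
    show "finite (\<phi> ` (C \<inter> N))" using finC by simp
    fix S assume S: "subgroup S A" "\<phi> ` (M \<inter> N) \<subseteq> S" "S \<subseteq> \<phi> ` (C \<inter> N)"
    interpret S: subgroup S A by (rule S(1))
    define K where "K = {n \<in> C \<inter> N. \<phi> n \<in> S}"
    have K_mult: "k \<otimes> l \<in> K" if "k \<in> K" "l \<in> K" for k l
      using that \<phi>_mult unfolding K_def by auto
    \<comment> \<open>\<open>M\<close> normalises \<open>K\<close>: conjugation changes values of \<open>\<phi>\<close> at most by inversion.\<close>
    have K_conj: "inv m \<otimes> k \<otimes> m \<in> K" if "m \<in> M" "k \<in> K" for m k
    proof -
      have k: "k \<in> C" "k \<in> N" "\<phi> k \<in> S" using that(2) by (auto simp: K_def)
      have m: "m \<in> C" "m \<in> carrier G" using that(1) M(2) by auto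
      have "inv m \<otimes> k \<otimes> m \<in> N" "\<phi> (inv m \<otimes> k \<otimes> m) \<in> {\<phi> k, inv\<^bsub>A\<^esub> \<phi> k}"
        using conj[of "inv m" k] m k by auto
      moreover have "inv m \<otimes> k \<otimes> m \<in> C" using m k by simp
      ultimately show ?thesis using k unfolding K_def by auto
    qed
    define L where "L = (\<lambda>(m, k). m \<otimes> k) ` (M \<times> K)"
    have LI: "m \<otimes> k \<in> L" if "m \<in> M" "k \<in> K" for m k
      unfolding L_def using that by (intro image_eqI[of _ _ "(m, k)"]) auto
    have LE: "\<exists>m k. x = m \<otimes> k \<and> m \<in> M \<and> k \<in> K" if "x \<in> L" for x
      using that unfolding L_def by auto
    have one_K: "\<one> \<in> K" using \<phi>.hom_one by (simp add: K_def)
    have KC: "K \<subseteq> C" by (auto simp: K_def)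
    have LC: "L \<subseteq> C" using M(2) KC unfolding L_def by auto
    have "subgroup L G"
    proof (rule finite_closed_subgroup)
      show "L \<subseteq> carrier G" using LC C.subset by blast
      show "finite L" using LC finC finite_subset by blast
      show "L \<noteq> {}" using LI[OF M.one_closed one_K] by blast
      fix u v assume "u \<in> L" "v \<in> L"
      then obtain m k m' k' where u: "u = m \<otimes> k" "m \<in> M" "k \<in> K"
        and v: "v = m' \<otimes> k'" "m' \<in> M" "k' \<in> K" using LE by meson
      have cl: "m \<in> carrier G" "m' \<in> carrier G" "k \<in> carrier G" "k' \<in> carrier G"
        using u v KC by auto
      have "u \<otimes> v = (m \<otimes> m') \<otimes> ((inv m' \<otimes> k \<otimes> m') \<otimes> k')"
        unfolding u(1) v(1) using cl by (simp add: m_assoc mult_inv_cancel)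
      also have "\<dots> \<in> L"
        using u v by (intro LI K_mult K_conj) auto
      finally show "u \<otimes> v \<in> L" .
    qed
    moreover have "M \<subseteq> L" using LI[OF _ one_K] by (metis M.mem_carrier r_one subsetI)
    ultimately have "L = M \<or> L = C" using mx LC by blast
    then show "S = \<phi> ` (M \<inter> N) \<or> S = \<phi> ` (C \<inter> N)"
    proof
      assume L: "L = M"
      have "S \<subseteq> \<phi> ` (M \<inter> N)"
      proof
        fix s assume s: "s \<in> S"
        then obtain n where n: "n \<in> C" "n \<in> N" "s = \<phi> n" using S(3) by auto
        then have "n \<in> K" using s by (simp add: K_def)
        then have "n \<in> M" using LI[OF M.one_closed] L KC C.subset by (metis l_one subsetD)
        then show "s \<in> \<phi> ` (M \<inter> N)" using n by auto
      qed
      then show ?thesis using S(2) by auto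
    next
      assume L: "L = C"
      have "\<phi> ` (C \<inter> N) \<subseteq> S"
      proof safe
        fix n assume n: "n \<in> C" "n \<in> N"
        then obtain m k where mk: "n = m \<otimes> k" "m \<in> M" "k \<in> K" using LE L by blast
        then have kN: "k \<in> N" "\<phi> k \<in> S" by (auto simp: K_def)
        have "m = n \<otimes> inv k" using mk kN n(2) by (metis M.mem_carrier N.mem_carrier inv_solve_right)
        then have mN: "m \<in> N" using n kN by simp
        then have "\<phi> m \<in> S" using S(2) mk by blast
        then show "\<phi> n \<in> S" unfolding mk(1) using \<phi>_mult mN kN by simp
      qed
      then show ?thesis using S(3) by auto
    qed
  qed
  then show ?thesis ..
qed simp

text \<open>
  Follow \<open>card (\<phi> ` (C i \<inter> N))\<close> down the chain: it ends at 1, and each step divides it by 1 or by a prime.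
  It is applied below to a Borel subgroup, with \<open>\<phi>\<close> the projection to the torus, and to the normaliser of
  a torus \<open>N\<close>, with \<open>\<phi>\<close> the identity on \<open>N\<close>.
\<close>

theorem (in group) prime_factors_le_chain_length:
  assumes fin: "finite (carrier G)" and N: "subgroup N G" and A: "comm_group A"
    and hom: "\<phi> \<in> hom (G\<lparr>carrier := N\<rparr>) A"
    and conj: "\<And>g n. g \<in> carrier G \<Longrightarrow> n \<in> N \<Longrightarrow>
      g \<otimes> n \<otimes> inv g \<in> N \<and> \<phi> (g \<otimes> n \<otimes> inv g) \<in> {\<phi> n, inv\<^bsub>A\<^esub> \<phi> n}"
    and chain: "unrefinable_chain G t C"
  shows "size (prime_factorization (card (\<phi> ` N))) \<le> t"
proof -
  interpret N: subgroup N G by fact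
  let ?f = "\<lambda>i. size (prime_factorization (card (\<phi> ` (C i \<inter> N))))"
  have step: "?f i \<le> ?f (Suc i) + 1" if "i < t" for i
  proof -
    have Ci: "subgroup (C i) G" using chain_subgroup[OF chain, of i] that by simp
    then have "finite (C i)" using fin subgroup.subset finite_subset by blast
    moreover have "\<one> \<in> C (Suc i) \<inter> N"
      using subgroup.one_closed chain_subgroup[OF chain, of "Suc i"] that by auto
    moreover have max: "maximal_subgroup (C (Suc i)) (G\<lparr>carrier := C i\<rparr>)"
      using chain that by (simp add: unrefinable_chain_def)
    then have "C (Suc i) \<subseteq> C i" using maximal_subgroup_within[OF Ci] by auto
    ultimately have "card (\<phi> ` (C (Suc i) \<inter> N)) \<noteq> 0"
      by (metis card_eq_0_iff empty_iff finite_Int finite_imageI finite_subset image_is_empty)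
    then show ?thesis
      using normal_hom_maximal_index[OF fin N A hom conj Ci max]
      by (auto simp: prime_factorization_mult prime_factorization_prime)
  qed
  have "?f 0 \<le> ?f i + i" if "i \<le> t" for i
    using that
  proof (induction i)
    case (Suc i)
    then show ?case using step[of i] by simp
  qed simp
  from this[of t] have "?f 0 \<le> ?f t + t" by simp
  moreover have "C 0 \<inter> N = N" "C t \<inter> N = {\<one>}"
    using chain N.subset by (auto simp: unrefinable_chain_def)
  ultimately show ?thesis by simp
qed

section \<open>Finite groups with transitive commuting\<close>

text \<open>
  Commuting is assumed to be transitive on nontrivial elements; equivalently, the centralisers of
  nontrivial elements are abelian, and they partition the nontrivial elements.
\<close>

locale finite_ct_group = group +
  assumes finite_carrier: "finite (carrier G)"
    and commute_trans: "\<lbrakk>g \<in> carrier G; x \<in> carrier G; y \<in> carrier G; g \<noteq> \<one>;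
      g \<otimes> x = x \<otimes> g; g \<otimes> y = y \<otimes> g\<rbrakk> \<Longrightarrow> x \<otimes> y = y \<otimes> x"
begin

definition centralizer where "centralizer x = {g \<in> carrier G. g \<otimes> x = x \<otimes> g}"

definition conj_class where "conj_class x = (\<lambda>g. g \<otimes> x \<otimes> inv g) ` carrier G"

lemma card_conj_class: "x \<in> carrier G \<Longrightarrow> card (conj_class x) * card (centralizer x) = Coset.order G"
  unfolding conj_class_def centralizer_def by (rule conj_class_card)

lemma centralizer_eq:
  assumes "x \<in> carrier G" "x \<noteq> \<one>" "y \<in> centralizer x" "y \<noteq> \<one>"
  shows "centralizer y = centralizer x"
proof -
  have y: "y \<in> carrier G" "y \<otimes> x = x \<otimes> y" using assms(3) by (auto simp: centralizer_def)
  have "g \<otimes> y = y \<otimes> g \<longleftrightarrow> g \<otimes> x = x \<otimes> g" if g: "g \<in> carrier G" for g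
  proof
    assume "g \<otimes> y = y \<otimes> g"
    then show "g \<otimes> x = x \<otimes> g" using commute_trans[of y g x] y g assms by simp
  next
    assume "g \<otimes> x = x \<otimes> g"
    then show "g \<otimes> y = y \<otimes> g" using commute_trans[of x g y] y g assms by simp
  qed
  then show ?thesis by (auto simp: centralizer_def)
qed

lemma conj_one_iff:
  assumes g: "g \<in> carrier G" and x: "x \<in> carrier G"
  shows "g \<otimes> x \<otimes> inv g = \<one> \<longleftrightarrow> x = \<one>"
proof
  assume *: "g \<otimes> x \<otimes> inv g = \<one>"
  have "x = inv g \<otimes> (g \<otimes> x \<otimes> inv g) \<otimes> g" using g x by (simp add: m_assoc mult_inv_cancel)
  also have "\<dots> = \<one>" unfolding * using g by simp
  finally show "x = \<one>" .
qed (use g in simp)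

lemma conj_class_subset: "x \<in> carrier G \<Longrightarrow> x \<noteq> \<one> \<Longrightarrow> conj_class x \<subseteq> carrier G - {\<one>}"
  using conj_one_iff by (auto simp: conj_class_def)

lemma finite_conj_class: "x \<in> carrier G \<Longrightarrow> finite (conj_class x)"
  using finite_carrier by (simp add: conj_class_def)

text \<open>
  The union \<open>U x\<close> of the conjugates of the centraliser of \<open>x\<close>, without the identity, has
  \<open>(c - 1) * n / c\<close> elements, where \<open>n\<close> is the order of the group and \<open>c\<close> that of the centraliser: the
  hypothesis makes the conjugacy classes of the \<open>c - 1\<close> nontrivial elements of the centraliser distinct, and each
  has size \<open>n / c\<close>. As \<open>c \<ge> 2\<close>, this is at least \<open>n / 2\<close>. If the group were not abelian,
  some \<open>U a\<close> would leave out a nontrivial element \<open>z\<close>, and then \<open>U a\<close> and \<open>U z\<close>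
  would be disjoint, which is too much for \<open>n - 1\<close> elements.
\<close>

theorem commutative_if_no_fusion:
  assumes no_fusion: "\<And>g x. \<lbrakk>g \<in> carrier G; x \<in> carrier G; x \<noteq> \<one>;
      x \<otimes> (g \<otimes> x \<otimes> inv g) = (g \<otimes> x \<otimes> inv g) \<otimes> x\<rbrakk> \<Longrightarrow> g \<otimes> x \<otimes> inv g = x"
    and ab: "a \<in> carrier G" "b \<in> carrier G"
  shows "a \<otimes> b = b \<otimes> a"
proof (rule ccontr)
  assume nc: "a \<otimes> b \<noteq> b \<otimes> a"
  let ?n = "card (carrier G)"
  define U where "U x = (\<Union>y\<in>centralizer x - {\<one>}. conj_class y)" for x
  have finc: "finite (centralizer x)" for x using finite_carrier by (simp add: centralizer_def)
  have U_sub: "U x \<subseteq> carrier G - {\<one>}" if "x \<in> carrier G" for x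
    using conj_class_subset unfolding U_def centralizer_def by blast
  have cardU: "card (U x) * card (centralizer x) = (card (centralizer x) - 1) * ?n"
    if x: "x \<in> carrier G" "x \<noteq> \<one>" for x
  proof -
    have disj: "conj_class y \<inter> conj_class z = {}" if yz: "y \<in> centralizer x - {\<one>}" "z \<in> centralizer x - {\<one>}" "y \<noteq> z" for y z
    proof (rule ccontr)
      assume "conj_class y \<inter> conj_class z \<noteq> {}"
      then obtain g h where gh: "g \<in> carrier G" "h \<in> carrier G" "g \<otimes> y \<otimes> inv g = h \<otimes> z \<otimes> inv h"
        by (auto simp: conj_class_def)
      have cl: "y \<in> carrier G" "z \<in> carrier G" using yz by (auto simp: centralizer_def)
      have "(inv h \<otimes> g) \<otimes> y \<otimes> inv (inv h \<otimes> g) = inv h \<otimes> (g \<otimes> y \<otimes> inv g) \<otimes> h"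
        using gh(1,2) cl by (simp add: m_assoc inv_mult_group)
      also have "\<dots> = z" unfolding gh(3) using gh(1,2) cl by (simp add: m_assoc mult_inv_cancel)
      finally have z: "(inv h \<otimes> g) \<otimes> y \<otimes> inv (inv h \<otimes> g) = z" .
      have "y \<otimes> z = z \<otimes> y"
        using commute_trans[of x y z] yz x by (auto simp: centralizer_def)
      then show False using no_fusion[of "inv h \<otimes> g" y] z gh cl yz by auto
    qed
    have "card (U x) = (\<Sum>y\<in>centralizer x - {\<one>}. card (conj_class y))"
      unfolding U_def using finc disj finite_conj_class by (intro card_UN_disjoint) (auto simp: centralizer_def)
    then have "card (U x) * card (centralizer x) = (\<Sum>y\<in>centralizer x - {\<one>}. card (conj_class y) * card (centralizer x))"
      by (simp add: sum_distrib_right)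
    also have "\<dots> = (\<Sum>y\<in>centralizer x - {\<one>}. ?n)"
    proof (rule sum.cong)
      fix y assume y: "y \<in> centralizer x - {\<one>}"
      then show "card (conj_class y) * card (centralizer x) = ?n"
        using card_conj_class[of y] centralizer_eq[of x y] x by (auto simp: Coset.order_def centralizer_def)
    qed simp
    also have "\<dots> = (card (centralizer x) - 1) * ?n"
      using x finc by (simp add: card_Diff_singleton_if centralizer_def)
    finally show ?thesis .
  qed
  have c2: "card (centralizer x) \<ge> 2" if x: "x \<in> carrier G" "x \<noteq> \<one>" for x
  proof -
    have "card {\<one>, x} \<le> card (centralizer x)" using x finc by (intro card_mono) (auto simp: centralizer_def)
    then show ?thesis using x by auto
  qed
  have half: "?n \<le> 2 * card (U x)" if x: "x \<in> carrier G" "x \<noteq> \<one>" for x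
  proof -
    have "card (centralizer x) \<le> 2 * (card (centralizer x) - 1)" using c2[OF x] by simp
    then have "card (centralizer x) * ?n \<le> 2 * (card (centralizer x) - 1) * ?n" by (rule mult_le_mono1)
    also have "\<dots> = card (centralizer x) * (2 * card (U x))" using cardU[OF x] by (simp add: mult_ac)
    finally show ?thesis using c2[OF x] by simp
  qed
  have a1: "a \<noteq> \<one>" using nc ab by auto
  have "U a \<noteq> carrier G - {\<one>}"
  proof
    assume "U a = carrier G - {\<one>}"
    then have "card (U a) = ?n - 1" using finite_carrier by simp
    then have "(?n - 1) * card (centralizer a) = (card (centralizer a) - 1) * ?n"
      using cardU[OF ab(1) a1] by simp
    moreover have "card (centralizer a) \<ge> 1" using c2[OF ab(1) a1] by simp
    then obtain c where c: "card (centralizer a) = Suc c" by (cases "card (centralizer a)") auto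
    moreover have "?n \<noteq> 0" using finite_carrier one_closed by auto
    then obtain m where "?n = Suc m" by (cases ?n) auto
    ultimately have "card (centralizer a) = ?n" by simp
    then have "centralizer a = carrier G" using finite_carrier by (intro card_subset_eq) (auto simp: centralizer_def)
    then have "b \<in> centralizer a" using ab by simp
    then show False using nc by (simp add: centralizer_def)
  qed
  then obtain z where z: "z \<in> carrier G" "z \<noteq> \<one>" "z \<notin> U a" using U_sub[OF ab(1)] by blast
  have "U z \<inter> U a = {}"
  proof (rule ccontr)
    assume "U z \<inter> U a \<noteq> {}"
    then obtain w where "w \<in> U z" "w \<in> U a" by blast
    then obtain y y' g h where y: "y \<in> centralizer a - {\<one>}" "y' \<in> centralizer z - {\<one>}"
      and gh: "g \<in> carrier G" "h \<in> carrier G" "g \<otimes> y \<otimes> inv g = h \<otimes> y' \<otimes> inv h"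
      unfolding U_def conj_class_def by (elim UN_E imageE) metis
    have cl: "y \<in> carrier G" "y' \<in> carrier G" using y by (auto simp: centralizer_def)
    define k where "k = inv h \<otimes> g"
    have k: "k \<in> carrier G" using gh by (simp add: k_def)
    have "k \<otimes> y \<otimes> inv k = inv h \<otimes> (g \<otimes> y \<otimes> inv g) \<otimes> h"
      unfolding k_def using gh(1,2) cl by (simp add: m_assoc inv_mult_group)
    also have "\<dots> = y'" unfolding gh(3) using gh(1,2) cl by (simp add: m_assoc mult_inv_cancel)
    finally have y': "k \<otimes> y \<otimes> inv k = y'" .
    define w where "w = inv k \<otimes> z \<otimes> k"
    have wc: "w \<in> carrier G" using k z by (simp add: w_def)
    have zw: "z = k \<otimes> w \<otimes> inv k" unfolding w_def using k z by (simp add: m_assoc mult_inv_cancel)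
    have "y' \<otimes> z = z \<otimes> y'" using y z by (auto simp: centralizer_def)
    then have "inv k \<otimes> (y' \<otimes> z) \<otimes> k = inv k \<otimes> (z \<otimes> y') \<otimes> k" by simp
    moreover have "inv k \<otimes> (y' \<otimes> z) \<otimes> k = y \<otimes> w"
      unfolding y'[symmetric] w_def using k cl(1) z(1) by (simp add: m_assoc mult_inv_cancel)
    moreover have "inv k \<otimes> (z \<otimes> y') \<otimes> k = w \<otimes> y"
      unfolding y'[symmetric] w_def using k cl(1) z(1) by (simp add: m_assoc mult_inv_cancel)
    ultimately have "y \<otimes> w = w \<otimes> y" by simp
    moreover have "y \<otimes> a = a \<otimes> y" using y by (auto simp: centralizer_def)
    ultimately have "w \<otimes> a = a \<otimes> w" using commute_trans[of y w a] wc cl ab y by auto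
    then have "w \<in> centralizer a" using wc by (simp add: centralizer_def)
    moreover have "w \<noteq> \<one>" using zw z(2) k by auto
    moreover have "z \<in> conj_class w" using zw k by (auto simp: conj_class_def)
    ultimately have "z \<in> U a" unfolding U_def by blast
    then show False using z(3) by simp
  qed
  then have "card (U z) + card (U a) = card (U z \<union> U a)"
    using U_sub z ab finite_carrier by (intro card_Un_disjoint[symmetric]) (meson finite_Diff finite_subset)+
  also have "\<dots> \<le> card (carrier G - {\<one>})"
    using U_sub z ab finite_carrier by (intro card_mono) auto
  also have "\<dots> < ?n" using finite_carrier by (intro psubset_card_mono) auto
  finally show False using half[OF z(1,2)] half[OF ab(1) a1] by simp
qed

definition involution where "involution x \<longleftrightarrow> x \<in> carrier G \<and> x \<noteq> \<one> \<and> x \<otimes> x = \<one>"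

lemma square_cancel:
  assumes "x \<in> carrier G" "y \<in> carrier G" "x \<otimes> x = \<one>"
  shows "x \<otimes> (x \<otimes> y) = y"
  using assms by (simp add: m_assoc[symmetric])

lemma commute_if_square_one:
  assumes cl: "x \<in> carrier G" "y \<in> carrier G" and sq: "x \<otimes> x = \<one>" "y \<otimes> y = \<one>"
    and xy: "x \<otimes> y \<otimes> (x \<otimes> y) = \<one>"
  shows "y \<otimes> x = x \<otimes> y"
proof -
  have "y \<otimes> x = x \<otimes> (x \<otimes> y \<otimes> (x \<otimes> y)) \<otimes> y" using cl sq(2) by (simp add: m_assoc square_cancel[OF _ _ sq(1)])
  then show ?thesis using cl by (simp add: xy)
qed

lemma conj_involution: "involution x \<Longrightarrow> g \<in> carrier G \<Longrightarrow> involution (g \<otimes> x \<otimes> inv g)"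
proof -
  assume x: "involution x" and g: "g \<in> carrier G"
  have "(g \<otimes> x \<otimes> inv g) \<otimes> (g \<otimes> x \<otimes> inv g) = g \<otimes> (x \<otimes> x) \<otimes> inv g"
  proof -
    have "x \<in> carrier G" using x by (simp add: involution_def)
    then show ?thesis using g by (simp add: m_assoc mult_inv_cancel)
  qed
  then show ?thesis using x g by (simp add: involution_def conj_one_iff)
qed

text \<open>
  The involutions \<open>t\<close> and \<open>u\<close> generate a dihedral group with rotation \<open>r = u t\<close>. If \<open>r\<close> had even order,
  a power of it would be an involution commuting with \<open>r\<close>, forcing \<open>r\<^sup>2 = 1\<close> and hence that \<open>t\<close> and
  \<open>u\<close> commute. So the order of \<open>r\<close> is odd, say \<open>2 j + 1\<close>, and \<open>r ^ (j + 1)\<close> conjugates \<open>t\<close> to \<open>u\<close>.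
\<close>

theorem involutions_conjugate:
  assumes t: "involution t" and u: "involution u" and nc: "t \<otimes> u \<noteq> u \<otimes> t"
    and sq: "\<And>z x. involution z \<Longrightarrow> x \<in> carrier G \<Longrightarrow> z \<otimes> x = x \<otimes> z \<Longrightarrow> x \<otimes> x = \<one>"
  shows "\<exists>g \<in> carrier G. u = g \<otimes> t \<otimes> inv g"
proof -
  have cl: "t \<in> carrier G" "u \<in> carrier G" and tt: "t \<otimes> t = \<one>" and uu: "u \<otimes> u = \<one>"
    using t u by (auto simp: involution_def)
  define r where "r = u \<otimes> t"
  have r: "r \<in> carrier G" using cl by (simp add: r_def)
  have trt: "t \<otimes> r [^] (i::nat) \<otimes> t = inv (r [^] i)" for i
  proof (induction i)
    case 0 then show ?case using cl tt by simp
  next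
    case (Suc i)
    have 1: "t \<otimes> r \<otimes> t = inv r"
      unfolding r_def using cl tt uu
      by (simp add: m_assoc inv_mult_group inv_unique'[OF cl(1) cl(1) tt tt, symmetric] inv_unique'[OF cl(2) cl(2) uu uu, symmetric])
    have "t \<otimes> r [^] Suc i \<otimes> t = (t \<otimes> r [^] i \<otimes> t) \<otimes> (t \<otimes> r \<otimes> t)"
      using cl r tt by (simp add: m_assoc) (simp add: m_assoc[symmetric])
    also have "\<dots> = inv (r [^] i) \<otimes> inv r" using Suc 1 by simp
    also have "\<dots> = inv (r [^] Suc i)" using r by (simp add: inv_mult_group[symmetric] nat_pow_Suc2[symmetric] del: nat_pow_Suc)
    finally show ?case .
  qed
  have odd: "odd (ord r)"
  proof
    assume "even (ord r)"
    then obtain j where j: "ord r = 2 * j" by auto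
    have "ord r \<ge> 1" using ord_ge_1[OF finite_carrier r] .
    then have j0: "0 < j" "j < ord r" using j by auto
    define z where "z = r [^] j"
    have "z \<noteq> \<one>" using j0 pow_eq_id[OF r, of j] by (auto simp: z_def dest: dvd_imp_le)
    moreover have "z \<otimes> z = \<one>" using pow_ord_eq_1[OF r] r j by (simp add: z_def nat_pow_mult mult_2)
    ultimately have "involution z" using r by (simp add: involution_def z_def)
    moreover have "z \<otimes> r = r \<otimes> z" using r by (simp add: z_def nat_pow_comm[of r j 1, simplified])
    ultimately have "r \<otimes> r = \<one>" using sq r by blast
    then have "u \<otimes> t \<otimes> (u \<otimes> t) = \<one>" by (simp add: r_def)
    then have "u \<otimes> (u \<otimes> t \<otimes> (u \<otimes> t)) \<otimes> t = u \<otimes> t" using cl by simp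
    moreover have "u \<otimes> (u \<otimes> t \<otimes> (u \<otimes> t)) \<otimes> t = (u \<otimes> u) \<otimes> t \<otimes> u \<otimes> (t \<otimes> t)" using cl by (simp add: m_assoc)
    ultimately show False using nc tt uu cl by simp
  qed
  then obtain j where j: "ord r = Suc (2 * j)" by (auto elim: oddE)
  define g where "g = r [^] Suc j"
  have g: "g \<in> carrier G" using r by (simp add: g_def)
  have "inv g = t \<otimes> g \<otimes> t" unfolding g_def by (rule trt[symmetric])
  then have "g \<otimes> t \<otimes> inv g = g \<otimes> t \<otimes> (t \<otimes> g \<otimes> t)" by simp
  also have "\<dots> = g \<otimes> (t \<otimes> t) \<otimes> g \<otimes> t" using g cl by (simp add: m_assoc)
  also have "\<dots> = (g \<otimes> g) \<otimes> t" using g cl tt by simp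
  also have "g \<otimes> g = r [^] (Suc j + Suc j)" unfolding g_def by (rule nat_pow_mult[OF r])
  also have "Suc j + Suc j = ord r + 1" using j by simp
  also have "r [^] (ord r + 1) = r [^] ord r \<otimes> r" by simp
  also have "\<dots> = r" using r pow_ord_eq_1[OF r] by simp
  also have "r \<otimes> t = u" unfolding r_def using cl tt by (simp add: m_assoc)
  finally show ?thesis using g by (intro bexI[of _ g]) simp
qed

text \<open>
  Let \<open>Q\<close> be the centraliser of \<open>t\<close>, of order \<open>s\<close>, and let \<open>B\<close> consist of the \<open>g\<close> that conjugate \<open>t\<close> into \<open>Q\<close>.
  There are \<open>n / s\<close> involutions, \<open>s - 1\<close> of them in \<open>B\<close>, and \<open>B\<close> has order \<open>s * (s - 1)\<close>. Hence the
  number of involutions outside \<open>B\<close> equals the number of cosets of \<open>Q\<close> outside \<open>B\<close>. No such coset contains two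
  involutions \<open>v\<close> and \<open>v z\<close>, because then \<open>v\<close> would commute with \<open>z\<close>, hence with \<open>t\<close>. So every such
  coset contains exactly one. For \<open>SL\<^sub>2\<close> in characteristic two, \<open>B\<close> is the stabiliser of the point
  of the projective line that is fixed by \<open>t\<close>.
\<close>

theorem coset_meets_involutions:
  assumes t: "involution t"
    and conj: "\<And>u. involution u \<Longrightarrow> \<exists>g\<in>carrier G. u = g \<otimes> t \<otimes> inv g"
    and elem: "\<And>y. y \<in> centralizer t \<Longrightarrow> y \<otimes> y = \<one>"
    and h: "h \<in> carrier G" "h \<otimes> t \<otimes> inv h \<notin> centralizer t"
  shows "\<exists>y\<in>centralizer t. involution (h \<otimes> y)"
proof -
  define B where "B = {g \<in> carrier G. g \<otimes> t \<otimes> inv g \<in> centralizer t}"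
  define I where "I = {u. involution u}"
  have tc: "t \<in> carrier G" "t \<noteq> \<one>" "t \<otimes> t = \<one>" using t by (auto simp: involution_def)
  have finc: "finite (centralizer t)" using finite_carrier by (simp add: centralizer_def)
  have inv_cls: "I = conj_class t"
    using conj conj_involution[OF t] by (auto simp: I_def conj_class_def)
  have finI: "finite I" unfolding inv_cls by (rule finite_conj_class[OF tc(1)])
  have cI: "card I * card (centralizer t) = Coset.order G"
    unfolding inv_cls by (rule card_conj_class[OF tc(1)])
  have cent_mult: "x \<otimes> y \<in> centralizer t" if "x \<in> centralizer t" "y \<in> centralizer t" for x y
  proof -
    have cl: "x \<in> carrier G" "y \<in> carrier G" and c: "x \<otimes> t = t \<otimes> x" "y \<otimes> t = t \<otimes> y"
      using that by (auto simp: centralizer_def)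
    have "x \<otimes> y \<otimes> t = x \<otimes> (t \<otimes> y)" using cl tc c by (simp add: m_assoc)
    also have "\<dots> = t \<otimes> (x \<otimes> y)" using cl tc c(1) by (simp add: m_assoc[symmetric])
    finally show ?thesis using cl by (simp add: centralizer_def)
  qed
  have Bsub: "subgroup B G"
  proof (rule finite_closed_subgroup)
    show "B \<subseteq> carrier G" by (auto simp: B_def)
    show "finite B" using finite_carrier by (simp add: B_def)
    have "t \<in> B" using tc by (simp add: B_def centralizer_def m_assoc)
    then show "B \<noteq> {}" by blast
    fix g k assume "g \<in> B" "k \<in> B"
    then have g: "g \<in> carrier G" "g \<otimes> t \<otimes> inv g \<in> centralizer t" and k: "k \<in> carrier G" "k \<otimes> t \<otimes> inv k \<in> centralizer t"
      by (auto simp: B_def)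
    have ktk: "k \<otimes> t \<otimes> inv k \<noteq> \<one>" "g \<otimes> t \<otimes> inv g \<noteq> \<one>"
      using conj_one_iff tc g k by auto
    \<comment> \<open>The conjugate \<open>s\<close> of \<open>t\<close> by \<open>k\<close> commutes with \<open>t\<close>, so its conjugate by \<open>g\<close> commutes with \<open>p\<close>,
      and \<open>p\<close> commutes with \<open>t\<close>.\<close>
    define p where "p = g \<otimes> t \<otimes> inv g"
    define s where "s = k \<otimes> t \<otimes> inv k"
    have ps: "p \<in> carrier G" "s \<in> carrier G" using g k tc by (auto simp: p_def s_def)
    have "s \<otimes> t = t \<otimes> s" using k(2) by (simp add: s_def centralizer_def)
    then have "g \<otimes> (s \<otimes> t) \<otimes> inv g = g \<otimes> (t \<otimes> s) \<otimes> inv g" by simp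
    then have "(g \<otimes> s \<otimes> inv g) \<otimes> p = p \<otimes> (g \<otimes> s \<otimes> inv g)"
      unfolding p_def using g ps tc by (simp add: m_assoc mult_inv_cancel)
    moreover have "p \<otimes> t = t \<otimes> p" using g(2) by (simp add: p_def centralizer_def)
    ultimately have "(g \<otimes> s \<otimes> inv g) \<otimes> t = t \<otimes> (g \<otimes> s \<otimes> inv g)"
      using commute_trans[of p "g \<otimes> s \<otimes> inv g" t] ps g tc ktk by (simp add: p_def)
    moreover have "g \<otimes> k \<otimes> t \<otimes> inv (g \<otimes> k) = g \<otimes> s \<otimes> inv g"
      unfolding s_def using g k tc by (simp add: inv_mult_group m_assoc)
    ultimately show "g \<otimes> k \<in> B" using g k ps by (simp add: B_def centralizer_def)
  qed
  have B_iff: "g \<in> B \<longleftrightarrow> g \<in> carrier G \<and> g \<otimes> t \<otimes> inv g \<in> centralizer t" for g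
    by (simp add: B_def)
  have centB: "centralizer t \<subseteq> B"
  proof
    fix g assume "g \<in> centralizer t"
    then have g: "g \<in> carrier G" "g \<otimes> t = t \<otimes> g" by (auto simp: centralizer_def)
    have "g \<otimes> t \<otimes> inv g = t" unfolding g(2) using g(1) tc by (simp add: m_assoc)
    then show "g \<in> B" using g(1) tc by (simp add: B_iff centralizer_def)
  qed
  have invB: "u \<in> I \<and> u \<in> B \<longleftrightarrow> u \<in> centralizer t - {\<one>}" for u
  proof
    assume u: "u \<in> I \<and> u \<in> B"
    then have uc: "u \<in> carrier G" "u \<otimes> u = \<one>" "u \<noteq> \<one>" and c: "u \<otimes> t \<otimes> inv u \<in> centralizer t"
      using B_iff by (auto simp: I_def involution_def)
    have iu: "inv u = u" using uc by (simp add: inv_equality)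
    have "(u \<otimes> t \<otimes> u) \<otimes> t = t \<otimes> (u \<otimes> t \<otimes> u)" using c iu by (simp add: centralizer_def)
    \<comment> \<open>If \<open>u t u\<close> commutes with \<open>t\<close>, then \<open>e = u t u t\<close> commutes with both \<open>t\<close> and \<open>u\<close>.\<close>
    define e where "e = u \<otimes> t \<otimes> u \<otimes> t"
    have ec: "e \<in> carrier G" using uc tc by (simp add: e_def)
    have e': "e = t \<otimes> (u \<otimes> t \<otimes> u)" unfolding e_def using \<open>(u \<otimes> t \<otimes> u) \<otimes> t = _\<close> .
    have et: "e \<otimes> t = t \<otimes> e"
    proof -
      have "e \<otimes> t = t \<otimes> (u \<otimes> t \<otimes> u) \<otimes> t" using e' by simp
      also have "\<dots> = t \<otimes> e" unfolding e_def using uc tc by (simp add: m_assoc)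
      finally show ?thesis .
    qed
    have eu: "e \<otimes> u = u \<otimes> e"
    proof -
      have "u \<otimes> e = t \<otimes> u \<otimes> t" unfolding e_def using uc tc by (simp add: m_assoc square_cancel)
      also have "\<dots> = t \<otimes> (u \<otimes> t \<otimes> u) \<otimes> u" using uc tc by (simp add: m_assoc)
      also have "\<dots> = e \<otimes> u" using e' by simp
      finally show ?thesis by simp
    qed
    have "u \<otimes> t = t \<otimes> u"
    proof (cases "e = \<one>")
      case True
      then show ?thesis using commute_if_square_one[of u t] uc tc by (simp add: e_def m_assoc)
    next
      case False
      then show ?thesis using commute_trans[of e u t] ec uc tc et eu by simp
    qed
    then show "u \<in> centralizer t - {\<one>}" using uc by (simp add: centralizer_def)
  next
    assume u: "u \<in> centralizer t - {\<one>}"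
    then have "u \<otimes> u = \<one>" using elem by blast
    then show "u \<in> I \<and> u \<in> B" using u centB by (auto simp: I_def involution_def centralizer_def)
  qed
  \<comment> \<open>\<open>B\<close> acts transitively on the involutions in the centraliser of \<open>t\<close>, which is the stabiliser of \<open>t\<close>.\<close>
  have cB: "card B = (card (centralizer t) - 1) * card (centralizer t)"
  proof -
    interpret BG: group "G\<lparr>carrier := B\<rparr>" by (rule subgroup_imp_group[OF Bsub])
    have tB: "t \<in> B" using centB tc by (auto simp: centralizer_def)
    have 1: "(\<lambda>g. g \<otimes> t \<otimes> inv\<^bsub>G\<lparr>carrier := B\<rparr>\<^esub> g) ` B = centralizer t - {\<one>}"
    proof -
      have "(\<lambda>g. g \<otimes> t \<otimes> inv\<^bsub>G\<lparr>carrier := B\<rparr>\<^esub> g) ` B = (\<lambda>g. g \<otimes> t \<otimes> inv g) ` B"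
        by (intro image_cong) (auto simp: m_inv_consistent[OF Bsub])
      also have "\<dots> = centralizer t - {\<one>}"
      proof safe
        fix g assume "g \<in> B"
        then show "g \<otimes> t \<otimes> inv g \<in> centralizer t" by (simp add: B_iff)
        show "g \<otimes> t \<otimes> inv g = \<one> \<Longrightarrow> False" using conj_one_iff[of g t] tc \<open>g \<in> B\<close> by (simp add: B_iff)
      next
        fix u assume u: "u \<in> centralizer t" "u \<notin> (\<lambda>g. g \<otimes> t \<otimes> inv g) ` B"
        show "u = \<one>"
        proof (rule ccontr)
          assume "u \<noteq> \<one>"
          then have "u \<in> I" using u invB[of u] by simp
          then obtain g where g: "g \<in> carrier G" "u = g \<otimes> t \<otimes> inv g" using conj by (auto simp: I_def)
          then have "g \<in> B" using u(1) B_iff by blast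
          then show False using u g by blast
        qed
      qed
      finally show ?thesis .
    qed
    have 2: "{g \<in> B. g \<otimes> t = t \<otimes> g} = centralizer t"
      using centB subgroup.subset[OF Bsub] by (auto simp: centralizer_def)
    show ?thesis
      using BG.conj_class_card[of t] tB 1 2 finc by (simp add: Coset.order_def card_Diff_singleton_if centralizer_def tc)
  qed
    let ?J = "I - B"
  have "card ?J * card (centralizer t) = card (carrier G - B)"
  proof -
    have "I \<inter> B = centralizer t - {\<one>}" using invB by auto
    then have "card ?J = card I - (card (centralizer t) - 1)"
      using finI finc card_Diff_subset_Int[of I B] by (simp add: centralizer_def tc card_Diff_singleton_if)
    then have "card ?J * card (centralizer t) = Coset.order G - card B"
      using cI cB by (simp add: diff_mult_distrib)
    then show ?thesis using finite_carrier subgroup.subset[OF Bsub] by (simp add: card_Diff_subset Coset.order_def finite_subset)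
  qed
  moreover have "inj_on (\<lambda>(v, y). v \<otimes> y) (?J \<times> centralizer t)"
  proof (rule inj_onI, safe)
    fix v y v' y' assume *: "v \<in> I" "v \<notin> B" "y \<in> centralizer t" "v' \<in> I" "v' \<notin> B" "y' \<in> centralizer t" "v \<otimes> y = v' \<otimes> y'"
    have vc: "v \<in> carrier G" "v' \<in> carrier G" "v \<otimes> v = \<one>" "v' \<otimes> v' = \<one>"
      and yc: "y \<in> carrier G" "y' \<in> carrier G"
      using * by (auto simp: I_def involution_def centralizer_def)
    define z where "z = y \<otimes> y'"
    have zc: "z \<in> centralizer t" using cent_mult * by (simp add: z_def)
    then have zG: "z \<in> carrier G" and zz: "z \<otimes> z = \<one>" using elem by (auto simp: centralizer_def)
    have "v \<otimes> y \<otimes> y' = v' \<otimes> (y' \<otimes> y')" unfolding *(7) using vc yc by (simp add: m_assoc)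
    then have v'eq: "v' = v \<otimes> z" using elem[OF *(6)] vc yc by (simp add: z_def m_assoc)
    have z1: "z = \<one>"
    proof (rule ccontr)
      assume z1: "z \<noteq> \<one>"
      have "z \<otimes> v = v \<otimes> z"
        using commute_if_square_one[of v z] vc zz zG unfolding v'eq by simp
      moreover have "z \<otimes> t = t \<otimes> z" using zc by (simp add: centralizer_def)
      ultimately have "v \<otimes> t = t \<otimes> v" using commute_trans[of z v t] z1 vc zG tc by simp
      then have "v \<in> centralizer t" using vc by (simp add: centralizer_def)
      then show False using centB *(2) by blast
    qed
    then show vv: "v = v'" using v'eq vc by simp
    show "y = y'" using *(7) vv vc yc by simp
  qed
  ultimately have "card ((\<lambda>(v, y). v \<otimes> y) ` (?J \<times> centralizer t)) = card (carrier G - B)"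
    by (simp add: card_image card_cartesian_product)
  moreover have "(\<lambda>(v, y). v \<otimes> y) ` (?J \<times> centralizer t) \<subseteq> carrier G - B"
  proof safe
    fix v y assume *: "v \<in> I" "v \<notin> B" "y \<in> centralizer t"
    then have vy: "v \<in> carrier G" "y \<in> carrier G" "y \<in> B" using centB by (auto simp: I_def involution_def centralizer_def)
    then show "v \<otimes> y \<in> carrier G" by simp
    assume "v \<otimes> y \<in> B"
    then have "v \<otimes> y \<otimes> inv y \<in> B"
      using vy subgroup.m_closed[OF Bsub] subgroup.m_inv_closed[OF Bsub] by blast
    then show False using *(2) vy by (simp add: m_assoc)
  qed
  ultimately have "(\<lambda>(v, y). v \<otimes> y) ` (?J \<times> centralizer t) = carrier G - B"
    using finite_carrier by (intro card_subset_eq) auto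
  moreover have "h \<in> carrier G - B" using h by (simp add: B_iff)
  ultimately have "h \<in> (\<lambda>(v, y). v \<otimes> y) ` (?J \<times> centralizer t)" by blast
  then obtain v y where vy: "v \<in> ?J" "y \<in> centralizer t" "h = v \<otimes> y" by (elim imageE) auto
  then have v: "involution v" "v \<in> carrier G" "y \<in> carrier G"
    by (auto simp: I_def involution_def centralizer_def)
  then have "h \<otimes> y = v" using elem[OF vy(2)] by (simp add: vy(3) m_assoc)
  then show ?thesis using vy(2) v(1) by (intro bexI[of _ y]) simp_all
qed

lemma commuting_conj_iff:
  assumes "g \<in> carrier G" "x \<in> carrier G" "y \<in> carrier G"
  shows "(g \<otimes> x \<otimes> inv g) \<otimes> y = y \<otimes> (g \<otimes> x \<otimes> inv g) \<longleftrightarrow>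
    x \<otimes> (inv g \<otimes> y \<otimes> g) = (inv g \<otimes> y \<otimes> g) \<otimes> x"
proof
  assume "(g \<otimes> x \<otimes> inv g) \<otimes> y = y \<otimes> (g \<otimes> x \<otimes> inv g)"
  then have "inv g \<otimes> ((g \<otimes> x \<otimes> inv g) \<otimes> y) \<otimes> g = inv g \<otimes> (y \<otimes> (g \<otimes> x \<otimes> inv g)) \<otimes> g" by simp
  then show "x \<otimes> (inv g \<otimes> y \<otimes> g) = (inv g \<otimes> y \<otimes> g) \<otimes> x"
    using assms by (simp add: m_assoc mult_inv_cancel)
next
  assume "x \<otimes> (inv g \<otimes> y \<otimes> g) = (inv g \<otimes> y \<otimes> g) \<otimes> x"
  then have "g \<otimes> (x \<otimes> (inv g \<otimes> y \<otimes> g)) \<otimes> inv g = g \<otimes> ((inv g \<otimes> y \<otimes> g) \<otimes> x) \<otimes> inv g" by simp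
  then show "(g \<otimes> x \<otimes> inv g) \<otimes> y = y \<otimes> (g \<otimes> x \<otimes> inv g)"
    using assms by (simp add: m_assoc mult_inv_cancel)
qed

lemma involution_closed: "involution x \<Longrightarrow> x \<in> carrier G"
  by (simp add: involution_def)

text \<open>
  An involution that commutes with \<open>t\<close> does not commute with \<open>v\<close>, so it is conjugate to \<open>v\<close>
  and thereby to \<open>t\<close>.
\<close>

corollary all_involutions_conjugate:
  assumes t: "involution t" and v: "involution v" and nc: "t \<otimes> v \<noteq> v \<otimes> t"
    and sq: "\<And>z x. involution z \<Longrightarrow> x \<in> carrier G \<Longrightarrow> z \<otimes> x = x \<otimes> z \<Longrightarrow> x \<otimes> x = \<one>"
    and u: "involution u"
  shows "\<exists>g \<in> carrier G. u = g \<otimes> t \<otimes> inv g"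
proof (cases "t \<otimes> u = u \<otimes> t")
  case False
  then show ?thesis using involutions_conjugate[OF t u False] sq by blast
next
  case True
  have cl: "t \<in> carrier G" "u \<in> carrier G" "v \<in> carrier G"
    using t u v by (simp_all add: involution_closed)
  have "v \<otimes> u \<noteq> u \<otimes> v"
    using commute_trans[of u t v] nc True u cl by (auto simp: involution_def)
  then obtain g where g: "g \<in> carrier G" "u = g \<otimes> v \<otimes> inv g"
    using involutions_conjugate[OF v u] sq by blast
  obtain h where h: "h \<in> carrier G" "v = h \<otimes> t \<otimes> inv h"
    using involutions_conjugate[OF t v nc] sq by blast
  have "u = (g \<otimes> h) \<otimes> t \<otimes> inv (g \<otimes> h)"
    unfolding g(2) h(2) using g(1) h(1) cl(1) by (simp add: m_assoc inv_mult_group)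
  then show ?thesis using g h by (intro bexI[of _ "g \<otimes> h"]) auto
qed

text \<open>
  By \<open>coset_meets_involutions\<close>, if \<open>h\<^sup>2\<close> is nontrivial and \<open>s\<close> is an involution, then \<open>h s\<close> is an
  involution, which means that \<open>s\<close> inverts \<open>h\<close>. Such an \<open>h\<close> is inverted by both \<open>t\<close> and
  \<open>v\<close>, so it commutes with the rotation \<open>x = v t\<close>; an involution other than \<open>t\<close> is the product of such an
  element with \<open>t\<close> and so inverts \<open>x\<close>.
\<close>

theorem dihedral_if_small_centralizer:
  assumes t: "involution t" and v: "involution v" and nc: "t \<otimes> v \<noteq> v \<otimes> t"
    and sq: "\<And>z x. involution z \<Longrightarrow> x \<in> carrier G \<Longrightarrow> z \<otimes> x = x \<otimes> z \<Longrightarrow> x \<otimes> x = \<one>"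
    and cent_t: "centralizer t = {\<one>, t}"
  shows "\<exists>x\<in>carrier G. x \<otimes> x \<noteq> \<one> \<and> (\<forall>h\<in>carrier G. h \<otimes> x = x \<otimes> h \<or> h \<otimes> x = inv x \<otimes> h)"
proof -
  have tc: "t \<in> carrier G" "t \<otimes> t = \<one>" "t \<noteq> \<one>" and vc: "v \<in> carrier G" "v \<otimes> v = \<one>" "v \<noteq> \<one>"
    using t v by (auto simp: involution_def)
  have conj: "\<exists>g\<in>carrier G. u = g \<otimes> t \<otimes> inv g" if "involution u" for u
    using all_involutions_conjugate[OF t v nc _ that] sq by simp
  have cent_conj: "centralizer s = {\<one>, s}" if s: "involution s" for s
  proof -
    obtain g where g: "g \<in> carrier G" "s = g \<otimes> t \<otimes> inv g" using conj[OF s] by blast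
    have "y = \<one> \<or> y = s" if "y \<in> centralizer s" for y
    proof -
      have y: "y \<in> carrier G" "y \<otimes> s = s \<otimes> y" using that by (auto simp: centralizer_def)
      then have "inv g \<otimes> y \<otimes> g \<in> centralizer t"
        using commuting_conj_iff[OF g(1) tc(1) y(1)] g by (simp add: centralizer_def)
      then have cases: "inv g \<otimes> y \<otimes> g = \<one> \<or> inv g \<otimes> y \<otimes> g = t" using cent_t by blast
      have yy: "y = g \<otimes> (inv g \<otimes> y \<otimes> g) \<otimes> inv g"
        using g(1) y(1) by (simp add: m_assoc mult_inv_cancel)
      show ?thesis
        using cases
      proof
        assume e: "inv g \<otimes> y \<otimes> g = \<one>"
        show ?thesis using yy unfolding e using g(1) by simp
      next
        assume e: "inv g \<otimes> y \<otimes> g = t"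
        show ?thesis using yy unfolding e g(2) ..
      qed
    qed
    moreover have "\<one> \<in> centralizer s" "s \<in> centralizer s" using s by (auto simp: centralizer_def involution_def)
    ultimately show ?thesis by blast
  qed
  have conj_any: "\<exists>g\<in>carrier G. u = g \<otimes> s \<otimes> inv g" if s: "involution s" and u: "involution u" for s u
  proof -
    obtain g where g: "g \<in> carrier G" "u = g \<otimes> t \<otimes> inv g" using conj[OF u] by blast
    obtain k where k: "k \<in> carrier G" "s = k \<otimes> t \<otimes> inv k" using conj[OF s] by blast
    have "u = (g \<otimes> inv k) \<otimes> s \<otimes> inv (g \<otimes> inv k)"
      unfolding g(2) k(2) using g(1) k(1) tc by (simp add: m_assoc inv_mult_group mult_inv_cancel)
    then show ?thesis using g k by (intro bexI[of _ "g \<otimes> inv k"]) auto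
  qed
  \<comment> \<open>An element whose square is nontrivial is inverted by every involution.\<close>
  have inverted: "h \<otimes> s \<otimes> (h \<otimes> s) = \<one>"
    if s: "involution s" and h: "h \<in> carrier G" and hh: "h \<otimes> h \<noteq> \<one>" for s h
  proof -
    have sc: "s \<in> carrier G" "s \<otimes> s = \<one>" "s \<noteq> \<one>" using s by (auto simp: involution_def)
    have notin: "h \<notin> centralizer s" using cent_conj[OF s] hh sc by auto
    have "h \<otimes> s \<otimes> inv h \<notin> centralizer s"
    proof
      assume "h \<otimes> s \<otimes> inv h \<in> centralizer s"
      then have "h \<otimes> s \<otimes> inv h = s" using cent_conj[OF s] conj_one_iff[OF h sc(1)] sc by auto
      then have "h \<otimes> s = s \<otimes> h" using h sc by (metis inv_solve_right m_closed)
      then show False using notin h by (simp add: centralizer_def)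
    qed
    moreover have "y \<otimes> y = \<one>" if "y \<in> centralizer s" for y using that cent_conj[OF s] sc by auto
    ultimately have "\<exists>y\<in>centralizer s. involution (h \<otimes> y)"
      using coset_meets_involutions[OF s conj_any[OF s] _ h] by blast
    then have "involution h \<or> involution (h \<otimes> s)" using cent_conj[OF s] h by auto
    then show ?thesis using hh by (auto simp: involution_def)
  qed
  define x where "x = v \<otimes> t"
  have xc: "x \<in> carrier G" using tc vc by (simp add: x_def)
  have xx: "x \<otimes> x \<noteq> \<one>"
    using commute_if_square_one[of v t] tc vc nc by (auto simp: x_def)
  have ix: "inv x = t \<otimes> v"
    using tc vc by (intro inv_equality) (simp_all add: x_def m_assoc square_cancel)
  have tx: "t \<otimes> x = inv x \<otimes> t" unfolding ix using tc vc by (simp add: x_def m_assoc)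
  have comm: "h \<otimes> x = x \<otimes> h" if h: "h \<in> carrier G" and hh: "h \<otimes> h \<noteq> \<one>" for h
  proof -
    have "h \<otimes> t \<otimes> (h \<otimes> t) = \<one>" "h \<otimes> v \<otimes> (h \<otimes> v) = \<one>" using inverted h hh t v by auto
    then have "h \<otimes> t = inv (h \<otimes> t)" "h \<otimes> v = inv (h \<otimes> v)"
      using h tc vc by (simp_all add: inv_equality)
    moreover have "inv t = t" "inv v = v" using tc vc by (simp_all add: inv_equality)
    ultimately have ht: "h \<otimes> t = t \<otimes> inv h" and hv: "h \<otimes> v = v \<otimes> inv h"
      using h tc vc by (simp_all add: inv_mult_group)
    have "h \<otimes> x = (h \<otimes> v) \<otimes> t" using h tc vc by (simp add: x_def m_assoc)
    also have "\<dots> = v \<otimes> (inv h \<otimes> t)" unfolding hv using h tc vc by (simp add: m_assoc)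
    also have "inv h \<otimes> t = t \<otimes> h"
    proof -
      have "t \<otimes> h = t \<otimes> (h \<otimes> t) \<otimes> t" using h tc by (simp add: m_assoc)
      also have "\<dots> = inv h \<otimes> t" unfolding ht using h tc by (simp add: square_cancel)
      finally show ?thesis by simp
    qed
    also have "v \<otimes> (t \<otimes> h) = x \<otimes> h" using h tc vc by (simp add: x_def m_assoc)
    finally show ?thesis .
  qed
  have "h \<otimes> x = x \<otimes> h \<or> h \<otimes> x = inv x \<otimes> h" if h: "h \<in> carrier G" for h
  proof (cases "h \<otimes> h = \<one>")
    case False
    then show ?thesis using comm h by blast
  next
    case hh: True
    show ?thesis
    proof (cases "h \<in> centralizer t")
      case True
      then have "h = \<one> \<or> h = t" using cent_t by blast
      then show ?thesis using tx xc by auto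
    next
      case False
      then have "t \<otimes> h \<noteq> h \<otimes> t" using h by (auto simp: centralizer_def)
      then have "(h \<otimes> t) \<otimes> (h \<otimes> t) \<noteq> \<one>" using commute_if_square_one[OF h tc(1) hh tc(2)] by blast
      then have c: "(h \<otimes> t) \<otimes> x = x \<otimes> (h \<otimes> t)" using comm h tc by simp
      have c': "(h \<otimes> t) \<otimes> inv x = inv x \<otimes> (h \<otimes> t)"
      proof -
        have "inv x \<otimes> ((h \<otimes> t) \<otimes> x) \<otimes> inv x = inv x \<otimes> (x \<otimes> (h \<otimes> t)) \<otimes> inv x" using c by simp
        then show ?thesis using h tc(1) xc by (simp add: m_assoc mult_inv_cancel)
      qed
      have "h \<otimes> x = (h \<otimes> t) \<otimes> (t \<otimes> x)" using h tc xc by (simp add: m_assoc square_cancel)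
      also have "\<dots> = ((h \<otimes> t) \<otimes> inv x) \<otimes> t" unfolding tx using h tc xc by (simp add: m_assoc)
      also have "\<dots> = inv x \<otimes> h" unfolding c' using h tc xc by (simp add: m_assoc)
      finally show ?thesis ..
    qed
  qed
  then show ?thesis using xc xx by blast
qed

end

section \<open>The special linear group in characteristic two\<close>

class char_two_field = field +
  assumes char_two: "1 + 1 = 0"
begin

lemma add_self [simp]: "x + x = 0"
  by (metis distrib_left mult_1_right mult_zero_right char_two)

lemma add_self_left [simp]: "x + (x + y) = y"
  by (simp flip: add.assoc)

lemma add_eq_zero_iff: "x + y = 0 \<longleftrightarrow> x = y"
  by (metis add_self add_self_left add_0_right)

lemma uminus_eq [simp]: "- x = x"
  by (rule minus_unique) simp

lemma diff_eq_add [simp]: "x - y = x + y"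
  by (simp only: diff_conv_add_uminus uminus_eq)

lemma square_add: "(x + y) * (x + y) = x * x + y * y"
  by (simp add: distrib_left distrib_right ac_simps)

lemma square_eq_iff [simp]: "x * x = y * y \<longleftrightarrow> x = y"
  by (metis add_eq_zero_iff mult_eq_0_iff square_add)

lemma square_eq_one_iff [simp]: "x * x = 1 \<longleftrightarrow> x = 1"
  using square_eq_iff[of x 1] by simp

end

definition field_on :: "'a::char_two_field set \<Rightarrow> 'a ring" where
  "field_on K = ring_of_type_algebra\<lparr>carrier := K\<rparr>"

text \<open>
  The group over the whole type serves as an ambient group, in which the groups over subfields are
  subgroups. This keeps the subfields plain sets.
\<close>

definition SL :: "('a::char_two_field \<times> 'a \<times> 'a \<times> 'a) monoid" where
  "SL = SL2 (field_on UNIV)"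

definition sl2 :: "'a::char_two_field set \<Rightarrow> ('a \<times> 'a \<times> 'a \<times> 'a) set" where
  "sl2 K = {(a, b, c, d). a \<in> K \<and> b \<in> K \<and> c \<in> K \<and> d \<in> K \<and> a * d + b * c = 1}"

fun tr :: "'a::char_two_field \<times> 'a \<times> 'a \<times> 'a \<Rightarrow> 'a" where
  "tr (a, b, c, d) = a + d"

abbreviation SL_times (infixl "\<star>" 70) where "x \<star> y \<equiv> x \<otimes>\<^bsub>SL\<^esub> y"

abbreviation SL_unit ("\<one>\<^sub>S") where "\<one>\<^sub>S \<equiv> \<one>\<^bsub>SL\<^esub>"

abbreviation SL_inverse ("inv\<^sub>S _" [81] 80) where "inv\<^sub>S x \<equiv> inv\<^bsub>SL\<^esub> x"

lemma field_on_UNIV: "field_on UNIV = ring_of_type_algebra"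
  by (simp add: field_on_def ring_of_type_algebra_def)

lemma group_SL [simp, intro]: "group (SL :: ('a::char_two_field \<times> 'a \<times> 'a \<times> 'a) monoid)"
  unfolding SL_def field_on_UNIV using field_from_type_algebra by (rule SL2_group)

lemma SL_mult [simp]: "(a, b, c, d) \<star> (p, q, r, s)
    = (a * p + b * r, a * q + b * s, c * p + d * r, c * q + d * s)"
  by (simp add: SL_def SL2_def field_on_def ring_of_type_algebra_def)

lemma SL_one [simp]: "\<one>\<^sub>S = (1, 0, 0, 1)"
  by (simp add: SL_def SL2_def field_on_def ring_of_type_algebra_def)

lemma SL_carrier: "carrier SL = sl2 UNIV"
proof -
  interpret field "field_on (UNIV :: 'a set)"
    unfolding field_on_UNIV by (rule field_from_type_algebra)
  have "\<ominus>\<^bsub>field_on UNIV\<^esub> x = x" for x :: 'a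
    by (rule add.inv_equality) (simp_all add: field_on_def ring_of_type_algebra_def)
  then show ?thesis
    by (simp add: SL_def SL2_def sl2_def a_minus_def) (simp add: field_on_def ring_of_type_algebra_def)
qed

lemma mem_SL [simp]: "(a, b, c, d) \<in> carrier SL \<longleftrightarrow> a * d + b * c = 1"
  by (simp add: SL_carrier sl2_def)

lemma mem_sl2 [simp]: "(a, b, c, d) \<in> sl2 K \<longleftrightarrow>
    a \<in> K \<and> b \<in> K \<and> c \<in> K \<and> d \<in> K \<and> a * d + b * c = 1"
  by (simp add: sl2_def)

lemma SL_inv [simp]: "a * d + b * c = 1 \<Longrightarrow> inv\<^sub>S (a, b, c, d) = (d, b, c, a)"
  by (rule group.inv_equality[OF group_SL]) (simp_all add: algebra_simps)

text \<open>
  The matrices commute if and only if the vectors \<open>(b, c, a + d)\<close> and \<open>(q, r, p + s)\<close> are parallel.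
  The first of them vanishes only for the identity matrix, which is what makes commuting transitive
  (\<open>SL_commute_trans\<close>).
\<close>

lemma SL_commute_iff: "(a, b, c, d) \<star> (p, q, r, s) = (p, q, r, s) \<star> (a, b, c, d) \<longleftrightarrow>
    b * r = q * c \<and> (a + d) * q = (p + s) * b \<and> (a + d) * r = (p + s) * c"
proof -
  have 1: "a * q + b * s = p * b + q * d \<longleftrightarrow> (a + d) * q = (p + s) * b"
    by (subst (1 2) add_eq_zero_iff[symmetric]) (simp add: algebra_simps)
  have 2: "c * p + d * r = r * a + s * c \<longleftrightarrow> (a + d) * r = (p + s) * c"
    by (subst (1 2) add_eq_zero_iff[symmetric]) (simp add: algebra_simps)
  show ?thesis using 1 2 by (auto simp: algebra_simps)
qed

lemma parallel:
  fixes b c m :: "'a::field"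
  assumes "b \<noteq> 0 \<or> c \<noteq> 0 \<or> m \<noteq> 0" and "b * r = q * c" "m * q = n * b" "m * r = n * c"
  shows "\<exists>k. q = k * b \<and> r = k * c \<and> n = k * m"
  using assms(1)
proof (elim disjE)
  assume "b \<noteq> 0"
  then show ?thesis using assms(2-) by (intro exI[of _ "q / b"]) (simp add: field_simps)
next
  assume "c \<noteq> 0"
  then show ?thesis using assms(2-) by (intro exI[of _ "r / c"]) (simp add: field_simps)
next
  assume "m \<noteq> 0"
  then show ?thesis using assms(2-) by (intro exI[of _ "n / m"]) (simp add: field_simps)
qed

lemma SL_commute_trans:
  assumes "g \<in> carrier SL" "x \<in> carrier SL" "y \<in> carrier SL" "g \<noteq> \<one>\<^sub>S"
    and "g \<star> x = x \<star> g" "g \<star> y = y \<star> g"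
  shows "x \<star> y = y \<star> x"
proof -
  obtain a b c d p q r s p' q' r' s'
    where e: "g = (a, b, c, d)" "x = (p, q, r, s)" "y = (p', q', r', s')"
    by (metis prod_cases4)
  define m n l where mnl: "m = a + d" "n = p + s" "l = p' + s'"
  have gx: "b * r = q * c" "m * q = n * b" "m * r = n * c"
    and gy: "b * r' = q' * c" "m * q' = l * b" "m * r' = l * c"
    using assms(5,6) unfolding e SL_commute_iff mnl by auto
  have "b \<noteq> 0 \<or> c \<noteq> 0 \<or> m \<noteq> 0"
  proof (rule ccontr)
    assume "\<not> ?thesis"
    then show False using assms(1,4) unfolding e mnl by (auto simp: add_eq_zero_iff)
  qed
  then obtain k k' where "q = k * b" "r = k * c" "n = k * m" "q' = k' * b" "r' = k' * c" "l = k' * m"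
    using parallel[of b c m] gx gy by metis
  then have "q * r' = q' * r \<and> n * q' = l * q \<and> n * r' = l * r" by (simp add: ac_simps)
  then show ?thesis unfolding e SL_commute_iff mnl by simp
qed

lemma finite_ct_group_SL:
  assumes "subgroup H SL" "finite H"
  shows "finite_ct_group (SL\<lparr>carrier := H\<rparr>)"
proof -
  have "group (SL\<lparr>carrier := H\<rparr>)" using assms(1) group.subgroup_imp_group group_SL by blast
  moreover have "H \<subseteq> carrier SL" using assms(1) by (rule subgroup.subset)
  ultimately show ?thesis
  proof (intro finite_ct_group.intro finite_ct_group_axioms.intro, goal_cases)
    case (3 g x y)
    moreover from this(3-5) have "g \<in> carrier SL" "x \<in> carrier SL" "y \<in> carrier SL"
      using \<open>H \<subseteq> carrier SL\<close> by auto
    ultimately show ?case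
      using SL_commute_trans[of g x y] by (simp del: SL_one)
  qed (use assms(2) in simp_all)
qed

lemma square_one_iff_tr:
  assumes "x \<in> carrier SL" "x \<noteq> \<one>\<^sub>S"
  shows "x \<star> x = \<one>\<^sub>S \<longleftrightarrow> tr x = 0"
proof -
  obtain a b c d where e: "x = (a, b, c, d)" by (metis prod_cases4)
  have "x \<star> x = (a * a + b * c, b * (a + d), c * (a + d), d * d + b * c)"
    by (simp add: e distrib_left distrib_right ac_simps)
  then have sq: "x \<star> x = \<one>\<^sub>S \<longleftrightarrow>
      a * a + b * c = 1 \<and> b * (a + d) = 0 \<and> c * (a + d) = 0 \<and> d * d + b * c = 1" by simp
  show ?thesis
  proof (cases "a = d")
    case True
    then have "d * d + b * c = 1" using assms(1) by (simp add: e)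
    then show ?thesis unfolding sq by (simp add: True e)
  next
    case False
    then have "a + d \<noteq> 0" by (simp add: add_eq_zero_iff)
    moreover have "x \<star> x \<noteq> \<one>\<^sub>S"
    proof
      assume "x \<star> x = \<one>\<^sub>S"
      note * = this[unfolded sq]
      then have "b = 0" "c = 0" using mult_eq_0_iff \<open>a + d \<noteq> 0\<close> by blast+
      moreover from this * have "a = 1" "d = 1" by simp_all
      ultimately show False using assms(2) by (simp add: e)
    qed
    ultimately show ?thesis by (simp add: e)
  qed
qed

lemma tr_conj:
  assumes "g \<in> carrier SL" "x \<in> carrier SL"
  shows "tr (g \<star> x \<star> inv\<^sub>S g) = tr x"
proof -
  obtain a b c d p q r s where e: "x = (a, b, c, d)" "g = (p, q, r, s)" by (metis prod_cases4)
  have g: "p * s + q * r = 1" using assms(1) by (simp add: e)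
  have "tr (g \<star> x \<star> inv\<^sub>S g) = (a + d) * (p * s + q * r)"
    unfolding e SL_inv[OF g] by (simp add: algebra_simps)
  then show ?thesis by (simp add: g e)
qed

lemma commute_involution_imp_tr_zero:
  assumes "z \<in> carrier SL" "x \<in> carrier SL" "z \<noteq> \<one>\<^sub>S" "tr z = 0"
    and "z \<star> x = x \<star> z"
  shows "tr x = 0"
proof -
  obtain a b c d p q r s where e: "z = (a, b, c, d)" "x = (p, q, r, s)" by (metis prod_cases4)
  have "a = d" using assms(4) by (simp add: e add_eq_zero_iff)
  moreover have "b \<noteq> 0 \<or> c \<noteq> 0" using assms(1,3) \<open>a = d\<close> by (auto simp: e)
  ultimately show ?thesis using assms(5) unfolding e SL_commute_iff by auto
qed

text \<open>
  As \<open>x\<close> is not scalar, \<open>y = m + k x\<close> with scalars \<open>m\<close> and \<open>k\<close>. Equal traces give \<open>k = 1\<close>, and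
  equal determinants then give \<open>m = 0\<close> or \<open>m = tr x\<close>; in the latter case \<open>y\<close> is the inverse of \<open>x\<close> by Cayley and
  Hamilton.
\<close>

lemma commute_same_tr:
  assumes "x \<in> carrier SL" "y \<in> carrier SL" "x \<star> y = y \<star> x" "tr y = tr x" "tr x \<noteq> 0"
  shows "y = x \<or> y = inv\<^sub>S x"
proof -
  obtain a b c d p q r s where e: "x = (a, b, c, d)" "y = (p, q, r, s)" by (metis prod_cases4)
  have tr: "p + s = a + d" "a + d \<noteq> 0" using assms(4,5) by (auto simp: e)
  have "(a + d) * q = (a + d) * b" "(a + d) * r = (a + d) * c"
    using assms(3) unfolding e SL_commute_iff tr by auto
  then have qr: "q = b" "r = c" using tr(2) by auto
  have "a * d + b * c = 1" "p * s + b * c = 1" using assms(1,2) by (auto simp: e qr)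
  then have ps: "p * s = a * d" by (metis add_right_cancel)
  have "(p + a) * (p + d) = p * p + p * (a + d) + a * d" by (simp add: algebra_simps)
  also have "\<dots> = p * p + p * (p + s) + p * s" by (simp only: tr(1) ps)
  also have "\<dots> = 0" by (simp add: distrib_left)
  finally have "p = a \<or> p = d" by (simp add: add_eq_zero_iff)
  then have "(p = a \<and> s = d) \<or> (p = d \<and> s = a)"
    using tr(1) by (auto simp: add.commute[of a d])
  then show ?thesis using \<open>a * d + b * c = 1\<close> by (auto simp: e qr)
qed

section \<open>Subgroups with few involutions\<close>

text \<open>
  Closure under negation is automatic, since \<open>- x = x\<close>.
\<close>

definition is_subfield :: "'a::char_two_field set \<Rightarrow> bool" where
  "is_subfield K \<longleftrightarrow> 0 \<in> K \<and> 1 \<in> K \<and> (\<forall>x\<in>K. \<forall>y\<in>K. x + y \<in> K \<and> x * y \<in> K \<and> inverse x \<in> K)"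

lemma is_subfieldD:
  assumes "is_subfield K"
  shows "0 \<in> K" "1 \<in> K" "x \<in> K \<Longrightarrow> y \<in> K \<Longrightarrow> x + y \<in> K" "x \<in> K \<Longrightarrow> y \<in> K \<Longrightarrow> x * y \<in> K"
    "x \<in> K \<Longrightarrow> inverse x \<in> K" "x \<in> K \<Longrightarrow> y \<in> K \<Longrightarrow> x / y \<in> K"
  using assms unfolding is_subfield_def by (auto simp: divide_inverse)

lemma sqrt_in_subfield:
  fixes K :: "'a::char_two_field set"
  assumes "finite K" "\<And>x. x \<in> K \<Longrightarrow> x * x \<in> K" "y \<in> K"
  shows "\<exists>x\<in>K. x * x = y"
proof -
  have "(\<lambda>x. x * x) ` K = K"
    using assms by (intro endo_inj_surj) (auto simp: inj_on_def)
  then have "y \<in> (\<lambda>x. x * x) ` K" using assms(3) by simp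
  then show ?thesis by auto
qed

lemma quad_cases:
  obtains a b c d where "x = (a, b, c, d)"
  by (metis prod_cases4)

interpretation SL: group "SL :: ('a::char_two_field \<times> 'a \<times> 'a \<times> 'a) monoid"
  by (rule group_SL)

text \<open>
  If \<open>g\<close> conjugates \<open>x\<close> to a different element that commutes with \<open>x\<close>, then it inverts \<open>x\<close>, because the traces agree. So
  \<open>g\<^sup>2\<close>, which is nontrivial, commutes with both \<open>g\<close> and \<open>x\<close>, and transitivity gives that \<open>g\<close> and \<open>x\<close>
  commute after all. Hence no fusion takes place in the subgroup.
\<close>

lemma subgroup_comm_if_no_involution:
  fixes H :: "('a::char_two_field \<times> 'a \<times> 'a \<times> 'a) set"
  assumes H: "subgroup H SL" "finite H"
    and no: "\<And>x. x \<in> H \<Longrightarrow> x \<noteq> \<one>\<^sub>S \<Longrightarrow> tr x \<noteq> 0"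
    and xy: "x \<in> H" "y \<in> H"
  shows "x \<star> y = y \<star> x"
proof -
  interpret H: finite_ct_group "SL\<lparr>carrier := H\<rparr>" by (rule finite_ct_group_SL[OF H])
  interpret S: subgroup H SL by (rule H(1))
  have inv_H: "inv\<^bsub>SL\<lparr>carrier := H\<rparr>\<^esub> g = inv\<^sub>S g" if "g \<in> H" for g
    using SL.m_inv_consistent[OF H(1) that] .
  have fusion: "g \<star> x \<star> inv\<^sub>S g = x"
    if g: "g \<in> H" and x: "x \<in> H" "x \<noteq> \<one>\<^sub>S"
      and comm: "x \<star> (g \<star> x \<star> inv\<^sub>S g) = g \<star> x \<star> inv\<^sub>S g \<star> x"
    for g x
  proof (rule ccontr)
    assume ne: "g \<star> x \<star> inv\<^sub>S g \<noteq> x"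
    have cl: "g \<in> carrier SL" "x \<in> carrier SL" using g x S.subset by auto
    have "g \<star> x \<star> inv\<^sub>S g = x \<or> g \<star> x \<star> inv\<^sub>S g = inv\<^sub>S x"
      using commute_same_tr[of x "g \<star> x \<star> inv\<^sub>S g"] cl comm tr_conj[OF cl] no[OF x] by simp
    then have "g \<star> x \<star> inv\<^sub>S g = inv\<^sub>S x" using ne by blast
    then have gx: "g \<star> x = inv\<^sub>S x \<star> g"
      using cl SL.inv_solve_right'[of "inv\<^sub>S x" "g \<star> x" g] by simp
    have "x \<star> (g \<star> x) \<star> inv\<^sub>S x = x \<star> (inv\<^sub>S x \<star> g) \<star> inv\<^sub>S x"
      using gx by simp
    then have xg: "x \<star> g = g \<star> inv\<^sub>S x"
      using cl by (simp add: SL.m_assoc SL.mult_inv_cancel del: SL_one)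
    have "(g \<star> g) \<star> x = g \<star> inv\<^sub>S x \<star> g"
      using cl gx by (simp add: SL.m_assoc)
    also have "\<dots> = x \<star> (g \<star> g)" unfolding xg[symmetric] using cl by (simp add: SL.m_assoc)
    finally have ggx: "(g \<star> g) \<star> x = x \<star> (g \<star> g)" .
    have "g \<noteq> \<one>\<^sub>S" using ne cl by (auto simp del: SL_one)
    then have gg: "g \<star> g \<noteq> \<one>\<^sub>S" using square_one_iff_tr[OF cl(1)] no[OF g] by blast
    have "(g \<star> g) \<star> g = g \<star> (g \<star> g)" using cl by (simp add: SL.m_assoc)
    then have "g \<star> x = x \<star> g"
      using SL_commute_trans[OF _ cl gg _ ggx] cl by simp
    then have "g \<star> x \<star> inv\<^sub>S g = x" using cl by (simp add: SL.m_assoc del: SL_one)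
    then show False using ne by blast
  qed
  have "x \<otimes>\<^bsub>SL\<lparr>carrier := H\<rparr>\<^esub> y = y \<otimes>\<^bsub>SL\<lparr>carrier := H\<rparr>\<^esub> x"
  proof (rule H.commutative_if_no_fusion, goal_cases)
    case (1 g x)
    then show ?case
      using fusion[of g x] inv_H[of g] by (simp del: SL_one SL.m_inv_consistent)
  qed (use xy in simp_all)
  then show ?thesis by simp
qed

lemma involution_in_subgroup_iff:
  assumes "subgroup H SL" "finite H"
  shows "finite_ct_group.involution (SL\<lparr>carrier := H\<rparr>) x \<longleftrightarrow> x \<in> H \<and> x \<noteq> \<one>\<^sub>S \<and> tr x = 0"
proof -
  have "H \<subseteq> carrier SL" using assms(1) by (rule subgroup.subset)
  then show ?thesis
    using square_one_iff_tr[of x]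
    unfolding finite_ct_group.involution_def[OF finite_ct_group_SL[OF assms]] by auto
qed

lemma centralizer_in_subgroup:
  assumes "subgroup H SL" "finite H"
  shows "finite_ct_group.centralizer (SL\<lparr>carrier := H\<rparr>) x = {g \<in> H. g \<star> x = x \<star> g}"
  unfolding finite_ct_group.centralizer_def[OF finite_ct_group_SL[OF assms]] by simp

lemma involution_centralizer_square_one:
  assumes H: "subgroup H SL" "finite H"
    and z: "finite_ct_group.involution (SL\<lparr>carrier := H\<rparr>) z" and x: "x \<in> H"
    and c: "z \<star> x = x \<star> z"
  shows "x \<star> x = \<one>\<^sub>S"
proof (cases "x = \<one>\<^sub>S")
  case False
  have "H \<subseteq> carrier SL" using H(1) by (rule subgroup.subset)
  then show ?thesis
    using z x c False commute_involution_imp_tr_zero[of z x] square_one_iff_tr[of x]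
    unfolding involution_in_subgroup_iff[OF H] by auto
qed simp

text \<open>
  The results on finite groups with transitive commuting, restated for subgroups of \<open>SL\<close>: there, the
  involutions are the nontrivial elements of trace zero, and the square of every element commuting
  with an involution is trivial.
\<close>

lemma
  assumes H: "subgroup H SL" "finite H"
    and t: "t \<in> H" "t \<noteq> \<one>\<^sub>S" "tr t = 0" and v: "v \<in> H" "v \<noteq> \<one>\<^sub>S" "tr v = 0"
    and nc: "t \<star> v \<noteq> v \<star> t"
  shows subgroup_involutions_conjugate:
      "\<lbrakk>u \<in> H; u \<noteq> \<one>\<^sub>S; tr u = 0\<rbrakk> \<Longrightarrow> \<exists>g\<in>H. u = g \<star> t \<star> inv\<^sub>S g"
    and subgroup_coset_trace_zero:
      "\<lbrakk>h \<in> H; h \<star> t \<star> inv\<^sub>S h \<star> t \<noteq> t \<star> (h \<star> t \<star> inv\<^sub>S h)\<rbrakk> \<Longrightarrow>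
        \<exists>y\<in>H. y \<star> t = t \<star> y \<and> tr (h \<star> y) = 0"
    and subgroup_dihedral:
      "{g \<in> H. g \<star> t = t \<star> g} = {\<one>\<^sub>S, t} \<Longrightarrow>
        \<exists>x\<in>H. tr x \<noteq> 0 \<and> (\<forall>h\<in>H. h \<star> x = x \<star> h \<or> h \<star> x = inv\<^sub>S x \<star> h)"
proof -
  let ?G = "SL\<lparr>carrier := H\<rparr>"
  interpret H: finite_ct_group ?G by (rule finite_ct_group_SL[OF H])
  interpret S: subgroup H SL by (rule H(1))
  have inv_H: "inv\<^bsub>?G\<^esub> g = inv\<^sub>S g" if "g \<in> H" for g
    using SL.m_inv_consistent[OF H(1) that] .
  have I: "H.involution t" "H.involution v"
    using t v unfolding involution_in_subgroup_iff[OF H] by auto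
  have nc': "t \<otimes>\<^bsub>?G\<^esub> v \<noteq> v \<otimes>\<^bsub>?G\<^esub> t" using nc by simp
  have sq: "x \<otimes>\<^bsub>?G\<^esub> x = \<one>\<^bsub>?G\<^esub>"
    if "H.involution z" "x \<in> carrier ?G" "z \<otimes>\<^bsub>?G\<^esub> x = x \<otimes>\<^bsub>?G\<^esub> z" for z x
    using involution_centralizer_square_one[OF H that(1), of x] that by simp
  have conj: "\<exists>g\<in>carrier ?G. u = g \<otimes>\<^bsub>?G\<^esub> t \<otimes>\<^bsub>?G\<^esub> inv\<^bsub>?G\<^esub> g" if "H.involution u" for u
    using H.all_involutions_conjugate[OF I nc' _ that] sq by blast
  show "\<exists>g\<in>H. u = g \<star> t \<star> inv\<^sub>S g" if u: "u \<in> H" "u \<noteq> \<one>\<^sub>S" "tr u = 0"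
  proof -
    have "H.involution u" using u unfolding involution_in_subgroup_iff[OF H] by auto
    then obtain g where "g \<in> carrier ?G" "u = g \<otimes>\<^bsub>?G\<^esub> t \<otimes>\<^bsub>?G\<^esub> inv\<^bsub>?G\<^esub> g" using conj by blast
    then show ?thesis using inv_H[of g] by (intro bexI[of _ g]) simp_all
  qed
  show "\<exists>y\<in>H. y \<star> t = t \<star> y \<and> tr (h \<star> y) = 0"
    if h: "h \<in> H" "h \<star> t \<star> inv\<^sub>S h \<star> t \<noteq> t \<star> (h \<star> t \<star> inv\<^sub>S h)"
  proof -
    have "\<exists>y\<in>H.centralizer t. H.involution (h \<otimes>\<^bsub>?G\<^esub> y)"
    proof (rule H.coset_meets_involutions[OF I(1) conj])
      show "y \<otimes>\<^bsub>?G\<^esub> y = \<one>\<^bsub>?G\<^esub>" if "y \<in> H.centralizer t" for y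
        using that sq[OF I(1), of y] by (simp add: centralizer_in_subgroup[OF H])
      show "h \<in> carrier ?G" using h by simp
      show "h \<otimes>\<^bsub>?G\<^esub> t \<otimes>\<^bsub>?G\<^esub> inv\<^bsub>?G\<^esub> h \<notin> H.centralizer t"
        unfolding inv_H[OF h(1)] using h(2) by (simp add: centralizer_in_subgroup[OF H])
    qed
    then show ?thesis
      unfolding centralizer_in_subgroup[OF H] involution_in_subgroup_iff[OF H] by auto
  qed
  show "\<exists>x\<in>H. tr x \<noteq> 0 \<and> (\<forall>h\<in>H. h \<star> x = x \<star> h \<or> h \<star> x = inv\<^sub>S x \<star> h)"
    if "{g \<in> H. g \<star> t = t \<star> g} = {\<one>\<^sub>S, t}"
  proof -
    have "H.centralizer t = {\<one>\<^bsub>?G\<^esub>, t}" using that by (simp add: centralizer_in_subgroup[OF H])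
    then obtain x where x: "x \<in> carrier ?G" "x \<otimes>\<^bsub>?G\<^esub> x \<noteq> \<one>\<^bsub>?G\<^esub>"
      and all: "\<And>h. h \<in> carrier ?G \<Longrightarrow> h \<otimes>\<^bsub>?G\<^esub> x = x \<otimes>\<^bsub>?G\<^esub> h \<or> h \<otimes>\<^bsub>?G\<^esub> x = inv\<^bsub>?G\<^esub> x \<otimes>\<^bsub>?G\<^esub> h"
      using H.dihedral_if_small_centralizer[OF I nc'] sq by blast
    have xH: "x \<in> H" using x by simp
    have "x \<in> carrier SL" using x S.subset by auto
    moreover have "x \<star> x \<noteq> \<one>\<^sub>S" using x by simp
    moreover have "x \<noteq> \<one>\<^sub>S" using calculation by (metis SL.r_one)
    ultimately have "tr x \<noteq> 0" using square_one_iff_tr by blast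
    then show ?thesis using xH all inv_H[OF xH] by (intro bexI[of _ x]) simp_all
  qed
qed

section \<open>Recognising SL2 over a subfield\<close>

lemma commute_unipotent_iff:
  "(a, b, c, d) \<star> (1, 1, 0, 1) = (1, 1, 0, 1) \<star> (a, b, c, d) \<longleftrightarrow> c = 0 \<and> a = d"
  unfolding SL_commute_iff by (auto simp: add_eq_zero_iff)

lemma conj_unipotent:
  assumes "p * s + q * r = 1"
  shows "(p, q, r, s) \<star> (1, 1, 0, 1) \<star> inv\<^sub>S (p, q, r, s)
    = (1 + p * r, p * p, r * r, 1 + p * r)"
  using assms by (simp add: algebra_simps)

text \<open>
  The field \<open>K\<close> is the set of all \<open>x\<close> such that the unipotent matrix with entry \<open>x\<close> lies in \<open>H\<close>. It is closed under addition.
  Conjugating by an upper triangular element of \<open>H\<close> with diagonal entry \<open>p\<close> multiplies \<open>K\<close> by \<open>p\<^sup>2\<close>;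
  since all involutions are conjugate, every nonzero element of \<open>K\<close> arises as such a \<open>p\<^sup>2\<close>, so \<open>K\<close> is
  closed under multiplication. By finiteness every element of \<open>K\<close> is a square in \<open>K\<close>, so
  the diagonal entries \<open>p\<close> lie in \<open>K\<close> themselves.

  For \<open>h\<close> outside the Borel subgroup the coset of \<open>h\<close> modulo the unipotent matrices contains an involution. This
  says that \<open>tr h / c\<close> lies in \<open>K\<close>, where \<open>c\<close> is the lower left entry of \<open>h\<close>. Multiplying \<open>h\<close> by the given diagonal
  element changes the weights of the two diagonal entries, so both quotients \<open>a / c\<close> and \<open>d / c\<close> are in \<open>K\<close>,
  and \<open>H\<close> contains the antidiagonal matrix with entries \<open>1 / c\<close> and \<open>c\<close>. The conjugate of a
  unipotent matrix by it shows that \<open>c\<^sup>2\<close>, and so \<open>c\<close>, lies in \<open>K\<close>.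
\<close>

lemma subgroup_eq_sl2:
  fixes H :: "('a::char_two_field \<times> 'a \<times> 'a \<times> 'a) set"
  assumes H: "subgroup H SL" "finite H"
    and u1: "(1, 1, 0, 1) \<in> H" and diag: "(\<tau>, 0, 0, \<sigma>) \<in> H" "\<tau> \<noteq> 1"
    and h: "(a', b', c', d') \<in> H" "c' \<noteq> 0"
  shows "\<exists>K. is_subfield K \<and> H = sl2 K"
proof -
  interpret S: subgroup H SL by (rule H(1))
  have det: "p * s + q * r = 1" if "(p, q, r, s) \<in> H" for p q r s
    using that S.subset by (metis mem_SL subsetD)
  have inv: "(s, q, r, p) \<in> H" if "(p, q, r, s) \<in> H" for p q r s
    using S.m_inv_closed[OF that] SL_inv[OF det[OF that]] by simp
  have mult: "(p * p' + q * r', p * q' + q * s', r * p' + s * r', r * q' + s * s') \<in> H"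
    if "(p, q, r, s) \<in> H" "(p', q', r', s') \<in> H" for p q r s p' q' r' s'
    using S.m_closed[OF that] by simp
  have \<tau>0: "\<tau> \<noteq> 0" using det[OF diag(1)] by auto
  have \<sigma>: "\<sigma> = inverse \<tau>" using det[OF diag(1)] by (simp add: field_simps \<tau>0)
  define t :: "'a \<times> 'a \<times> 'a \<times> 'a" where "t = (1, 1, 0, 1)"
  define v where "v = (a', b', c', d') \<star> t \<star> inv\<^sub>S (a', b', c', d')"
  have conj_t: "(p, q, r, s) \<star> t \<star> inv\<^sub>S (p, q, r, s) = (1 + p * r, p * p, r * r, 1 + p * r)"
    if "p * s + q * r = 1" for p q r s
    unfolding t_def by (rule conj_unipotent[OF that])
  have v: "v = (1 + a' * c', a' * a', c' * c', 1 + a' * c')"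
    unfolding v_def by (rule conj_t[OF det[OF h(1)]])
  have tH: "t \<in> H" "t \<noteq> \<one>\<^sub>S" "tr t = 0" using u1 by (auto simp: t_def)
  have vH: "v \<in> H" unfolding v_def using tH h(1) by simp
  have v': "v \<noteq> \<one>\<^sub>S" "tr v = 0" using h(2) by (auto simp: v)
  have nc: "t \<star> v \<noteq> v \<star> t"
  proof (rule not_sym)
    show "v \<star> t \<noteq> t \<star> v"
      unfolding t_def v commute_unipotent_iff using h(2) by simp
  qed
  note conj = subgroup_involutions_conjugate[OF H tH vH v' nc]
  note coset = subgroup_coset_trace_zero[OF H tH vH v' nc]
  define K where "K = {x. (1, x, 0, 1) \<in> H}"
  have finK: "finite K"
  proof (rule finite_imageD)
    show "finite ((\<lambda>x. (1 :: 'a, x, 0 :: 'a, 1 :: 'a)) ` K)" by (rule finite_subset[OF _ H(2)]) (auto simp: K_def)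
  qed (simp add: inj_on_def)
  have K0: "0 \<in> K" "1 \<in> K" using S.one_closed u1 by (auto simp: K_def)
  have K_add: "x + y \<in> K" if "x \<in> K" "y \<in> K" for x y
    using mult[of 1 y 0 1 1 x 0 1] that by (simp add: K_def)
  have K_root: "\<exists>p q. p \<noteq> 0 \<and> p * p = x \<and> (p, q, 0, inverse p) \<in> H" if x: "x \<in> K" "x \<noteq> 0" for x
  proof -
    obtain g where g: "g \<in> H" "(1, x, 0, 1) = g \<star> t \<star> inv\<^sub>S g"
      using conj[of "(1, x, 0, 1)"] x by (auto simp: K_def)
    obtain p q r s where e: "g = (p, q, r, s)" by (rule quad_cases)
    have d: "p * s + q * r = 1" using det g(1) e by simp
    have "r = 0" "x = p * p" using g(2) unfolding e conj_t[OF d] by auto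
    moreover from this have "p \<noteq> 0" "s = inverse p" using d x(2) inverse_unique[of p s] by auto
    ultimately show ?thesis using g(1) e by auto
  qed
  have K_scale: "p * p * x \<in> K" if "(p, q, 0, s) \<in> H" "x \<in> K" for p q s x
  proof -
    have d: "p * s = 1" using det[OF that(1)] by simp
    have "(p * 1 + q * 0, p * x + q * 1, 0 * 1 + s * 0, 0 * x + s * 1) \<in> H"
      using mult[OF that(1), of 1 x 0 1] that(2) by (simp add: K_def)
    from mult[OF this inv[OF that(1)]] show ?thesis using d by (simp add: K_def algebra_simps)
  qed
  have K_mult: "x * y \<in> K" if x: "x \<in> K" and y: "y \<in> K" for x y
  proof (cases "x = 0")
    case False
    then obtain p q where "p * p = x" "(p, q, 0, inverse p) \<in> H" using K_root[OF x] by blast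
    then show ?thesis using K_scale[of p q "inverse p" y] y by simp
  qed (use K0 in simp)
  have K_sqrt: "\<exists>y\<in>K. y * y = x" if "x \<in> K" for x
    using sqrt_in_subfield[OF finK _ that] K_mult by blast
  have K_diag: "p \<in> K" if "(p, q, 0, s) \<in> H" for p q s
  proof -
    have "p * p \<in> K" using K_scale[OF that K0(2)] by simp
    then obtain y where "y \<in> K" "y * y = p * p" using K_sqrt by blast
    then show ?thesis by simp
  qed
  have K_inv: "inverse x \<in> K" if x: "x \<in> K" for x
  proof (cases "x = 0")
    case False
    then obtain p q where pq: "p \<noteq> 0" "p * p = x" "(p, q, 0, inverse p) \<in> H" using K_root[OF x] by blast
    have 1: "inverse p * inverse p * 1 \<in> K" by (rule K_scale[OF inv[OF pq(3)] K0(2)])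
    have 2: "inverse p * inverse p * 1 = inverse x"
      unfolding pq(2)[symmetric] by (simp only: inverse_mult_distrib mult_1_right)
    show ?thesis using 1 unfolding 2 .
  qed (use K0 in simp)
  have K_div: "x / y \<in> K" if "x \<in> K" "y \<in> K" for x y
    using K_mult[OF that(1) K_inv[OF that(2)]] by (simp add: divide_inverse)
  have K: "is_subfield K"
    unfolding is_subfield_def by (intro conjI ballI K0 K_add K_mult K_inv)
  have \<tau>K: "\<tau> \<in> K" using K_diag[OF diag(1)] .
  \<comment> \<open>The commutator with the given diagonal element is unipotent, and its entry is a known multiple of \<open>q\<close>.\<close>
  have K_upper: "q \<in> K" if pq: "(p, q, 0, s) \<in> H" for p q s
  proof -
    have d: "p * s = 1" using det[OF pq] by simp
    then have p0: "p \<noteq> 0" and s: "s = inverse p" using inverse_unique[of p s] by auto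
    have 1: "(\<tau> * p, \<tau> * q, 0, \<sigma> * s) \<in> H" using mult[OF diag(1) pq] by simp
    have 2: "(\<tau> * p * \<sigma>, \<tau> * q * \<tau>, 0, \<sigma> * s * \<tau>) \<in> H" using mult[OF 1 inv[OF diag(1)]] by simp
    have 3: "(\<tau> * p * \<sigma> * s, \<tau> * p * \<sigma> * q + \<tau> * q * \<tau> * p, 0, \<sigma> * s * \<tau> * p) \<in> H"
      using mult[OF 2 inv[OF pq]] by simp
    have "\<tau> * p * \<sigma> * s = 1" "\<sigma> * s * \<tau> * p = 1" using p0 \<tau>0 s \<sigma> by (simp_all add: field_simps)
    moreover have "\<tau> * p * \<sigma> * q + \<tau> * q * \<tau> * p = p * (1 + \<tau> * \<tau>) * q"
      using \<tau>0 by (simp add: \<sigma> field_simps)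
    ultimately have "p * (1 + \<tau> * \<tau>) * q \<in> K" using 3 by (simp add: K_def)
    moreover have "p * (1 + \<tau> * \<tau>) \<in> K" using K_diag[OF pq] \<tau>K K0 K_add K_mult by simp
    moreover have "p * (1 + \<tau> * \<tau>) \<noteq> 0" using p0 diag(2) square_eq_one_iff[of \<tau>] by (simp add: add_eq_zero_iff)
    ultimately show ?thesis using K_div[of "p * (1 + \<tau> * \<tau>) * q" "p * (1 + \<tau> * \<tau>)"] by simp
  qed
  have upper_in: "(p, q, 0, inverse p) \<in> H" if p: "p \<in> K" "p \<noteq> 0" and q: "q \<in> K" for p q
  proof -
    obtain p' q' where p': "p' * p' = p * p" "(p', q', 0, inverse p') \<in> H"
      using K_root[of "p * p"] K_mult p by auto
    then have e: "(p, q', 0, inverse p) \<in> H" by simp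
    have "(q + q') / p \<in> K" using K_upper[OF e] q p K_add K_div by simp
    then have "(1, (q + q') / p, 0, 1) \<in> H" by (simp add: K_def)
    from mult[OF e this] show ?thesis using p by (simp add: add.commute)
  qed
  have K_quot: "(a + d) / c \<in> K" if abcd: "(a, b, c, d) \<in> H" "c \<noteq> 0" for a b c d
  proof -
    have dt: "a * d + b * c = 1" using det abcd by blast
    have "\<exists>y\<in>H. y \<star> t = t \<star> y \<and> tr ((a, b, c, d) \<star> y) = 0"
    proof (rule coset[OF abcd(1)])
      show "(a, b, c, d) \<star> t \<star> inv\<^sub>S (a, b, c, d) \<star> t
         \<noteq> t \<star> ((a, b, c, d) \<star> t \<star> inv\<^sub>S (a, b, c, d))"
        unfolding conj_t[OF dt] unfolding t_def commute_unipotent_iff using abcd(2) by simp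
    qed
    then obtain y where y: "y \<in> H" "y \<star> t = t \<star> y" "tr ((a, b, c, d) \<star> y) = 0" by blast
    obtain p q r s where e: "y = (p, q, r, s)" by (rule quad_cases)
    have rs: "r = 0" "s = p" using y(2) unfolding e t_def commute_unipotent_iff by auto
    have "p = 1" using det[of p q r s] y(1) by (simp add: e rs)
    then have "q \<in> K" "a + (c * q + d) = 0" using y by (simp_all add: e rs K_def)
    moreover from this(2) have "a + d = c * q" by (metis add_self_left add.left_commute add_0_right)
    ultimately show ?thesis using abcd(2) by simp
  qed
  have K_ratio: "a / c \<in> K" "d / c \<in> K" if abcd: "(a, b, c, d) \<in> H" "c \<noteq> 0" for a b c d
  proof -
    have "(\<tau> * a, \<tau> * b, \<sigma> * c, \<sigma> * d) \<in> H" using mult[OF diag(1) abcd(1)] by simp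
    then have "(\<tau> * a + \<sigma> * d) / (\<sigma> * c) \<in> K" using K_quot abcd(2) \<tau>0 by (simp add: \<sigma>)
    then have "(\<tau> * a + \<sigma> * d) / (\<sigma> * c) + (a + d) / c \<in> K" using K_quot[OF abcd] K_add by blast
    moreover have "(\<tau> * a + \<sigma> * d) / (\<sigma> * c) + (a + d) / c = (1 + \<tau> * \<tau>) * (a / c)"
      using abcd(2) \<tau>0 by (simp add: \<sigma> field_simps)
    ultimately have "(1 + \<tau> * \<tau>) * (a / c) \<in> K" by simp
    moreover have "1 + \<tau> * \<tau> \<in> K" using \<tau>K K0 K_add K_mult by simp
    moreover have "1 + \<tau> * \<tau> \<noteq> 0" using diag(2) square_eq_one_iff[of \<tau>] by (simp add: add_eq_zero_iff)
    ultimately show ac: "a / c \<in> K" using K_div[of "(1 + \<tau> * \<tau>) * (a / c)" "1 + \<tau> * \<tau>"] by simp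
    have "(a + d) / c + a / c \<in> K" using K_add[OF K_quot[OF abcd] ac] .
    then show "d / c \<in> K" by (simp add: add_divide_distrib add.commute add.left_commute)
  qed
  have anti: "(0, 1 / c, c, 0) \<in> H" if abcd: "(a, b, c, d) \<in> H" "c \<noteq> 0" for a b c d
  proof -
    have d: "a * d + b * c = 1" using det abcd by blast
    have 1: "(1, a / c, 0, 1) \<in> H" "(1, d / c, 0, 1) \<in> H" using K_ratio[OF abcd] by (auto simp: K_def)
    have "b + a / c * d = 1 / c" using d abcd(2) by (simp add: field_simps)
    then have "(0, 1 / c, c, d) \<in> H" using mult[OF 1(1) abcd(1)] abcd(2) by simp
    from mult[OF this 1(2)] show ?thesis using abcd(2) by simp
  qed
  have K_c: "c \<in> K" if abcd: "(a, b, c, d) \<in> H" "c \<noteq> 0" for a b c d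
  proof -
    have w: "(0, 1 / c, c, 0) \<in> H" using anti[OF abcd] .
    have "(0, 1 / c, c, c) \<in> H" using mult[OF w u1] by simp
    from mult[OF this w] have "(1, 0, c * c, 1) \<in> H" using abcd(2) by simp
    then have "1 / (c * c) \<in> K" using K_ratio(1) abcd(2) by fastforce
    then have "c * c \<in> K" using K_inv by fastforce
    then obtain y where "y \<in> K" "y * y = c * c" using K_sqrt by blast
    then show ?thesis by simp
  qed
  have "H \<subseteq> sl2 K"
  proof
    fix g assume g: "g \<in> H"
    obtain a b c d where e: "g = (a, b, c, d)" by (rule quad_cases)
    have abcd: "(a, b, c, d) \<in> H" using g e by simp
    have dt: "a * d + b * c = 1" using det[OF abcd] .
    show "g \<in> sl2 K"
    proof (cases "c = 0")
      case True
      then have "d = inverse a" using dt inverse_unique[of a d] by simp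
      then show ?thesis using K_diag K_upper abcd K_inv dt K0 unfolding e True by auto
    next
      case False
      have c: "c \<in> K" using K_c[OF abcd False] .
      have "a = a / c * c" "d = d / c * c" using False by simp_all
      then have ad: "a \<in> K" "d \<in> K" using K_mult K_ratio[OF abcd False] c by metis+
      have "b = (1 + a * d) / c" using dt False by (metis add.commute add_self_left nonzero_mult_div_cancel_right)
      then have "b \<in> K" using ad c K0 K_add K_mult K_div by simp
      then show ?thesis using ad c dt by (simp add: e)
    qed
  qed
  moreover have "sl2 K \<subseteq> H"
  proof
    fix g assume g: "g \<in> sl2 K"
    obtain a b c d where e: "g = (a, b, c, d)" by (rule quad_cases)
    have cl: "a \<in> K" "b \<in> K" "c \<in> K" "d \<in> K" and dt: "a * d + b * c = 1" using g by (auto simp: e)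
    show "g \<in> H"
    proof (cases "c = 0")
      case True
      then have "d = inverse a" "a \<noteq> 0" using dt inverse_unique[of a d] by auto
      then show ?thesis using upper_in cl unfolding e True by simp
    next
      case False
      have w': "(0, 1 / c', c', 0) \<in> H" using anti[OF h] .
      have c'K: "c' \<in> K" using K_c[OF h] .
      define l where "l = c' / c"
      have l: "l \<in> K" "l \<noteq> 0" using c'K cl K_div False h(2) by (auto simp: l_def)
      have "(l, 0, 0, inverse l) \<in> H" using upper_in l K0 by blast
      from mult[OF this w'] have w: "(0, 1 / c, c, 0) \<in> H" using False h(2) by (simp add: l_def)
      have u: "(1, a / c, 0, 1) \<in> H" "(1, d / c, 0, 1) \<in> H" using cl K_div by (auto simp: K_def)
      have b: "b = 1 / c + a * d / c"
      proof -
        have "b * c = 1 + a * d" using dt by (metis add.commute add_self_left)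
        then have "b = (1 + a * d) / c" using False by (simp add: field_simps)
        then show ?thesis by (simp add: add_divide_distrib)
      qed
      have "(a, 1 / c, c, 0) \<in> H" using mult[OF u(1) w] False by simp
      from mult[OF this u(2)] show ?thesis using False by (simp add: e b add.commute)
    qed
  qed
  ultimately show ?thesis using K by blast
qed

section \<open>The subgroups of SL2 over a finite field\<close>

lemma (in group) conj_iso:
  assumes g: "g \<in> carrier G"
  shows "(\<lambda>x. g \<otimes> x \<otimes> inv g) \<in> iso G G"
proof (rule isoI)
  show "(\<lambda>x. g \<otimes> x \<otimes> inv g) \<in> hom G G"
    using g by (auto simp: hom_def m_assoc mult_inv_cancel)
  show "bij_betw (\<lambda>x. g \<otimes> x \<otimes> inv g) (carrier G) (carrier G)"
    using g by (intro bij_betw_byWitness[of _ "\<lambda>x. inv g \<otimes> x \<otimes> g"]) (auto simp: m_assoc mult_inv_cancel)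
qed

lemma sl2_subset: "sl2 K \<subseteq> carrier SL"
  by (auto simp: SL_carrier)

lemma finite_sl2: "finite K \<Longrightarrow> finite (sl2 K)"
  by (rule finite_subset[of _ "K \<times> K \<times> K \<times> K"]) (auto simp: sl2_def)

lemma subgroup_sl2:
  assumes K: "is_subfield K"
  shows "subgroup (sl2 K) SL"
proof (rule SL.subgroupI)
  show "sl2 K \<subseteq> carrier SL" by (rule sl2_subset)
  have "\<one>\<^sub>S \<in> sl2 K" using is_subfieldD[OF K] by simp
  then show "sl2 K \<noteq> {}" by blast
  fix x assume x: "x \<in> sl2 K"
  obtain a b c d where e: "x = (a, b, c, d)" by (rule quad_cases)
  show "inv\<^sub>S x \<in> sl2 K" using x by (simp add: e ac_simps)
  fix y assume y: "y \<in> sl2 K"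
  obtain p q r s where e': "y = (p, q, r, s)" by (rule quad_cases)
  have "x \<star> y \<in> carrier SL" using x y sl2_subset by blast
  note det = this[unfolded e e' SL_mult mem_SL]
  have cl: "a \<in> K" "b \<in> K" "c \<in> K" "d \<in> K" "p \<in> K" "q \<in> K" "r \<in> K" "s \<in> K"
    using x y by (simp_all add: e e')
  show "x \<star> y \<in> sl2 K"
    unfolding e e' SL_mult mem_sl2 by (intro conjI is_subfieldD(3,4)[OF K] cl det)
qed

text \<open>
  In the generic case \<open>g \<noteq> 0\<close> the inverse of the conjugating matrix has as columns a fixed vector
  \<open>w * (e + 1, g)\<close> of \<open>z\<close> and the vector \<open>(w, 0)\<close>; the choice \<open>w\<^sup>2 = 1 / g\<close> gives it determinant 1.
\<close>

lemma involution_conj_unipotent: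
  assumes F: "is_subfield F" "finite F"
    and z: "z \<in> sl2 F" "z \<noteq> \<one>\<^sub>S" "tr z = 0"
  shows "\<exists>g\<in>sl2 F. g \<star> z \<star> inv\<^sub>S g = (1, 1, 0, 1)"
proof -
  note F' = is_subfieldD[OF F(1)]
  have sqrt: "\<exists>x\<in>F. x * x = y" if "y \<in> F" for y
  proof (rule sqrt_in_subfield[OF F(2) _ that])
    show "x * x \<in> F" if "x \<in> F" for x using F'(4)[OF that that] .
  qed
  obtain e f g e' where zz: "z = (e, f, g, e')" by (rule quad_cases)
  have e': "e' = e" using z(3) by (simp add: zz add_eq_zero_iff)
  have cl: "e \<in> F" "f \<in> F" "g \<in> F" and det: "e * e + f * g = 1" using z(1) by (auto simp: zz e')
  show ?thesis
  proof (cases "g = 0")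
    case True
    then have e: "e = 1" using det by simp
    then have f: "f \<noteq> 0" using z(2) True by (auto simp: zz e')
    obtain t where t: "t \<in> F" "t * t = inverse f" using sqrt[OF F'(5)[OF cl(2)]] by blast
    then have t0: "t \<noteq> 0" using f by auto
    have "t * f * t = 1" using t(2) f by (metis field_class.field_inverse mult.commute mult.left_commute)
    then have "(t, 0, 0, inverse t) \<star> z \<star> inv\<^sub>S (t, 0, 0, inverse t) = (1, 1, 0, 1)"
      using t0 by (simp add: zz e' e True)
    moreover have "(t, 0, 0, inverse t) \<in> sl2 F" using t t0 F' by simp
    ultimately show ?thesis by blast
  next
    case False
    obtain w where w: "w \<in> F" "w * w = inverse g" using sqrt[OF F'(5)[OF cl(3)]] by blast
    then have wg: "w * w * g = 1" using False by simp
    have dt: "0 * (w * (e + 1)) + w * (w * g) = 1"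
      using wg by (simp only: mult_zero_left add_0_left mult.assoc)
    have "(0, w, w * g, w * (e + 1)) \<in> sl2 F" using dt w cl F' by simp
    moreover have "(0, w, w * g, w * (e + 1)) \<star> z \<star> inv\<^sub>S (0, w, w * g, w * (e + 1)) = (1, 1, 0, 1)"
    proof -
      show ?thesis
        unfolding SL_inv[OF dt] zz e'
        using wg det by (simp add: algebra_simps)
    qed
    ultimately show ?thesis by blast
  qed
qed

text \<open>
  The form of Dickson's theorem that is used here: up to conjugacy a subgroup is upper triangular,
  or normalises the torus through some \<open>x\<close> of nonzero trace, or is \<open>SL\<^sub>2\<close> of a subfield. If there are
  involutions, one of them is moved to the standard unipotent matrix \<open>t\<close>. When \<open>t\<close> is the only
  involution in its centraliser and some element is not upper triangular, the group normalises a torus. When there is a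
  second one, it is conjugate to \<open>t\<close> by an upper triangular matrix with diagonal entry \<open>p \<noteq> 1\<close>, which a further
  conjugation by a unipotent matrix makes diagonal.
\<close>

theorem subgroup_sl2_cases:
  assumes F: "is_subfield F" "finite F" and H: "subgroup H SL" "H \<subseteq> sl2 F"
  obtains g where "g \<in> sl2 F" "\<And>a b c d. (a, b, c, d) \<in> (\<lambda>x. g \<star> x \<star> inv\<^sub>S g) ` H \<Longrightarrow> c = 0"
  | g x where "g \<in> sl2 F" "x \<in> sl2 F" "tr x \<noteq> 0"
      "\<And>h. h \<in> (\<lambda>x. g \<star> x \<star> inv\<^sub>S g) ` H \<Longrightarrow> h \<star> x = x \<star> h \<or> h \<star> x = inv\<^sub>S x \<star> h"
  | g K where "g \<in> sl2 F" "is_subfield K" "(\<lambda>x. g \<star> x \<star> inv\<^sub>S g) ` H = sl2 K"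
proof -
  let ?c = "\<lambda>g x. g \<star> x \<star> inv\<^sub>S g"
  note F' = is_subfieldD[OF F(1)]
  interpret S: subgroup "sl2 F" SL by (rule subgroup_sl2[OF F(1)])
  interpret HH: subgroup H SL by (rule H(1))
  have finH: "finite H" using finite_sl2[OF F(2)] H(2) finite_subset by blast
  have conj1: "?c \<one>\<^sub>S ` H = H"
    using HH.subset by (auto simp: image_iff simp del: SL_one)
  show thesis
  proof (cases "\<exists>z\<in>H. z \<noteq> \<one>\<^sub>S \<and> tr z = 0")
    case no: False
    show thesis
    proof (cases "H = {\<one>\<^sub>S}")
      case True
      have x: "(1, 1, 1, 0) \<in> sl2 F" "tr (1 :: 'a, 1, 1, 0) \<noteq> 0" using F' by auto
      show thesis
        by (rule that(2)[OF S.one_closed x], unfold conj1) (simp add: True)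
    next
      case False
      then obtain x where x: "x \<in> H" "x \<noteq> \<one>\<^sub>S" using HH.one_closed by blast
      show thesis
      proof (rule that(2)[OF S.one_closed], unfold conj1)
        show "x \<in> sl2 F" "tr x \<noteq> 0" using x H(2) no by auto
        show "h \<star> x = x \<star> h \<or> h \<star> x = inv\<^sub>S x \<star> h" if "h \<in> H" for h
          using subgroup_comm_if_no_involution[OF H(1) finH _ that x(1)] no by blast
      qed
    qed
  next
    case True
    then obtain z where z: "z \<in> H" "z \<noteq> \<one>\<^sub>S" "tr z = 0" by blast
    then obtain g where g: "g \<in> sl2 F" "?c g z = (1, 1, 0, 1)"
      using involution_conj_unipotent[OF F, of z] H(2) by blast
    have gG: "g \<in> carrier SL" using g(1) sl2_subset by blast
    define H1 where "H1 = ?c g ` H"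
    have image_subgroup: "subgroup (?c k ` L) SL" if "subgroup L SL" "k \<in> carrier SL" for k L
    proof -
      have "group_hom SL SL (?c k)"
        using SL.conj_iso[OF that(2)] by (simp add: group_hom_def group_hom_axioms_def iso_def)
      then show ?thesis using group_hom.subgroup_img_is_subgroup that(1) by blast
    qed
    have H1: "subgroup H1 SL" "finite H1" "H1 \<subseteq> sl2 F"
      unfolding H1_def using image_subgroup[OF H(1) gG] finH H(2) g(1) by auto
    interpret H1: subgroup H1 SL by (rule H1(1))
    have u1: "(1, 1, 0, 1) \<in> H1" unfolding H1_def using imageI[OF z(1), of "?c g"] unfolding g(2) .
    show thesis
    proof (cases "\<forall>a b c d. (a, b, c, d) \<in> H1 \<longrightarrow> c = 0")
      case True
      then show thesis using that(1)[OF g(1)] unfolding H1_def by blast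
    next
      case False
      then obtain a b c d where h: "(a, b, c, d) \<in> H1" "c \<noteq> 0" by blast
      have dt: "a * d + b * c = 1" using h(1) H1.subset by (metis mem_SL subsetD)
      define t :: "'a \<times> 'a \<times> 'a \<times> 'a" where "t = (1, 1, 0, 1)"
      have conj_t: "?c (p, q, r, s) t = (1 + p * r, p * p, r * r, 1 + p * r)"
        if "p * s + q * r = 1" for p q r s
        unfolding t_def by (rule conj_unipotent[OF that])
      define v where "v = ?c (a, b, c, d) t"
      have v: "v = (1 + a * c, a * a, c * c, 1 + a * c)" unfolding v_def by (rule conj_t[OF dt])
      have t': "t \<in> H1" "t \<noteq> \<one>\<^sub>S" "tr t = 0" using u1 by (auto simp: t_def)
      have "v \<in> H1" unfolding v_def using h(1) t'(1) by (intro H1.m_closed H1.m_inv_closed)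
      then have v': "v \<in> H1" "v \<noteq> \<one>\<^sub>S" "tr v = 0" using h(2) by (simp_all add: v)
      have nc: "t \<star> v \<noteq> v \<star> t"
      proof (rule not_sym)
        show "v \<star> t \<noteq> t \<star> v"
          unfolding t_def v commute_unipotent_iff using h(2) by simp
      qed
      show thesis
      proof (cases "\<exists>x. x \<noteq> 0 \<and> x \<noteq> 1 \<and> (1, x, 0, 1) \<in> H1")
        case True
        then obtain x where x: "x \<noteq> 0" "x \<noteq> 1" "(1, x, 0, 1) \<in> H1" by blast
        obtain k where k: "k \<in> H1" "(1, x, 0, 1) = ?c k t"
          using subgroup_involutions_conjugate[OF H1(1,2) t' v' nc, of "(1, x, 0, 1)"] x by auto
        obtain p q r s where e: "k = (p, q, r, s)" by (rule quad_cases)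
        have kd: "p * s + q * r = 1" using k(1) H1.subset unfolding e by (metis mem_SL subsetD)
        have r: "r = 0" and px: "x = p * p" using k(2) unfolding e conj_t[OF kd] by auto
        have p: "p \<noteq> 0" "p \<noteq> 1" using x px by auto
        have s: "s = inverse p" using kd r inverse_unique[of p s] by simp
        have ps: "p + s \<noteq> 0"
        proof
          assume "p + s = 0"
          then have "s = p" by (simp add: add_eq_zero_iff)
          then have "p * p = 1" using kd r by simp
          then show False using p(2) by simp
        qed
        define y where "y = q / (p + s)"
        have pqs: "p \<in> F" "q \<in> F" "s \<in> F" using k(1) H1(3) unfolding e by auto
        have yF: "y \<in> F" unfolding y_def using pqs F' by simp
        define u :: "'a \<times> 'a \<times> 'a \<times> 'a" where "u = (1, y, 0, 1)"
        have u: "u \<in> sl2 F" using yF F' by (simp add: u_def)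
        have uG: "u \<in> carrier SL" by (simp add: u_def)
        have H2: "subgroup (?c u ` H1) SL" "finite (?c u ` H1)"
          using image_subgroup[OF H1(1) uG] H1(2) by auto
        have ut: "?c u t = t" by (simp add: u_def t_def algebra_simps)
        have 1: "(1, 1, 0, 1) \<in> ?c u ` H1"
          using imageI[OF t'(1), of "?c u"] unfolding ut unfolding t_def .
        have "y * (p + s) = q" using nonzero_eq_divide_eq[OF ps, of y q] y_def by blast
        then have "y * p + y * s = q" by (simp only: distrib_left)
        then have uk: "?c u k = (p, 0, 0, s)" by (simp add: u_def e r) (simp add: algebra_simps)
        have 2: "(p, 0, 0, s) \<in> ?c u ` H1"
          using imageI[OF k(1), of "?c u"] unfolding uk .
        have uh: "?c u (a, b, c, d) = (a + y * c, (a + y * c) * y + (b + y * d), c, c * y + d)"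
          by (simp add: u_def)
        have 3: "(a + y * c, (a + y * c) * y + (b + y * d), c, c * y + d) \<in> ?c u ` H1"
          using imageI[OF h(1), of "?c u"] unfolding uh .
        obtain K where K: "is_subfield K" "?c u ` H1 = sl2 K"
          using subgroup_eq_sl2[OF H2 1 2 p(2) 3 h(2)] by blast
        have "?c (u \<star> g) ` H = ?c u ` H1"
          unfolding H1_def image_image using uG gG HH.subset
          by (intro image_cong) (auto simp: SL.m_assoc SL.inv_mult_group subset_iff simp del: SL_one)
        then show thesis using that(3)[of "u \<star> g" K] K u g(1) by simp
      next
        case False
        have "{h \<in> H1. h \<star> t = t \<star> h} = {\<one>\<^sub>S, t}"
        proof (intro equalityI subsetI)
          fix k assume "k \<in> {h \<in> H1. h \<star> t = t \<star> h}"
          moreover obtain p q r s where e: "k = (p, q, r, s)" by (rule quad_cases)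
          ultimately have k: "(p, q, r, s) \<in> H1" "(p, q, r, s) \<star> t = t \<star> (p, q, r, s)"
            by auto
          have rs: "r = 0" "s = p" using k(2) unfolding t_def commute_unipotent_iff by auto
          have "p * s + q * r = 1" using k(1) H1.subset by (metis mem_SL subsetD)
          then have "p = 1" by (simp add: rs)
          then show "k \<in> {\<one>\<^sub>S, t}" using False k(1) rs by (auto simp: t_def e)
        next
          fix k assume "k \<in> {\<one>\<^sub>S, t}"
          then show "k \<in> {h \<in> H1. h \<star> t = t \<star> h}"
            using t'(1) H1.one_closed H1.subset by (auto simp del: SL_one)
        qed
        then obtain x where "x \<in> H1" "tr x \<noteq> 0"
            "\<forall>h\<in>H1. h \<star> x = x \<star> h \<or> h \<star> x = inv\<^sub>S x \<star> h"
          using subgroup_dihedral[OF H1(1,2) t' v' nc] by blast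
        then show thesis using that(2)[OF g(1), of x] H1(3) unfolding H1_def by blast
      qed
    qed
  qed
qed

section \<open>Orders of finite fields and their prime factors\<close>

abbreviation num_prime_factors :: "nat \<Rightarrow> nat" where
  "num_prime_factors n \<equiv> size (prime_factorization n)"

lemma num_prime_factors_mult:
  fixes m n :: nat
  assumes "m \<noteq> 0" "n > 1"
  shows "num_prime_factors (m * n) \<ge> Suc (num_prime_factors m)"
proof -
  have "prime_factorization n \<noteq> {#}" using assms(2) by (simp add: prime_factorization_empty_iff)
  then have "num_prime_factors n \<ge> 1" by (simp add: Suc_le_eq nonempty_has_size)
  then show ?thesis using assms by (simp add: prime_factorization_mult)
qed

lemma num_prime_factors_pow3_minus_1: "b \<le> num_prime_factors (2 ^ (3 ^ b) - 1)"
proof (induction b)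
  case (Suc b)
  define x :: nat where "x = 2 ^ (3 ^ b)"
  have x: "x \<ge> 2" using self_le_power[of "2::nat" "3 ^ b"] by (simp add: x_def)
  obtain y where y: "x = Suc y" "y > 0" using x by (cases x) auto
  have "2 ^ (3 ^ Suc b) - 1 = x ^ 3 - 1" by (simp add: x_def power_mult[symmetric] mult.commute)
  also have "\<dots> = (x - 1) * (x * x + x + 1)" by (simp add: y power3_eq_cube algebra_simps)
  finally have *: "2 ^ (3 ^ Suc b) - 1 = (x - 1) * (x * x + x + 1)" .
  have "Suc (num_prime_factors (x - 1)) \<le> num_prime_factors ((x - 1) * (x * x + x + 1))"
    using x by (intro num_prime_factors_mult) auto
  then show ?case using Suc unfolding * by (simp add: x_def)
qed simp

text \<open>
  With \<open>x = y + 1\<close> the cofactor of \<open>x + 1\<close> in \<open>x ^ 3 + 1\<close> is \<open>x\<^sup>2 - x + 1 = x * y + 1\<close>, free of subtraction.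
\<close>

lemma num_prime_factors_pow3_plus_1: "b \<le> num_prime_factors (2 ^ (3 ^ b) + 1)"
proof (induction b)
  case (Suc b)
  define x :: nat where "x = 2 ^ (3 ^ b)"
  have x: "x \<ge> 2" using self_le_power[of "2::nat" "3 ^ b"] by (simp add: x_def)
  obtain y where y: "x = Suc y" "y > 0" using x by (cases x) auto
  have "2 ^ (3 ^ Suc b) + 1 = x ^ 3 + 1" by (simp add: x_def power_mult[symmetric] mult.commute)
  also have "\<dots> = (x + 1) * (x * y + 1)" by (simp add: y power3_eq_cube algebra_simps)
  finally have *: "2 ^ (3 ^ Suc b) + 1 = (x + 1) * (x * y + 1)" .
  have "Suc (num_prime_factors (x + 1)) \<le> num_prime_factors ((x + 1) * (x * y + 1))"
    using x y by (intro num_prime_factors_mult) auto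
  then show ?case using Suc unfolding * by (simp add: x_def)
qed simp

lemma mersenne_dvd_imp_dvd:
  assumes "(2::nat) ^ d - 1 dvd 2 ^ k - 1"
  shows "d dvd k"
  using assms
proof (induction k rule: less_induct)
  case (less k)
  have zero: "k = 0" if "(2::nat) ^ k - 1 = 0"
  proof (rule ccontr)
    assume "k \<noteq> 0"
    then show False using self_le_power[of "2::nat" k] that by simp
  qed
  show ?case
  proof (cases "k < d")
    case True
    then have "(2::nat) ^ k - 1 < 2 ^ d - 1"
      by (metis diff_less_mono one_le_numeral one_le_power one_less_numeral_iff power_strict_increasing semiring_norm(76))
    then have "(2::nat) ^ k - 1 = 0" using less.prems by (metis dvd_imp_le not_gr_zero not_le)
    then have "k = 0" by (rule zero)
    then show ?thesis by simp
  next
    case False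
    show ?thesis
    proof (cases "d = 0")
      case True
      then have "(2::nat) ^ k - 1 = 0" using less.prems by simp
      then have "k = 0" by (rule zero)
      then show ?thesis by simp
    next
      case d: False
      define m where "m = k - d"
      have k: "k = m + d" using False by (simp add: m_def)
      have "(2::nat) ^ k - 1 = 2 ^ m * (2 ^ d - 1) + (2 ^ m - 1)"
        by (simp add: k power_add diff_mult_distrib2)
      then have "(2::nat) ^ d - 1 dvd 2 ^ m - 1" using less.prems by (metis dvd_add_right_iff dvd_triv_right)
      then have "d dvd m" using less.IH[of m] d k by simp
      then show ?thesis by (simp add: k)
    qed
  qed
qed

lemma group_additive:
  assumes "is_subfield F"
  shows "group \<lparr>carrier = F, monoid.mult = (+), one = (0::'a::char_two_field)\<rparr>"
  by (rule groupI) (use is_subfieldD[OF assms] in \<open>auto simp: add.assoc intro!: bexI[of _ _]\<close>)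

lemma comm_group_units:
  assumes "is_subfield F"
  shows "comm_group \<lparr>carrier = F - {0}, monoid.mult = (*), one = (1::'a::char_two_field)\<rparr>"
proof (rule comm_groupI)
  fix x assume "x \<in> carrier \<lparr>carrier = F - {0}, monoid.mult = (*), one = 1\<rparr>"
  then show "\<exists>y\<in>carrier \<lparr>carrier = F - {0}, monoid.mult = (*), one = 1\<rparr>.
      y \<otimes>\<^bsub>\<lparr>carrier = F - {0}, monoid.mult = (*), one = 1\<rparr>\<^esub> x = \<one>\<^bsub>\<lparr>carrier = F - {0}, monoid.mult = (*), one = 1\<rparr>\<^esub>"
    using is_subfieldD[OF assms] by (intro bexI[of _ "inverse x"]) auto
qed (use is_subfieldD[OF assms] in \<open>auto simp: mult_ac\<close>)

lemma nat_pow_units: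
  "x [^]\<^bsub>\<lparr>carrier = U, monoid.mult = (*), one = (1::'a::field)\<rparr>\<^esub> (n::nat) = x ^ n"
proof (induction n)
  case 0
  show ?case by (simp add: nat_pow_def)
next
  case (Suc n)
  then show ?case by (simp add: nat_pow_def mult.commute)
qed

lemma subfield_pow_card:
  assumes F: "is_subfield F" "finite F" and x: "x \<in> F"
  shows "x ^ card F = x"
proof (cases "x = 0")
  case True
  have "card F \<noteq> 0" using F is_subfieldD[OF F(1)] by auto
  then show ?thesis using True by simp
next
  case False
  interpret U: comm_group "\<lparr>carrier = F - {0}, monoid.mult = (*), one = 1\<rparr>"
    by (rule comm_group_units[OF F(1)])
  have "x ^ (card F - 1) = 1"
    using U.pow_order_eq_1[of x] x False F is_subfieldD(1)[OF F(1)]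
    by (simp add: nat_pow_units Coset.order_def)
  moreover have "card F = Suc (card F - 1)" using F x by (metis Suc_pred' card_gt_0_iff empty_iff)
  ultimately show ?thesis by (metis mult.right_neutral power_Suc)
qed

text \<open>
  Lagrange's theorem in the additive group makes the order of \<open>K\<close> a power \<open>2 ^ d\<close>, and in the multiplicative
  group it gives that \<open>2 ^ d - 1\<close> divides \<open>2 ^ k - 1\<close>.
\<close>

lemma card_subfield:
  fixes F :: "'a::char_two_field set"
  assumes F: "is_subfield F" "finite F" "card F = 2 ^ k" and K: "is_subfield K" "K \<subseteq> F"
  shows "\<exists>d. card K = 2 ^ d \<and> d dvd k"
proof -
  interpret A: group "\<lparr>carrier = F, monoid.mult = (+), one = (0::'a)\<rparr>" by (rule group_additive[OF F(1)])
  interpret U: comm_group "\<lparr>carrier = F - {0}, monoid.mult = (*), one = (1::'a)\<rparr>" by (rule comm_group_units[OF F(1)])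
  note K' = is_subfieldD[OF K(1)]
  have finK: "finite K" using F(2) K(2) finite_subset by blast
  have "subgroup K \<lparr>carrier = F, monoid.mult = (+), one = (0::'a)\<rparr>"
    by (rule A.finite_closed_subgroup) (use K' K(2) finK in auto)
  from A.lagrange[OF this] have "card K dvd 2 ^ k"
    unfolding Coset.order_def by (simp add: F(3)) (metis dvd_triv_right)
  then obtain d where d: "card K = 2 ^ d" by (metis divides_primepow_nat two_is_prime_nat)
  have "subgroup (K - {0}) \<lparr>carrier = F - {0}, monoid.mult = (*), one = (1::'a)\<rparr>"
  proof (rule U.finite_closed_subgroup)
    have "1 \<in> K - {0}" using K' by simp
    then show "K - {0} \<noteq> {}" by blast
  qed (use K' K(2) finK in auto)
  from U.lagrange[OF this] have "card (K - {0}) dvd card (F - {0})"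
    unfolding Coset.order_def by simp (metis dvd_triv_right)
  then have "(2::nat) ^ d - 1 dvd 2 ^ k - 1"
    using d F K' is_subfieldD(1)[OF F(1)] finK by simp
  then show ?thesis using d mersenne_dvd_imp_dvd by blast
qed

lemma power_add_char_two: "(x + y) ^ (2 ^ n) = x ^ (2 ^ n) + (y :: 'a::char_two_field) ^ (2 ^ n)"
  by (induction n) (simp_all add: power_mult power2_eq_square mult.commute[of 2] square_add)

lemma subfield_fixed_points:
  assumes F: "is_subfield (F :: 'a::char_two_field set)"
  shows "is_subfield {x \<in> F. x ^ (2 ^ n) = x}"
  using is_subfieldD[OF F] unfolding is_subfield_def
  by (auto simp: power_add_char_two power_mult_distrib power_inverse)

text \<open>
  With \<open>m = 2 ^ d - 1\<close>, the \<open>m * N\<close> units of \<open>F\<close> are roots of \<open>X ^ (m * N) - 1\<close>, which is \<open>r = X ^ m - 1\<close>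
  times a polynomial \<open>p\<close> of degree \<open>m * (N - 1)\<close>. As \<open>p\<close> has at most \<open>m * (N - 1)\<close> roots, the remaining
  \<open>m\<close> units are roots of \<open>r\<close>.
\<close>

lemma card_fixed_points:
  fixes F :: "'a::char_two_field set"
  assumes F: "is_subfield F" "finite F" "card F = 2 ^ (d * j)" and d: "d > 0" "j > 0"
  shows "card {x \<in> F. x ^ (2 ^ d) = x} = 2 ^ d"
proof -
  note F' = is_subfieldD[OF F(1)]
  define m :: nat where "m = 2 ^ d - 1"
  have m: "2 ^ d = Suc m" "m > 0" using d self_le_power[of "2::nat" d] by (auto simp: m_def)
  have "m dvd 2 ^ (d * j) - 1"
    unfolding power_mult m(1)
  proof (induction j)
    case (Suc j)
    have *: "Suc m ^ Suc j - 1 = m * Suc m ^ j + (Suc m ^ j - 1)" by simp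
    show ?case unfolding * using Suc by (intro dvd_add) simp_all
  qed simp
  then obtain N where N: "2 ^ (d * j) - 1 = m * N" by blast
  have N0: "N > 0"
  proof (rule ccontr)
    assume "\<not> N > 0"
    then have "(2::nat) ^ (d * j) \<le> 1" using N by simp
    moreover have "(2::nat) ^ (d * j) \<ge> 2" using d self_le_power[of "2::nat" "d * j"] by simp
    ultimately show False by simp
  qed
  have cardU: "card (F - {0}) = m * N" using F F' N by simp
  define p :: "'a poly" where "p = (\<Sum>i<N. monom 1 (m * i))"
  define r :: "'a poly" where "r = monom 1 m - 1"
  have poly_p: "poly p x = (\<Sum>i<N. (x ^ m) ^ i)" for x by (simp add: p_def poly_sum poly_monom power_mult)
  have p0: "p \<noteq> 0"
  proof
    assume "p = 0"
    then have "poly p 0 = 0" by simp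
    moreover have "poly p 0 = 1"
      unfolding poly_p using m N0 by (subst sum.remove[of _ 0]) (auto simp: power_0_left)
    ultimately show False by simp
  qed
  have degp: "degree p \<le> m * (N - 1)"
    unfolding p_def by (intro degree_sum_le order.trans[OF degree_monom_le]) auto
  have poly_r: "poly r x = x ^ m - 1" for x by (simp add: r_def poly_monom)
  have r0: "r \<noteq> 0"
  proof
    assume "r = 0"
    then have "poly r 0 = 0" by simp
    then show False using m by (simp add: poly_r power_0_left)
  qed
  have degr: "degree r \<le> m"
    unfolding r_def by (intro degree_diff_le) (auto simp: degree_monom_le)
  have roots: "F - {0} \<subseteq> {x. poly p x = 0} \<union> {x \<in> F - {0}. x ^ m = 1}"
  proof
    fix x assume x: "x \<in> F - {0}"
    have "x ^ (m * N) = 1"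
    proof -
      have "x ^ card F = x" using subfield_pow_card[OF F(1,2)] x by simp
      moreover have "card F = Suc (m * N)" using N F(3) by (metis Suc_pred' one_less_power pos2 zero_less_power add_diff_inverse_nat plus_1_eq_Suc less_one)
      ultimately show ?thesis using x by simp
    qed
    then have "(x ^ m - 1) * poly p x = 0"
      unfolding poly_p using power_diff_1_eq[of "x ^ m" N] by (simp add: power_mult)
    then show "x \<in> {x. poly p x = 0} \<union> {x \<in> F - {0}. x ^ m = 1}" using x by (auto simp: add_eq_zero_iff)
  qed
  have "m * N \<le> card ({x. poly p x = 0} \<union> {x \<in> F - {0}. x ^ m = 1})"
    using roots card_mono[OF _ roots] poly_roots_finite[OF p0] F(2) cardU by simp
  also have "\<dots> \<le> card {x. poly p x = 0} + card {x \<in> F - {0}. x ^ m = 1}" by (rule card_Un_le)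
  also have "card {x. poly p x = 0} \<le> m * (N - 1)"
    using card_poly_roots_bound[OF p0] degp by simp
  finally have "m * N \<le> m * (N - 1) + card {x \<in> F - {0}. x ^ m = 1}" by simp
  moreover have "m * N = m * (N - 1) + m" using N0 by (cases N) auto
  ultimately have ge: "m \<le> card {x \<in> F - {0}. x ^ m = 1}" by simp
  have "card {x \<in> F - {0}. x ^ m = 1} \<le> card {x. poly r x = 0}"
    using poly_roots_finite[OF r0] by (intro card_mono) (auto simp: poly_r)
  also have "\<dots> \<le> m" using card_poly_roots_bound[OF r0] degr by simp
  finally have c: "card {x \<in> F - {0}. x ^ m = 1} = m" using ge by simp
  have "{x \<in> F. x ^ (2 ^ d) = x} = insert 0 {x \<in> F - {0}. x ^ m = 1}"
    unfolding m(1) using F' by auto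
  then show ?thesis using c F(2) m by simp
qed

section \<open>Chains below Borel subgroups and torus normalisers\<close>

text \<open>
  The centraliser consists of the matrices \<open>p + r x\<close> of determinant 1, so it corresponds to the conic
  \<open>p\<^sup>2 + p r t + r\<^sup>2 = 1\<close>, where \<open>t\<close> is the trace of \<open>x\<close>. The lines through the point \<open>(1, 0)\<close> with slope parameter \<open>l\<close>
  meet it in one further point, unless \<open>l\<close> is a root of \<open>l\<^sup>2 + l t + 1\<close>. That polynomial has no root
  or two of them, as \<open>l + t\<close> is a root along with \<open>l\<close>, so the conic has \<open>q + 1\<close> or \<open>q - 1\<close> points.
\<close>

lemma card_centralizer:
  fixes F :: "'a::char_two_field set"
  assumes F: "is_subfield F" "finite F" and x: "x \<in> sl2 F" "tr x \<noteq> 0"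
  shows "card {g \<in> sl2 F. g \<star> x = x \<star> g} \<in> {card F - 1, card F + 1}"
proof -
  note F' = is_subfieldD[OF F(1)]
  obtain a b c d where e: "x = (a, b, c, d)" by (rule quad_cases)
  define t where "t = a + d"
  have t0: "t \<noteq> 0" using x(2) by (simp add: e t_def)
  have cl: "a \<in> F" "b \<in> F" "c \<in> F" "d \<in> F" and det: "a * d + b * c = 1" using x(1) by (auto simp: e)
  have tF: "t \<in> F" using cl F' by (simp add: t_def)
  have d: "d = a + t" by (simp add: t_def)
  define S where "S = {(p, r). p \<in> F \<and> r \<in> F \<and> p * p + p * r * t + r * r = 1}"
  let ?f = "\<lambda>(p, r). (p + r * a, r * b, r * c, p + r * d)"
  have norm: "(p + r * a) * (p + r * d) + (r * b) * (r * c) = p * p + p * r * t + r * r" for p r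
  proof -
    have "(p + r * a) * (p + r * d) + (r * b) * (r * c) = p * p + p * r * (a + d) + r * r * (a * d + b * c)"
      by (simp add: algebra_simps)
    then show ?thesis by (simp add: det t_def)
  qed
  have "{g \<in> sl2 F. g \<star> x = x \<star> g} = ?f ` S"
  proof (intro equalityI subsetI)
    fix g assume g: "g \<in> {g \<in> sl2 F. g \<star> x = x \<star> g}"
    obtain p q r s where e': "g = (p, q, r, s)" by (rule quad_cases)
    have gc: "p \<in> F" "q \<in> F" "r \<in> F" "s \<in> F" "p * s + q * r = 1" using g by (auto simp: e')
    have "g \<star> x = x \<star> g" using g by simp
    then have comm: "(p + s) * b = t * q" "(p + s) * c = t * r"
      unfolding e e' SL_commute_iff t_def by auto
    define k where "k = (p + s) / t"
    have kF: "k \<in> F" using gc tF F' by (simp add: k_def)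
    have kt: "k * t = p + s" using t0 by (simp add: k_def)
    have q: "q = k * b" "r = k * c" using comm t0 by (simp_all add: k_def field_simps)
    define m where "m = p + k * a"
    have mF: "m \<in> F" using gc kF cl F' by (simp add: m_def)
    have p: "p = m + k * a" by (simp add: m_def add.assoc)
    have "m + k * d = p + k * a + (k * a + k * t)" unfolding m_def d by (simp only: distrib_left)
    also have "\<dots> = s" unfolding kt by (simp add: ac_simps)
    finally have s: "s = m + k * d" by simp
    have "m * m + m * k * t + k * k = 1" using norm[of m k] gc(5) unfolding p s q by simp
    then have "(m, k) \<in> S" using mF kF by (simp add: S_def)
    moreover have "g = ?f (m, k)" unfolding e' p s q by simp
    ultimately show "g \<in> ?f ` S" by blast
  next
    fix g assume "g \<in> ?f ` S"
    then obtain p r where pr: "(p, r) \<in> S" "g = ?f (p, r)" by auto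
    then have "p \<in> F" "r \<in> F" "p * p + p * r * t + r * r = 1" by (auto simp: S_def)
    then have "g \<in> sl2 F" using cl F' norm[of p r] unfolding pr(2) by simp
    moreover have "g \<star> x = x \<star> g"
      unfolding pr(2) e by (simp only: prod.case SL_commute_iff) (simp add: algebra_simps)
    ultimately show "g \<in> {g \<in> sl2 F. g \<star> x = x \<star> g}" by simp
  qed
  moreover have "inj_on ?f S"
  proof (rule inj_onI, clarify)
    fix p r p' r'
    assume *: "p + r * a = p' + r' * a" "p + r * d = p' + r' * d"
    have "(p + r * a) + (p + r * d) = (p' + r' * a) + (p' + r' * d)" using * by simp
    moreover have "(p + r * a) + (p + r * d) = r * t" for p r unfolding d by (simp add: algebra_simps)
    ultimately have "r * t = r' * t" by simp
    then have "r = r'" using t0 by simp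
    then show "p = p' \<and> r = r'" using *(1) by simp
  qed
  ultimately have card1: "card {g \<in> sl2 F. g \<star> x = x \<star> g} = card S"
    by (simp add: card_image)
  let ?n = "\<lambda>l. l * l + l * t + 1"
  define R where "R = {l \<in> F. ?n l = 0}"
  let ?h = "\<lambda>l. (1 + l * (t / ?n l), t / ?n l)"
  have "S = insert (1, 0) (?h ` (F - R))"
  proof (intro equalityI subsetI)
    fix z assume "z \<in> S"
    moreover obtain p r where z: "z = (p, r)" by (cases z)
    ultimately have pr: "p \<in> F" "r \<in> F" "p * p + p * r * t + r * r = 1" by (auto simp: S_def)
    show "z \<in> insert (1, 0) (?h ` (F - R))"
    proof (cases "r = 0")
      case True
      then show ?thesis using pr(3) by (simp add: z)
    next
      case False
      define l where "l = (p + 1) / r"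
      have lF: "l \<in> F" using pr F' by (simp add: l_def)
      have "l * r = p + 1" using False by (simp add: l_def)
      then have p: "p = 1 + l * r" by (simp add: add.commute)
      have "(1 + l * r) * (1 + l * r) + (1 + l * r) * r * t + r * r = 1 + r * (r * ?n l + t)"
        by (simp add: algebra_simps)
      then have "r * (r * ?n l + t) = 0"
        using pr(3) unfolding p by (metis add_cancel_left_right)
      then have rn: "r * ?n l = t" using False by (metis add_eq_zero_iff mult_eq_0_iff)
      then have n0: "?n l \<noteq> 0" using t0 by (metis mult_zero_right)
      have r: "r = t / ?n l" using nonzero_eq_divide_eq[OF n0, of r t] rn by blast
      have "z = ?h l" unfolding z using p r by metis
      moreover have "l \<in> F - R" using lF n0 by (simp add: R_def)
      ultimately show ?thesis by blast
    qed
  next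
    fix z assume "z \<in> insert (1, 0) (?h ` (F - R))"
    then consider "z = (1, 0)" | l where "l \<in> F" "?n l \<noteq> 0" "z = ?h l" by (auto simp: R_def)
    then show "z \<in> S"
    proof cases
      case 1
      then show ?thesis using F' by (simp add: S_def)
    next
      case 2
      define r where "r = t / ?n l"
      have rF: "r \<in> F" unfolding r_def using 2(1) tF F' by (intro F'(6) F'(3) F'(4)) auto
      have rn: "r * ?n l = t" unfolding r_def using 2(2) by (rule nonzero_eq_divide_eq[THEN iffD1]) simp
      have "(1 + l * r) * (1 + l * r) + (1 + l * r) * r * t + r * r = 1 + r * (r * ?n l + t)"
        by (simp add: algebra_simps)
      then have "(1 + l * r) * (1 + l * r) + (1 + l * r) * r * t + r * r = 1" unfolding rn by simp
      moreover have "1 + l * r \<in> F" using rF 2(1) F' by simp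
      ultimately show ?thesis using rF unfolding 2(3) r_def[symmetric] by (simp add: S_def)
    qed
  qed
  moreover have "inj_on ?h (F - R)"
  proof (rule inj_onI)
    fix l k assume l: "l \<in> F - R" and k: "k \<in> F - R" and eq: "?h l = ?h k"
    define r where "r = t / ?n l"
    have "?n l \<noteq> 0" using l by (auto simp: R_def)
    then have r0: "r \<noteq> 0" using t0 by (simp add: r_def)
    have "t / ?n k = r" "1 + l * r = 1 + k * r" using eq by (auto simp: r_def)
    then show "l = k" using r0 by simp
  qed
  moreover have "(1, 0) \<notin> ?h ` (F - R)" using t0 by (auto simp: R_def)
  ultimately have "card S = Suc (card (F - R))" using F(2) by (simp add: card_image)
  moreover have "card R = 0 \<or> card R = 2"
  proof (cases "R = {}")
    case False
    then obtain l where l: "l \<in> F" "?n l = 0" by (auto simp: R_def)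
    have "R = {l, l + t}"
    proof (intro equalityI subsetI)
      fix k assume k: "k \<in> R"
      have "(k + l) * (k + (l + t)) = ?n k + ?n l" by (simp add: algebra_simps)
      also have "\<dots> = 0" using k l by (simp add: R_def)
      finally show "k \<in> {l, l + t}" by (simp add: add_eq_zero_iff)
    next
      fix k assume "k \<in> {l, l + t}"
      moreover have "?n (l + t) = ?n l" by (simp add: algebra_simps)
      ultimately show "k \<in> R" using l tF F' by (auto simp: R_def)
    qed
    moreover have "l \<noteq> l + t" using t0 by simp
    ultimately show ?thesis by simp
  qed simp
  moreover have "card (F - R) = card F - card R" using F(2) by (intro card_Diff_subset) (auto simp: R_def)
  moreover have "card R \<le> card F" using F(2) by (intro card_mono) (auto simp: R_def)
  ultimately have "card S = card F - 1 \<or> card S = card F + 1" by linarith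
  then show ?thesis unfolding card1 by simp
qed

definition borel :: "'a::char_two_field set \<Rightarrow> ('a \<times> 'a \<times> 'a \<times> 'a) set" where
  "borel F = {(a, b, c, d) \<in> sl2 F. c = 0}"

lemma subgroup_borel:
  assumes F: "is_subfield F" "finite F"
  shows "subgroup (borel F) SL"
proof (rule SL.finite_closed_subgroup)
  interpret S: subgroup "sl2 F" SL by (rule subgroup_sl2[OF F(1)])
  show "borel F \<subseteq> carrier SL" by (auto simp: borel_def)
  show "finite (borel F)" by (rule finite_subset[OF _ finite_sl2[OF F(2)]]) (auto simp: borel_def)
  have "\<one>\<^sub>S \<in> borel F" using is_subfieldD[OF F(1)] by (simp add: borel_def)
  then show "borel F \<noteq> {}" by blast
  fix u v assume *: "u \<in> borel F" "v \<in> borel F"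
  then have "u \<star> v \<in> sl2 F" by (intro S.m_closed) (auto simp: borel_def)
  then show "u \<star> v \<in> borel F" using * by (auto simp: borel_def)
qed

lemma borel_chain_length:
  fixes F :: "'a::char_two_field set"
  assumes F: "is_subfield F" "finite F" and chain: "unrefinable_chain (SL\<lparr>carrier := borel F\<rparr>) t C"
  shows "num_prime_factors (card F - 1) \<le> t"
proof -
  let ?B = "SL\<lparr>carrier := borel F\<rparr>"
  let ?U = "\<lparr>carrier = UNIV - {0}, monoid.mult = (*), one = (1::'a)\<rparr>"
  let ?\<phi> = "\<lambda>(a, b, c, d). a"
  interpret B: group ?B using subgroup_borel[OF F] by (rule SL.subgroup_imp_group)
  have "is_subfield (UNIV :: 'a set)" by (simp add: is_subfield_def)
  then have U: "comm_group ?U" by (rule comm_group_units)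
  interpret U: comm_group ?U by (rule U)
  note F' = is_subfieldD[OF F(1)]
  have mem: "(a, b, c, d) \<in> borel F \<longleftrightarrow> a \<in> F \<and> b \<in> F \<and> c = 0 \<and> d \<in> F \<and> a * d = 1" for a b c d
    using F' by (auto simp: borel_def)
  have inv_B: "inv\<^bsub>?B\<^esub> g = inv\<^sub>S g" if "g \<in> borel F" for g
    using SL.m_inv_consistent[OF subgroup_borel[OF F] that] .
  have hom: "?\<phi> \<in> hom ?B ?U"
    by (rule homI) (auto simp: mem)
  have "num_prime_factors (card (?\<phi> ` borel F)) \<le> t"
  proof (rule B.prime_factors_le_chain_length[OF _ _ U _ _ chain])
    show "finite (carrier ?B)"
    proof -
      have "borel F \<subseteq> sl2 F" by (auto simp: borel_def)
      then show ?thesis using finite_subset[OF _ finite_sl2[OF F(2)]] by simp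
    qed
    show "subgroup (borel F) ?B" using B.subgroup_self by simp
    show "?\<phi> \<in> hom (?B\<lparr>carrier := borel F\<rparr>) ?U" using hom by simp
    fix g n assume gn: "g \<in> carrier ?B" "n \<in> borel F"
    then have n: "n \<in> carrier ?B" by simp
    have "?\<phi> (g \<otimes>\<^bsub>?B\<^esub> n \<otimes>\<^bsub>?B\<^esub> inv\<^bsub>?B\<^esub> g) = ?\<phi> n"
    proof -
      obtain a b c d p q r s where e: "g = (a, b, c, d)" "n = (p, q, r, s)" by (metis prod_cases4)
      have g: "a * d = 1" "c = 0" and r: "r = 0" using gn unfolding e by (simp_all add: mem)
      have "inv\<^bsub>?B\<^esub> g = (d, b, c, a)" using gn(1) inv_B[of g] SL_inv[of a d b c] g by (simp add: e)
      moreover have "a * p * d = p" using g(1) by (metis mult.commute mult.left_commute mult.right_neutral)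
      ultimately show ?thesis by (simp add: e g(2) r)
    qed
    moreover have "g \<otimes>\<^bsub>?B\<^esub> n \<otimes>\<^bsub>?B\<^esub> inv\<^bsub>?B\<^esub> g \<in> carrier ?B"
      using gn(1) n by (intro B.m_closed B.inv_closed)
    ultimately show "g \<otimes>\<^bsub>?B\<^esub> n \<otimes>\<^bsub>?B\<^esub> inv\<^bsub>?B\<^esub> g \<in> borel F \<and>
        ?\<phi> (g \<otimes>\<^bsub>?B\<^esub> n \<otimes>\<^bsub>?B\<^esub> inv\<^bsub>?B\<^esub> g) \<in> {?\<phi> n, inv\<^bsub>?U\<^esub> ?\<phi> n}" by simp
  qed
  moreover have "?\<phi> ` borel F = F - {0}"
  proof (intro equalityI subsetI)
    fix a assume "a \<in> F - {0}"
    then have "(a, 0, 0, inverse a) \<in> borel F" using F' by (simp add: mem)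
    then show "a \<in> ?\<phi> ` borel F" by (rule rev_image_eqI) simp
  qed (auto simp: mem)
  ultimately show ?thesis using F F' by simp
qed

text \<open>
  When \<open>x\<close> has nonzero trace, this is the normaliser in \<open>sl2 F\<close> of the centraliser of \<open>x\<close>, which is a maximal torus.
\<close>

definition torus_normalizer where
  "torus_normalizer F x = {h \<in> sl2 F. h \<star> x = x \<star> h \<or> h \<star> x = inv\<^sub>S x \<star> h}"

lemma subgroup_torus_normalizer:
  assumes F: "is_subfield F" "finite F" and x: "x \<in> sl2 F"
  shows "subgroup (torus_normalizer F x) SL"
proof (rule SL.finite_closed_subgroup)
  interpret S: subgroup "sl2 F" SL by (rule subgroup_sl2[OF F(1)])
  have xG: "x \<in> carrier SL" using x by simp
  show "torus_normalizer F x \<subseteq> carrier SL" using S.subset by (auto simp: torus_normalizer_def)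
  show "finite (torus_normalizer F x)"
    by (rule finite_subset[OF _ finite_sl2[OF F(2)]]) (auto simp: torus_normalizer_def)
  have "\<one>\<^sub>S \<in> torus_normalizer F x" using S.one_closed xG by (simp add: torus_normalizer_def del: SL_one)
  then show "torus_normalizer F x \<noteq> {}" by blast
  fix u v assume uv: "u \<in> torus_normalizer F x" "v \<in> torus_normalizer F x"
  then have uvF: "u \<in> sl2 F" "v \<in> sl2 F" by (auto simp: torus_normalizer_def)
  then have uvG: "u \<in> carrier SL" "v \<in> carrier SL" by simp_all
  let ?i = "inv\<^sub>S x"
  have inv_swap: "h \<star> ?i = ?i \<star> h \<and> h \<star> x = x \<star> h \<or> h \<star> ?i = x \<star> h \<and> h \<star> x = ?i \<star> h"
    if "h \<in> torus_normalizer F x" for h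
  proof -
    have hG: "h \<in> carrier SL" using that S.subset by (auto simp: torus_normalizer_def)
    have "h \<star> x = x \<star> h \<or> h \<star> x = ?i \<star> h" using that by (simp add: torus_normalizer_def)
    then show ?thesis
    proof
      assume c: "h \<star> x = x \<star> h"
      have "?i \<star> (h \<star> x) \<star> ?i = ?i \<star> (x \<star> h) \<star> ?i" using c by simp
      then have "?i \<star> h = h \<star> ?i" using hG xG by (simp add: SL.m_assoc SL.mult_inv_cancel del: SL_one)
      then show ?thesis using c by simp
    next
      assume c: "h \<star> x = ?i \<star> h"
      have "x \<star> (h \<star> x) \<star> ?i = x \<star> (?i \<star> h) \<star> ?i" using c by simp
      then have "x \<star> h = h \<star> ?i" using hG xG by (simp add: SL.m_assoc SL.mult_inv_cancel del: SL_one)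
      then show ?thesis using c by simp
    qed
  qed
  have "u \<star> v \<star> x = x \<star> (u \<star> v) \<or> u \<star> v \<star> x = ?i \<star> (u \<star> v)"
  proof -
    have 1: "u \<star> v \<star> x = u \<star> (v \<star> x)" using uvG xG by (simp add: SL.m_assoc)
    have 2: "u \<star> (y \<star> v) = u \<star> y \<star> v" if "y \<in> carrier SL" for y using uvG that by (simp add: SL.m_assoc)
    have 3: "y \<star> u \<star> v = y \<star> (u \<star> v)" if "y \<in> carrier SL" for y using uvG that by (simp add: SL.m_assoc)
    have iG: "?i \<in> carrier SL" using xG by simp
    from inv_swap[OF uv(1)] inv_swap[OF uv(2)] show ?thesis
      using 1 2[OF xG] 2[OF iG] 3[OF xG] 3[OF iG] by metis
  qed
  then show "u \<star> v \<in> torus_normalizer F x"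
    using S.m_closed[OF uvF] by (simp add: torus_normalizer_def)
qed

text \<open>
  A conjugate of an element \<open>n\<close> of the torus by \<open>g\<close> commutes with \<open>x\<close> or its inverse, hence lies in the torus and
  commutes with \<open>n\<close>. Having the same trace as \<open>n\<close>, it is \<open>n\<close> or the inverse of \<open>n\<close>.
\<close>

lemma torus_chain_length:
  fixes F :: "'a::char_two_field set"
  assumes F: "is_subfield F" "finite F" and x: "x \<in> sl2 F" "tr x \<noteq> 0"
    and chain: "unrefinable_chain (SL\<lparr>carrier := torus_normalizer F x\<rparr>) t C"
  shows "num_prime_factors (card {g \<in> sl2 F. g \<star> x = x \<star> g}) \<le> t"
proof -
  let ?N = "SL\<lparr>carrier := torus_normalizer F x\<rparr>"
  let ?T = "{g \<in> sl2 F. g \<star> x = x \<star> g}"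
  note sN = subgroup_torus_normalizer[OF F x(1)]
  interpret S: subgroup "sl2 F" SL by (rule subgroup_sl2[OF F(1)])
  interpret N: group ?N using sN by (rule SL.subgroup_imp_group)
  have xG: "x \<in> carrier SL" using x by simp
  have x1: "x \<noteq> \<one>\<^sub>S" using x(2) by auto
  have TG: "g \<in> carrier SL" if "g \<in> ?T" for g using that S.subset by blast
  have T_comm: "g \<star> h = h \<star> g" if "g \<in> ?T" "h \<in> ?T" for g h
    using SL_commute_trans[of x g h] that xG x1 TG by auto
  have sT: "subgroup ?T SL"
  proof (rule SL.finite_closed_subgroup)
    show "?T \<subseteq> carrier SL" using TG by blast
    show "finite ?T" using finite_sl2[OF F(2)] by simp
    show "?T \<noteq> {}" using x by blast
    fix u v assume uv: "u \<in> ?T" "v \<in> ?T"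
    then have "u \<star> v \<star> x = u \<star> (x \<star> v)" using TG[OF uv(1)] TG[OF uv(2)] xG by (simp add: SL.m_assoc)
    also have "\<dots> = (u \<star> x) \<star> v" using TG[OF uv(1)] TG[OF uv(2)] xG by (simp add: SL.m_assoc)
    also have "\<dots> = x \<star> (u \<star> v)" using uv TG[OF uv(1)] TG[OF uv(2)] xG by (simp add: SL.m_assoc)
    finally show "u \<star> v \<in> ?T" using uv by simp
  qed
  have TN: "?T \<subseteq> torus_normalizer F x" by (auto simp: torus_normalizer_def)
  have comm_T: "comm_group (SL\<lparr>carrier := ?T\<rparr>)"
    using SL.subgroup_imp_group[OF sT] T_comm by (intro group.group_comm_groupI) auto
  have inv_N: "inv\<^bsub>?N\<^esub> g = inv\<^sub>S g" if "g \<in> torus_normalizer F x" for g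
    using SL.m_inv_consistent[OF sN that] .
  have inv_T: "inv\<^bsub>SL\<lparr>carrier := ?T\<rparr>\<^esub> g = inv\<^sub>S g" if "g \<in> ?T" for g
    using SL.m_inv_consistent[OF sT that] .
  have "num_prime_factors (card ((\<lambda>g. g) ` ?T)) \<le> t"
  proof (rule N.prime_factors_le_chain_length[OF _ _ comm_T _ _ chain])
    show "finite (carrier ?N)"
    proof -
      have "torus_normalizer F x \<subseteq> sl2 F" by (auto simp: torus_normalizer_def)
      then show ?thesis using finite_subset[OF _ finite_sl2[OF F(2)]] by simp
    qed
    show "subgroup ?T ?N" using SL.subgroup_of_subgroup_iff[OF sN] sT TN by blast
    show "(\<lambda>g. g) \<in> hom (?N\<lparr>carrier := ?T\<rparr>) (SL\<lparr>carrier := ?T\<rparr>)" by (simp add: hom_def)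
    fix g n assume gn: "g \<in> carrier ?N" "n \<in> ?T"
    then have g: "g \<in> torus_normalizer F x" "g \<in> sl2 F" "g \<in> carrier SL" using S.subset by (auto simp: torus_normalizer_def)
    have n: "n \<in> sl2 F" "n \<in> carrier SL" using gn(2) S.subset by auto
    define m where "m = g \<star> n \<star> inv\<^sub>S g"
    have m: "m \<in> sl2 F" "m \<in> carrier SL" using g n by (simp_all add: m_def)
    define y where "y = g \<star> x \<star> inv\<^sub>S g"
    have yG: "y \<in> carrier SL" using g xG by (simp add: y_def)
    have "g \<star> x = x \<star> g \<or> g \<star> x = inv\<^sub>S x \<star> g" using g(1) by (simp add: torus_normalizer_def)
    then have "y = x \<star> g \<star> inv\<^sub>S g \<or> y = inv\<^sub>S x \<star> g \<star> inv\<^sub>S g"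
      unfolding y_def by metis
    then have y: "y = x \<or> y = inv\<^sub>S x"
      using g xG by (simp add: SL.m_assoc del: SL_one)
    have nx: "n \<star> x = x \<star> n" using gn(2) by simp
    have "m \<star> y = g \<star> (n \<star> x) \<star> inv\<^sub>S g"
      unfolding m_def y_def using g n xG by (simp add: SL.m_assoc SL.mult_inv_cancel del: SL_one)
    also have "\<dots> = y \<star> m"
      unfolding nx m_def y_def using g n xG by (simp add: SL.m_assoc SL.mult_inv_cancel del: SL_one)
    finally have my: "y \<star> m = m \<star> y" by simp
    have yx: "y \<star> x = x \<star> y" using y xG by (auto simp del: SL_one)
    have y1: "y \<noteq> \<one>\<^sub>S"
    proof
      assume "y = \<one>\<^sub>S"
      then have "inv\<^sub>S x = \<one>\<^sub>S" using y x1 by metis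
      then have "inv\<^sub>S (inv\<^sub>S x) = \<one>\<^sub>S" by (simp only: SL.inv_one)
      then show False using x1 xG by (simp del: SL_one)
    qed
    have "m \<star> x = x \<star> m" using SL_commute_trans[OF yG m(2) xG y1 my yx] .
    then have mT: "m \<in> ?T" using m by simp
    have "m \<in> {n, inv\<^sub>S n}"
    proof (cases "n = \<one>\<^sub>S")
      case True
      then show ?thesis unfolding m_def using g by (simp del: SL_one)
    next
      case False
      have "tr n \<noteq> 0" using commute_involution_imp_tr_zero[OF n(2) xG False _ nx] x(2) by blast
      then show ?thesis
        using commute_same_tr[OF n(2) m(2) T_comm[OF gn(2) mT]] tr_conj[OF g(3) n(2)] by (simp add: m_def)
    qed
    then show "g \<otimes>\<^bsub>?N\<^esub> n \<otimes>\<^bsub>?N\<^esub> inv\<^bsub>?N\<^esub> g \<in> ?T \<and>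
        g \<otimes>\<^bsub>?N\<^esub> n \<otimes>\<^bsub>?N\<^esub> inv\<^bsub>?N\<^esub> g \<in> {n, inv\<^bsub>SL\<lparr>carrier := ?T\<rparr>\<^esub> n}"
      using mT unfolding inv_N[OF g(1)] inv_T[OF gn(2)] by (simp add: m_def)
  qed
  then show ?thesis by simp
qed

text \<open>
  For the field with two elements the conclusion fails: \<open>SL\<^sub>2(2)\<close> is the dihedral group of order 6. Hence
  the assumption on \<open>l\<close>.
\<close>

lemma torus_normalizer_neq_sl2:
  assumes F: "is_subfield F" and l: "l \<in> F" "l \<noteq> 0" "l \<noteq> 1" and x: "x \<in> sl2 F" "tr x \<noteq> 0"
  shows "torus_normalizer F x \<noteq> sl2 F"
proof
  assume eq: "torus_normalizer F x = sl2 F"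
  note F' = is_subfieldD[OF F]
  obtain a b c d where e: "x = (a, b, c, d)" by (rule quad_cases)
  have det: "a * d + b * c = 1" and ad: "a \<noteq> d" using x by (auto simp: e)
  have key: "g \<star> x = x \<star> g \<or> g \<star> x = (d, b, c, a) \<star> g" if "g \<in> sl2 F" for g
    using that SL_inv[OF det] unfolding eq[symmetric] by (simp add: torus_normalizer_def e)
  \<comment> \<open>A diagonal matrix forces \<open>b = c = 0\<close>, and then a unipotent one forces \<open>a = d\<close>.\<close>
  have "(l, 0, 0, inverse l) \<in> sl2 F" using l F' by simp
  from key[OF this] have "(l * b = b * inverse l \<and> inverse l * c = c * l) \<or> l * a = d * l"
    by (auto simp: e)
  moreover have "l \<noteq> inverse l"
  proof
    assume "l = inverse l"
    then have "l * l = 1" using l(2) by (metis right_inverse)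
    then show False using l(3) by simp
  qed
  ultimately have bc: "b = 0" "c = 0" using ad l(2) by (auto simp: mult.commute[of _ l] mult.commute[of _ "inverse l"])
  have "(1, 1, 0, 1) \<in> sl2 F" using F' by simp
  from key[OF this] show False using ad by (auto simp: e bc)
qed

section \<open>The induction over the tower of fields\<close>

theorem sl2_chain_length:
  fixes F :: "'a::char_two_field set"
  assumes "is_subfield F" "finite F" "card F = 2 ^ (3 ^ b)"
    and "unrefinable_chain (SL\<lparr>carrier := sl2 F\<rparr>) t C"
  shows "b \<le> t"
  using assms
proof (induction b arbitrary: F t C)
  case 0
  show ?case by simp
next
  case (Suc b)
  note F = Suc.prems(1,2) and F' = is_subfieldD[OF Suc.prems(1)]
  interpret S: subgroup "sl2 F" SL by (rule subgroup_sl2[OF F(1)])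
  have u1: "(1, 1, 0, 1) \<in> sl2 F" using F' by simp
  have "t \<noteq> 0"
  proof
    assume "t = 0"
    have "C 0 = sl2 F" "C t = {\<one>\<^sub>S}"
      using Suc.prems(4) unfolding unrefinable_chain_def by simp_all
    then have "sl2 F = {\<one>\<^sub>S}" using \<open>t = 0\<close> by metis
    then show False using u1 by auto
  qed
  then obtain t' where t: "t = Suc t'" by (cases t) auto
  have max: "maximal_subgroup (C 1) (SL\<lparr>carrier := sl2 F\<rparr>)"
    using Suc.prems(4) unfolding unrefinable_chain_def t by auto
  have M: "subgroup (C 1) SL" "C 1 \<subseteq> sl2 F"
    using max unfolding SL.maximal_subgroup_within[OF subgroup_sl2[OF F(1)]] by auto
  let ?c = "\<lambda>g x. g \<star> x \<star> inv\<^sub>S g"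
  \<comment> \<open>The conjugated chain is unrefinable too, so \<open>C 1\<close> may be replaced by any of its conjugates.\<close>
  have conj: "unrefinable_chain (SL\<lparr>carrier := ?c g ` C 1\<rparr>) t' (\<lambda>i. ?c g ` C (Suc i)) \<and>
      subgroup (?c g ` C 1) SL \<and> ?c g ` C 1 \<subset> sl2 F \<and>
      (\<forall>K. subgroup K SL \<longrightarrow> ?c g ` C 1 \<subseteq> K \<longrightarrow> K \<subset> sl2 F \<longrightarrow> K = ?c g ` C 1)"
    if g: "g \<in> sl2 F" for g
  proof -
    interpret G: group "SL\<lparr>carrier := sl2 F\<rparr>" by (rule SL.subgroup_imp_group[OF subgroup_sl2[OF F(1)]])
    have "(\<lambda>x. g \<otimes>\<^bsub>SL\<lparr>carrier := sl2 F\<rparr>\<^esub> x \<otimes>\<^bsub>SL\<lparr>carrier := sl2 F\<rparr>\<^esub> inv\<^bsub>SL\<lparr>carrier := sl2 F\<rparr>\<^esub> g)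
        \<in> iso (SL\<lparr>carrier := sl2 F\<rparr>) (SL\<lparr>carrier := sl2 F\<rparr>)"
      using g by (intro G.conj_iso) simp
    moreover have "inv\<^bsub>SL\<lparr>carrier := sl2 F\<rparr>\<^esub> g = inv\<^sub>S g"
      using SL.m_inv_consistent[OF subgroup_sl2[OF F(1)] g] .
    ultimately have "?c g \<in> iso (SL\<lparr>carrier := sl2 F\<rparr>) (SL\<lparr>carrier := sl2 F\<rparr>)" by (simp del: SL.m_inv_consistent)
    then have ch: "unrefinable_chain (SL\<lparr>carrier := sl2 F\<rparr>) (Suc t') (\<lambda>i. ?c g ` C i)"
      using G.unrefinable_chain_iso_image[OF G.is_group] Suc.prems(4) t by blast
    then have "maximal_subgroup (?c g ` C 1) (SL\<lparr>carrier := sl2 F\<rparr>)"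
      unfolding unrefinable_chain_def by auto
    then have "subgroup (?c g ` C 1) SL \<and> ?c g ` C 1 \<subset> sl2 F \<and>
      (\<forall>K. subgroup K SL \<longrightarrow> ?c g ` C 1 \<subseteq> K \<longrightarrow> K \<subset> sl2 F \<longrightarrow> K = ?c g ` C 1)"
      unfolding SL.maximal_subgroup_within[OF subgroup_sl2[OF F(1)]] by blast
    then show ?thesis using unrefinable_chain_tail[OF ch] by simp
  qed
  show ?case
  proof (rule subgroup_sl2_cases[OF F M])
    fix g assume g: "g \<in> sl2 F" and upper: "\<And>a b c d. (a, b, c, d) \<in> ?c g ` C 1 \<Longrightarrow> c = 0"
    have "?c g ` C 1 \<subseteq> borel F"
    proof
      fix h assume h: "h \<in> ?c g ` C 1"
      obtain p q r s where e: "h = (p, q, r, s)" by (rule quad_cases)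
      have "r = 0" using upper h unfolding e by blast
      moreover have "h \<in> sl2 F" using conj[OF g] h by blast
      ultimately show "h \<in> borel F" by (simp add: borel_def e)
    qed
    moreover have "borel F \<subset> sl2 F"
    proof -
      have "(0, 1, 1, 0) \<in> sl2 F - borel F" using F' by (simp add: borel_def)
      moreover have "borel F \<subseteq> sl2 F" by (auto simp: borel_def)
      ultimately show ?thesis by blast
    qed
    ultimately have "borel F = ?c g ` C 1" using conj[OF g] subgroup_borel[OF F] by blast
    then have "unrefinable_chain (SL\<lparr>carrier := borel F\<rparr>) t' (\<lambda>i. ?c g ` C (Suc i))" using conj[OF g] by metis
    from borel_chain_length[OF F this] have "num_prime_factors (card F - 1) \<le> t'" .
    then show "Suc b \<le> t" using num_prime_factors_pow3_minus_1[of "Suc b"] Suc.prems(3) t by simp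
  next
    fix g x assume g: "g \<in> sl2 F" and x: "x \<in> sl2 F" "tr x \<noteq> 0"
      and norm: "\<And>h. h \<in> ?c g ` C 1 \<Longrightarrow> h \<star> x = x \<star> h \<or> h \<star> x = inv\<^sub>S x \<star> h"
    have "?c g ` C 1 \<subseteq> torus_normalizer F x"
      using norm conj[OF g] unfolding torus_normalizer_def by blast
    moreover have "torus_normalizer F x \<subset> sl2 F"
    proof -
      have "\<not> F \<subseteq> {0, 1}"
      proof
        assume "F \<subseteq> {0, 1}"
        then have "card F \<le> card {0 :: 'a, 1}" by (intro card_mono) auto
        moreover have "(2::nat) \<le> 3 ^ Suc b"
        proof -
          have "(3::nat) \<le> 3 ^ Suc b" by (rule self_le_power) simp_all
          then show ?thesis by linarith
        qed
        then have "(2::nat) ^ 2 \<le> 2 ^ (3 ^ Suc b)" by (intro power_increasing) auto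
        ultimately show False using Suc.prems(3) by simp
      qed
      then obtain l where "l \<in> F" "l \<noteq> 0" "l \<noteq> 1" by blast
      then have "torus_normalizer F x \<noteq> sl2 F" using torus_normalizer_neq_sl2[OF F(1)] x by blast
      then show ?thesis by (auto simp: torus_normalizer_def)
    qed
    ultimately have "torus_normalizer F x = ?c g ` C 1"
      using conj[OF g] subgroup_torus_normalizer[OF F x(1)] by blast
    then have "unrefinable_chain (SL\<lparr>carrier := torus_normalizer F x\<rparr>) t' (\<lambda>i. ?c g ` C (Suc i))" using conj[OF g] by metis
    from torus_chain_length[OF F x this] card_centralizer[OF F x]
    have "num_prime_factors (card F - 1) \<le> t' \<or> num_prime_factors (card F + 1) \<le> t'" by auto
    then show "Suc b \<le> t"
      using num_prime_factors_pow3_minus_1[of "Suc b"] num_prime_factors_pow3_plus_1[of "Suc b"] Suc.prems(3) t by auto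
  next
    fix g K assume g: "g \<in> sl2 F" and K: "is_subfield K" and eq: "?c g ` C 1 = sl2 K"
    note K' = is_subfieldD[OF K]
    have sl2_mono_iff: "sl2 A \<subseteq> sl2 B \<longleftrightarrow> A \<subseteq> B" if "is_subfield A" for A B :: "'a set"
    proof
      assume *: "sl2 A \<subseteq> sl2 B"
      show "A \<subseteq> B"
      proof
        fix a assume "a \<in> A"
        then have "(1, a, 0, 1) \<in> sl2 A" using is_subfieldD[OF that] by simp
        then have "(1, a, 0, 1) \<in> sl2 B" using * by blast
        then show "a \<in> B" by simp
      qed
    qed (auto simp: sl2_def)
    have "sl2 K \<subset> sl2 F" using conj[OF g] unfolding eq by (elim conjE)
    then have KF: "K \<subset> F" using sl2_mono_iff[OF K, of F] sl2_mono_iff[OF F(1), of K] by (simp add: less_le_not_le)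
    obtain d where d: "card K = 2 ^ d" "d dvd 3 ^ Suc b"
      using card_subfield[OF F Suc.prems(3) K psubset_imp_subset[OF KF]] by blast
    obtain c where c: "d = 3 ^ c" "c \<le> Suc b"
      using divides_primepow_nat[of 3 d "Suc b"] d(2) by (auto simp del: power_Suc)
    have "card K < card F" using KF F(2) by (intro psubset_card_mono)
    then have "c \<noteq> Suc b" using d c Suc.prems(3) by auto
    then have cb: "c \<le> b" using c by simp
    define E where "E = {x \<in> F. x ^ (2 ^ (3 ^ b)) = x}"
    have E: "is_subfield E" unfolding E_def by (rule subfield_fixed_points[OF F(1)])
    have cardE: "card E = 2 ^ (3 ^ b)"
      unfolding E_def using card_fixed_points[OF F, of "3 ^ b" 3] Suc.prems(3) by (simp add: mult.commute)
    have "E \<noteq> F" using cardE Suc.prems(3) by auto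
    then have EF: "E \<subset> F" by (auto simp: E_def)
    have "K \<subseteq> E"
    proof
      fix x assume x: "x \<in> K"
      have fix_pow: "x ^ (2 ^ d) = x"
        using subfield_pow_card[OF K finite_subset[OF _ F(2)] x] KF d by auto
      have "x ^ (2 ^ (d * j)) = x" for j
      proof (induction j)
        case (Suc j)
        have "x ^ (2 ^ (d * Suc j)) = (x ^ (2 ^ d)) ^ (2 ^ (d * j))" by (simp add: power_mult[symmetric] power_add)
        then show ?case using Suc fix_pow by simp
      qed simp
      from this[of "3 ^ (b - c)"] have "x ^ (2 ^ (3 ^ b)) = x" using cb c by (simp flip: power_add)
      then show "x \<in> E" using x KF by (auto simp: E_def)
    qed
    then have "sl2 K \<subseteq> sl2 E" using sl2_mono_iff[OF K] by blast
    moreover have "sl2 E \<subset> sl2 F"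
      using sl2_mono_iff[OF E, of F] sl2_mono_iff[OF F(1), of E] EF by (simp add: less_le_not_le)
    ultimately have "sl2 E = ?c g ` C 1" using conj[OF g] subgroup_sl2[OF E] unfolding eq by blast
    then have "unrefinable_chain (SL\<lparr>carrier := sl2 E\<rparr>) t' (\<lambda>i. ?c g ` C (Suc i))" using conj[OF g] by metis
    then have "b \<le> t'" using Suc.IH[OF E _ cardE] finite_subset[OF _ F(2)] EF by blast
    then show "Suc b \<le> t" using t by simp
  qed
qed

section \<open>Finite fields of characteristic two\<close>

text \<open>
  All finite fields of characteristic two are realised as subfields of one type, the algebraic closure of the
  field with two elements.
\<close>

instance bit :: char_two_field
  by standard simp

instance alg_closure :: (char_two_field) char_two_field
proof
  have "to_ac ((1::'a) + 1) = 0" by (simp only: char_two to_ac_0)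
  then show "(1::'a alg_closure) + 1 = 0" by (simp only: to_ac_add to_ac_1)
qed

text \<open>
  The polynomial \<open>X ^ 2 ^ k - X\<close> has constant derivative 1 (up to sign), so its roots in an algebraically closed field are simple.
\<close>

lemma card_fixed_points_alg_closed:
  assumes "k > 0"
  shows "finite {x :: 'a::{char_two_field,alg_closed_field}. x ^ (2 ^ k) = x}"
    and "card {x :: 'a. x ^ (2 ^ k) = x} = 2 ^ k"
proof -
  define p :: "'a poly" where "p = monom 1 (2 ^ k) + monom 1 1"
  have poly_p: "poly p x = x ^ (2 ^ k) + x" for x by (simp add: p_def poly_monom)
  have k2: "(2::nat) ^ k > 1" using one_less_power[of "2::nat" k] assms by simp
  have degp: "Polynomial.degree p = 2 ^ k"
    unfolding p_def using k2 by (subst degree_add_eq_left) (simp_all add: degree_monom_eq)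
  then have p0: "p \<noteq> 0" by auto
  have two: "(2::'a) = 0" using char_two one_add_one by metis
  have dp: "pderiv p = 1" unfolding p_def by (simp add: pderiv_add pderiv_monom two assms monom_0 flip: one_pCons)
  obtain A where A: "size A = Polynomial.degree p" "p = smult (lead_coeff p) (\<Prod>x\<in>#A. [:- x, 1:])"
    using alg_closed_imp_factorization[OF p0] by blast
  have lc: "lead_coeff p \<noteq> 0" using p0 by simp
  have root_iff: "poly p x = 0 \<longleftrightarrow> x \<in># A" for x
  proof -
    have "poly p x = lead_coeff p * (\<Prod>y\<in>#A. poly [:- y, 1:] x)"
      by (subst A(2)) (simp only: poly_smult poly_prod_mset image_mset.compositionality o_def)
    then show ?thesis using lc by (auto simp: add_eq_zero_iff)
  qed
  have count: "count A x = 1" if x: "x \<in># A" for x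
  proof (rule ccontr)
    assume "count A x \<noteq> 1"
    then obtain B where B: "A = add_mset x (add_mset x B)"
      using x by (metis count_add_mset count_eq_zero_iff insert_DiffM multi_member_split One_nat_def)
    define s where "s = smult (lead_coeff p) (\<Prod>y\<in>#B. [:- y, 1:])"
    have "p = [:- x, 1:] * ([:- x, 1:] * s)" by (subst A(2)) (simp add: B s_def)
    then have "poly (pderiv p) x = poly (pderiv ([:- x, 1:] * ([:- x, 1:] * s))) x" by (rule arg_cong)
    also have "\<dots> = 0" by (simp only: pderiv_mult poly_add poly_mult) simp
    finally have "poly (pderiv p) x = 0" .
    then show False by (simp add: dp)
  qed
  have set_eq: "{x. x ^ (2 ^ k) = x} = set_mset A"
    using root_iff poly_p add_eq_zero_iff by auto
  then show "finite {x :: 'a. x ^ (2 ^ k) = x}" by simp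
  have "size A = (\<Sum>x\<in>set_mset A. count A x)" by (rule size_multiset_overloaded_eq)
  also have "\<dots> = card (set_mset A)" using count by simp
  finally show "card {x :: 'a. x ^ (2 ^ k) = x} = 2 ^ k" using A(1) degp set_eq by simp
qed

lemma exists_nat_field:
  assumes "k > 0"
  shows "\<exists>F :: nat ring. field F \<and> card (carrier F) = 2 ^ k"
proof -
  define K :: "bit alg_closure set" where "K = {x. x ^ (2 ^ k) = x}"
  have finK: "finite K" and cardK: "card K = 2 ^ k"
    unfolding K_def by (rule card_fixed_points_alg_closed[OF assms])+
  have "is_subfield (UNIV :: bit alg_closure set)" by (simp add: is_subfield_def)
  from subfield_fixed_points[OF this, of k] have K: "is_subfield K" by (simp add: K_def)
  note K' = is_subfieldD[OF K]
  have "cring (field_on K)"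
    by (rule cringI; (rule abelian_groupI comm_monoidI)?)
      (use K' in \<open>auto simp: field_on_def ring_of_type_algebra_def algebra_simps intro!: bexI[of _ _]\<close>)
  then have fK: "field (field_on K)"
  proof (rule cring.cring_fieldI2)
    show "\<zero>\<^bsub>field_on K\<^esub> \<noteq> \<one>\<^bsub>field_on K\<^esub>" by (simp add: field_on_def ring_of_type_algebra_def)
    fix a assume "a \<in> carrier (field_on K)" "a \<noteq> \<zero>\<^bsub>field_on K\<^esub>"
    then show "\<exists>b\<in>carrier (field_on K). a \<otimes>\<^bsub>field_on K\<^esub> b = \<one>\<^bsub>field_on K\<^esub>"
      using K' by (intro bexI[of _ "inverse a"]) (auto simp: field_on_def ring_of_type_algebra_def)
  qed
  obtain f :: "bit alg_closure \<Rightarrow> nat" where f: "inj_on f K"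
    using finite_imp_inj_to_nat_seg[OF finK] by metis
  let ?g = "the_inv_into K f"
  have g: "?g (f x) = x" if "x \<in> K" for x using the_inv_into_f_f[OF f that] .
  define N :: "nat ring" where "N = \<lparr>carrier = f ` K, monoid.mult = (\<lambda>x y. f (?g x * ?g y)),
      one = f 1, ring.zero = f 0, add = (\<lambda>x y. f (?g x + ?g y))\<rparr>"
  have "f \<in> ring_iso (field_on K) N"
    unfolding ring_iso_def ring_hom_def using f g K'
    by (auto simp: N_def field_on_def ring_of_type_algebra_def bij_betw_def)
  from field.ring_iso_imp_img_field[OF fK this] have "field N"
    by (simp add: N_def field_on_def ring_of_type_algebra_def)
  moreover have "card (carrier N) = 2 ^ k" using cardK f by (simp add: N_def card_image)
  ultimately show ?thesis by blast
qed

text \<open>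
  To embed an arbitrary finite field \<open>R\<close> of characteristic two, polynomials over the prime field are evaluated both at a generator of
  the multiplicative group of \<open>R\<close> and at a suitable point of the algebraically closed field.
\<close>

locale field_char_two = field R for R (structure) +
  assumes two_zero: "\<one> \<oplus> \<one> = \<zero>"
begin

definition embed_bit :: "bit \<Rightarrow> 'a" where "embed_bit c = (if c = 0 then \<zero> else \<one>)"

definition ev :: "'a \<Rightarrow> bit poly \<Rightarrow> 'a" where
  "ev g p = fold_coeffs (\<lambda>c r. embed_bit c \<oplus> g \<otimes> r) p \<zero>"

lemma add_self_R: "x \<in> carrier R \<Longrightarrow> x \<oplus> x = \<zero>"
proof -
  assume x: "x \<in> carrier R"
  then have "x \<oplus> x = (\<one> \<oplus> \<one>) \<otimes> x" by (simp add: l_distr)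
  then show ?thesis using x two_zero by simp
qed

lemma embed_bit_closed [simp]: "embed_bit c \<in> carrier R" by (simp add: embed_bit_def)

lemma embed_bit_add: "embed_bit (c + d) = embed_bit c \<oplus> embed_bit d"
  by (cases c; cases d) (simp_all add: embed_bit_def two_zero)

lemma ev_0 [simp]: "ev g 0 = \<zero>" by (simp add: ev_def)

lemma ev_closed [simp]: "g \<in> carrier R \<Longrightarrow> ev g p \<in> carrier R"
proof (induction p)
  case (pCons a p)
  then show ?case by (cases "p = 0 \<and> a = 0") (auto simp: ev_def)
qed simp

lemma ev_pCons: "g \<in> carrier R \<Longrightarrow> ev g (pCons c p) = embed_bit c \<oplus> g \<otimes> ev g p"
proof (cases "p = 0 \<and> c = 0")
  case True
  assume "g \<in> carrier R"
  then show ?thesis using True by (simp add: embed_bit_def)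
next
  case False
  assume g: "g \<in> carrier R"
  then have "ev g p \<in> carrier R" by simp
  then show ?thesis using False g by (auto simp: ev_def)
qed

lemma ev_add: "g \<in> carrier R \<Longrightarrow> ev g (p + q) = ev g p \<oplus> ev g q"
proof (induction p q rule: poly_induct2)
  case (pCons a p b q)
  have "ev g (pCons (a + b) (p + q)) = embed_bit (a + b) \<oplus> g \<otimes> ev g (p + q)"
    by (rule ev_pCons[OF pCons(2)])
  also have "\<dots> = embed_bit a \<oplus> embed_bit b \<oplus> (g \<otimes> ev g p \<oplus> g \<otimes> ev g q)"
    unfolding embed_bit_add using pCons by (simp add: r_distr)
  finally show ?case using pCons(2) by (simp add: ev_pCons a_ac)
qed simp

lemma ev_smult: "g \<in> carrier R \<Longrightarrow> ev g (smult c p) = embed_bit c \<otimes> ev g p"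
  by (cases c) (simp_all add: embed_bit_def)

lemma ev_mult: "g \<in> carrier R \<Longrightarrow> ev g (p * q) = ev g p \<otimes> ev g q"
proof (induction p)
  case (pCons a p)
  then show ?case
    by (simp add: ev_add ev_smult ev_pCons l_distr m_assoc) (simp add: embed_bit_def)
qed simp

lemma ev_monom: "g \<in> carrier R \<Longrightarrow> ev g (Polynomial.monom 1 n) = g [^] n"
  by (induction n) (simp_all add: monom_0 monom_Suc ev_pCons embed_bit_def m_comm)

lemma ev_1: "g \<in> carrier R \<Longrightarrow> ev g 1 = \<one>"
  using ev_monom[of g 0] by (simp add: monom_0 one_pCons)

end

lemma field_char_two_type: "field_char_two (ring_of_type_algebra :: 'a::char_two_field ring)"
  using field_from_type_algebra
  unfolding field_char_two_def field_char_two_axioms_def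
  by (simp add: ring_of_type_algebra_def one_add_one)

lemma ev_root_exists:
  assumes "Polynomial.degree m > 0"
  shows "\<exists>a::'a::{char_two_field,alg_closed_field}. field_char_two.ev ring_of_type_algebra a m = 0"
proof -
  interpret L: field_char_two "ring_of_type_algebra :: 'a ring" by (rule field_char_two_type)
  define h :: "bit \<Rightarrow> 'a" where "h c = (if c = 0 then 0 else 1)" for c
  have h0: "h 0 = 0" by (simp add: h_def)
  have h_eq: "h c = L.embed_bit c" for c
    by (simp add: h_def L.embed_bit_def) (simp add: ring_of_type_algebra_def)
  have "L.ev a p = poly (map_poly h p) a" for a p
  proof (induction p)
    case 0
    show ?case by simp (simp add: ring_of_type_algebra_def)
  next
    case (pCons c p)
    have "L.ev a (pCons c p) = h c + a * L.ev a p"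
      using L.ev_pCons[of a c p] unfolding h_eq by (simp add: ring_of_type_algebra_def)
    then show ?case using pCons by (simp add: map_poly_pCons h0)
  qed
  moreover have "Polynomial.degree (map_poly h m) > 0"
    using assms by (subst degree_map_poly) (auto simp: h_def)
  ultimately show ?thesis using alg_closed_imp_poly_has_root[of "map_poly h m"] by auto
qed

text \<open>
  Let \<open>g\<close> generate the multiplicative group of \<open>R\<close>, let \<open>m\<close> be a nonzero polynomial of least degree that vanishes at
  \<open>g\<close>, and let \<open>a\<close> be a root of \<open>m\<close> in the algebraically closed field. Every polynomial vanishing at \<open>g\<close> is a multiple of
  \<open>m\<close> and so vanishes at \<open>a\<close>; hence \<open>f (p g) = p a\<close> is a well-defined homomorphism on \<open>R\<close>.
\<close>

lemma finite_field_embeds: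
  fixes R (structure)
  assumes R: "field_char_two R" and fin: "finite (carrier R)"
  shows "\<exists>f. f \<in> ring_hom R (ring_of_type_algebra :: 'a::{char_two_field,alg_closed_field} ring) \<and> inj_on f (carrier R)"
proof -
  interpret field_char_two R by (rule R)
  interpret L: field_char_two "ring_of_type_algebra :: 'a ring" by (rule field_char_two_type)
  obtain g where g: "g \<in> carrier R" "carrier (mult_of R) = {g [^] i | i::nat. i \<in> UNIV}"
    using finite_field_mult_group_has_gen[OF fin] by auto
  have surj: "\<exists>p. ev g p = x" if "x \<in> carrier R" for x
  proof (cases "x = \<zero>")
    case False
    then have "x \<in> carrier (mult_of R)" using that by simp
    then obtain i :: nat where "x = g [^] i" unfolding g(2) by blast
    then show ?thesis using ev_monom[OF g(1)] by metis
  qed (use ev_0 in blast)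
  define Z where "Z m \<longleftrightarrow> m \<noteq> 0 \<and> ev g m = \<zero>" for m
  have "\<exists>m. Z m"
  proof -
    have "\<not> inj_on (\<lambda>i::nat. g [^] i) UNIV"
    proof
      assume "inj_on (\<lambda>i::nat. g [^] i) UNIV"
      moreover have "range (\<lambda>i::nat. g [^] i) \<subseteq> carrier R" using g(1) by auto
      ultimately show False using fin finite_subset finite_imageD infinite_UNIV_nat by blast
    qed
    then obtain i j :: nat where ij: "i \<noteq> j" "g [^] i = g [^] j" by (auto simp: inj_on_def)
    have "ev g (Polynomial.monom 1 i + Polynomial.monom 1 j) = \<zero>"
      using ij g(1) by (simp add: ev_add ev_monom add_self_R)
    moreover have "Polynomial.coeff (Polynomial.monom 1 i + Polynomial.monom 1 j) i = (1::bit)" using ij by simp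
    then have "Polynomial.monom 1 i + Polynomial.monom 1 j \<noteq> (0 :: bit poly)" by (metis Polynomial.coeff_0 zero_neq_one)
    ultimately show ?thesis unfolding Z_def by blast
  qed
  then obtain m where m: "Z m" and min: "\<And>p. Z p \<Longrightarrow> Polynomial.degree m \<le> Polynomial.degree p"
    using ex_has_least_nat[of Z _ degree] by blast
  have degm: "Polynomial.degree m > 0"
  proof (rule ccontr)
    assume "\<not> Polynomial.degree m > 0"
    then obtain c where "m = [:c:]" by (auto elim: degree_eq_zeroE)
    moreover from this have "c = 1" using m by (auto simp: Z_def)
    ultimately have "m = 1" by (simp add: one_pCons)
    then show False using m ev_1[OF g(1)] by (simp add: Z_def)
  qed
  have dvd: "m dvd p" if "ev g p = \<zero>" for p
  proof -
    have "ev g p = ev g m \<otimes> ev g (p div m) \<oplus> ev g (p mod m)"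
      using g(1) by (metis ev_add ev_mult mult_div_mod_eq)
    then have "\<zero> = \<zero> \<otimes> ev g (p div m) \<oplus> ev g (p mod m)" using that m by (simp only: Z_def)
    then have ev0: "ev g (p mod m) = \<zero>" using g(1) by simp
    have "p mod m = 0"
    proof (rule ccontr)
      assume "p mod m \<noteq> 0"
      then have "Polynomial.degree m \<le> Polynomial.degree (p mod m)" using min ev0 by (simp add: Z_def)
      then show False using degree_mod_less[of m p] m \<open>p mod m \<noteq> 0\<close> by (simp add: Z_def)
    qed
    then show ?thesis by auto
  qed
  obtain a :: 'a where a: "L.ev a m = 0" using ev_root_exists[OF degm] by blast
  have ac: "a \<in> carrier ring_of_type_algebra" by (simp add: ring_of_type_algebra_def)
  have L_add: "L.ev a (p + q) = L.ev a p + L.ev a q" and L_mult: "L.ev a (p * q) = L.ev a p * L.ev a q" for p q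
    using L.ev_add[OF ac] L.ev_mult[OF ac] by (simp_all add: ring_of_type_algebra_def)
  have L_1: "L.ev a 1 = 1" using L.ev_1[OF ac] by (simp add: ring_of_type_algebra_def)
  have ker: "L.ev a p = 0" if "ev g p = \<zero>" for p
    using dvd[OF that] a L_mult by (auto elim!: dvdE)
  define f where "f x = L.ev a (SOME p. ev g p = x)" for x
  have f_ev: "f (ev g p) = L.ev a p" for p
  proof -
    define s where "s = (SOME s. ev g s = ev g p)"
    have "ev g s = ev g p" unfolding s_def by (rule someI[of _ p]) simp
    then have "ev g (s + p) = \<zero>" using g(1) by (simp add: ev_add add_self_R)
    then have "L.ev a s + L.ev a p = 0" using ker L_add by metis
    then show ?thesis by (simp add: f_def s_def add_eq_zero_iff)
  qed
  have f_add: "f (x \<oplus> y) = f x + f y" and f_mult: "f (x \<otimes> y) = f x * f y"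
    if "x \<in> carrier R" "y \<in> carrier R" for x y
  proof -
    obtain p q where "ev g p = x" "ev g q = y" using surj \<open>x \<in> carrier R\<close> \<open>y \<in> carrier R\<close> by meson
    then show "f (x \<oplus> y) = f x + f y" "f (x \<otimes> y) = f x * f y"
      using f_ev ev_add[OF g(1)] ev_mult[OF g(1)] L_add L_mult by metis+
  qed
  have f_1: "f \<one> = 1" using f_ev[of 1] ev_1[OF g(1)] L_1 by simp
  have "f \<in> ring_hom R (ring_of_type_algebra :: 'a ring)"
    unfolding ring_hom_def using f_add f_mult f_1 by (simp add: ring_of_type_algebra_def)
  moreover have "inj_on f (carrier R)"
  proof (rule inj_onI)
    fix x y assume xy: "x \<in> carrier R" "y \<in> carrier R" "f x = f y"
    show "x = y"
    proof (rule ccontr)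
      assume "x \<noteq> y"
      define z where "z = x \<oplus> y"
      have zc: "z \<in> carrier R" using xy by (simp add: z_def)
      have "z \<noteq> \<zero>"
      proof
        assume "z = \<zero>"
        then have "x \<oplus> y = y \<oplus> y" using add_self_R xy by (simp add: z_def)
        then show False using \<open>x \<noteq> y\<close> xy by simp
      qed
      then have "z \<otimes> inv z = \<one>" "inv z \<in> carrier R" using zc field_Units by auto
      then have "f z * f (inv z) = 1" using f_mult[OF zc] f_1 by metis
      moreover have "f z = 0" using f_add xy by (simp add: z_def)
      ultimately show False by simp
    qed
  qed
  ultimately show ?thesis by blast
qed

section \<open>From SL2 to L2\<close>

lemma group_center_sl2:
  fixes K :: "'a::char_two_field set"
  assumes K: "is_subfield K"
  shows "group_center (SL\<lparr>carrier := sl2 K\<rparr>) = {\<one>\<^sub>S}"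
proof -
  note K' = is_subfieldD[OF K]
  have central: "z = \<one>\<^sub>S" if z: "z \<in> sl2 K" and c: "\<And>g. g \<in> sl2 K \<Longrightarrow> z \<star> g = g \<star> z" for z
  proof -
    obtain a b c d where e: "z = (a, b, c, d)" by (rule quad_cases)
    have "(1, 1, 0, 1) \<in> sl2 K" "(0, 1, 1, 0) \<in> sl2 K" using K' by auto
    from c[OF this(1)] c[OF this(2)] have "c = 0" "a = d" "b = c"
      unfolding e commute_unipotent_iff by simp_all
    then show ?thesis using z by (simp add: e)
  qed
  have one: "\<one>\<^sub>S \<in> sl2 K" using K' by simp
  have one_central: "\<one>\<^sub>S \<star> g = g \<star> \<one>\<^sub>S" if "g \<in> sl2 K" for g
    using subsetD[OF sl2_subset that] by (simp del: SL_one)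
  show ?thesis
  proof (intro equalityI subsetI)
    fix z assume "z \<in> group_center (SL\<lparr>carrier := sl2 K\<rparr>)"
    then have "z \<in> sl2 K" "\<forall>g\<in>sl2 K. z \<star> g = g \<star> z"
      unfolding group_center_def by simp_all
    then show "z \<in> {\<one>\<^sub>S}" using central by blast
  next
    fix z :: "'a \<times> 'a \<times> 'a \<times> 'a" assume "z \<in> {\<one>\<^sub>S}"
    then have z: "z = \<one>\<^sub>S" by blast
    show "z \<in> group_center (SL\<lparr>carrier := sl2 K\<rparr>)"
      unfolding group_center_def z using one one_central by (simp del: SL_one)
  qed
qed

lemma group_center_iso:
  assumes G: "group G" and f: "f \<in> iso G G'"
  shows "f ` group_center G = group_center G'"
proof -
  interpret group G by fact
  have bij: "inj_on f (carrier G)" "f ` carrier G = carrier G'" using f by (auto simp: iso_def bij_betw_def)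
  have hom: "f (x \<otimes>\<^bsub>G\<^esub> y) = f x \<otimes>\<^bsub>G'\<^esub> f y" if "x \<in> carrier G" "y \<in> carrier G" for x y
    using f that by (simp add: iso_def hom_def)
  have "z \<in> group_center G \<longleftrightarrow> f z \<in> group_center G'" if z: "z \<in> carrier G" for z
  proof -
    have "(\<forall>g\<in>carrier G. z \<otimes>\<^bsub>G\<^esub> g = g \<otimes>\<^bsub>G\<^esub> z) \<longleftrightarrow> (\<forall>g\<in>carrier G. f (z \<otimes>\<^bsub>G\<^esub> g) = f (g \<otimes>\<^bsub>G\<^esub> z))"
      using inj_on_eq_iff[OF bij(1)] z by (metis m_closed)
    also have "\<dots> \<longleftrightarrow> (\<forall>g\<in>carrier G. f z \<otimes>\<^bsub>G'\<^esub> f g = f g \<otimes>\<^bsub>G'\<^esub> f z)"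
      using hom z by simp
    also have "\<dots> \<longleftrightarrow> (\<forall>g\<in>carrier G'. f z \<otimes>\<^bsub>G'\<^esub> g = g \<otimes>\<^bsub>G'\<^esub> f z)"
      unfolding bij(2)[symmetric] by simp
    finally show ?thesis using z bij(2) by (auto simp: group_center_def)
  qed
  moreover have "group_center G \<subseteq> carrier G" "group_center G' \<subseteq> f ` carrier G"
    unfolding bij(2) by (auto simp: group_center_def)
  ultimately show ?thesis by blast
qed

lemma (in group) iso_Mod_one:
  "(\<lambda>x. {x}) \<in> iso G (G Mod {\<one>})"
proof (rule isoI)
  have rc: "{\<one>} #> x = {x}" if "x \<in> carrier G" for x using that by (simp add: r_coset_def)
  have car: "carrier (G Mod {\<one>}) = (\<lambda>x. {x}) ` carrier G"
    by (auto simp: FactGroup_def RCOSETS_def rc)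
  show "(\<lambda>x. {x}) \<in> hom G (G Mod {\<one>})"
    unfolding hom_def car by (auto simp: set_mult_def)
  show "bij_betw (\<lambda>x. {x}) (carrier G) (carrier (G Mod {\<one>}))"
    unfolding car by (simp add: bij_betw_def)
qed

text \<open>
  The order of the additive group annihilates 1, so \<open>(1 + 1) ^ k = 0\<close>.
\<close>

lemma field_char_two_if_card:
  assumes R: "field R" and card: "card (carrier R) = 2 ^ k"
  shows "field_char_two R"
proof -
  interpret field R by fact
  let ?s = "\<one>\<^bsub>R\<^esub> \<oplus>\<^bsub>R\<^esub> \<one>\<^bsub>R\<^esub>"
  have pow: "add_pow R ((2::nat) ^ j) \<one>\<^bsub>R\<^esub> = ?s [^]\<^bsub>R\<^esub> j" for j
  proof (induction j)
    case (Suc j)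
    have "add_pow R ((2::nat) ^ Suc j) \<one>\<^bsub>R\<^esub> = add_pow R ((2::nat) ^ j) \<one>\<^bsub>R\<^esub> \<oplus>\<^bsub>R\<^esub> add_pow R ((2::nat) ^ j) \<one>\<^bsub>R\<^esub>"
      using add.nat_pow_mult[of "\<one>\<^bsub>R\<^esub>" "2 ^ j" "2 ^ j"] by (simp add: mult_2)
    also have "\<dots> = ?s [^]\<^bsub>R\<^esub> j \<otimes>\<^bsub>R\<^esub> ?s"
      unfolding Suc by (simp add: r_distr)
    finally show ?case by simp
  qed simp
  have "add_pow R (card (carrier R)) \<one>\<^bsub>R\<^esub> = \<zero>\<^bsub>R\<^esub>"
    using group.pow_order_eq_1[OF a_group, of "\<one>\<^bsub>R\<^esub>"] by (simp add: Coset.order_def add_pow_def)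
  then have s0: "?s [^]\<^bsub>R\<^esub> k = \<zero>\<^bsub>R\<^esub>" unfolding card pow .
  have pow_nz: "x [^]\<^bsub>R\<^esub> j \<noteq> \<zero>\<^bsub>R\<^esub>" if "x \<in> carrier R" "x \<noteq> \<zero>\<^bsub>R\<^esub>" for x and j :: nat
    using that by (induction j) (auto simp: integral_iff)
  have "?s = \<zero>\<^bsub>R\<^esub>"
  proof (rule ccontr)
    assume "?s \<noteq> \<zero>\<^bsub>R\<^esub>"
    then show False using pow_nz[of ?s k] s0 by simp
  qed
  then show ?thesis using R by (simp add: field_char_two_def field_char_two_axioms_def)
qed

lemma (in field_char_two) SL2_iso_sl2:
  assumes f: "f \<in> ring_hom R (ring_of_type_algebra :: 'c::char_two_field ring)" "inj_on f (carrier R)"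
  shows "is_subfield (f ` carrier R)"
    and "(\<lambda>(a, b, c, d). (f a, f b, f c, f d)) \<in> iso (SL2 R) (SL\<lparr>carrier := sl2 (f ` carrier R)\<rparr>)"
proof -
  have f_add: "f (x \<oplus> y) = f x + f y" and f_mult: "f (x \<otimes> y) = f x * f y"
    if "x \<in> carrier R" "y \<in> carrier R" for x y
    using f(1) that by (auto simp: ring_hom_def ring_of_type_algebra_def)
  have f_1: "f \<one> = 1" using f(1) by (auto simp: ring_hom_def ring_of_type_algebra_def)
  have f_0: "f \<zero> = 0" using f_add[of \<zero> \<zero>] by simp
  have f_inv: "inverse (f x) = f (inv x)" "inv x \<in> carrier R" if "x \<in> carrier R" "x \<noteq> \<zero>" for x
  proof -
    have x: "x \<otimes> inv x = \<one>" "inv x \<in> carrier R" using that field_Units by auto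
    then have "f x * f (inv x) = 1" using f_mult[OF that(1)] f_1 by metis
    then show "inverse (f x) = f (inv x)" "inv x \<in> carrier R" using inverse_unique x(2) by auto
  qed
  let ?K = "f ` carrier R"
  show "is_subfield ?K" unfolding is_subfield_def
  proof (intro conjI ballI)
    show "0 \<in> ?K" using f_0 by (metis image_eqI zero_closed)
    show "1 \<in> ?K" using f_1 by (metis image_eqI one_closed)
    fix u v assume "u \<in> ?K" "v \<in> ?K"
    then obtain x y where xy: "x \<in> carrier R" "y \<in> carrier R" "u = f x" "v = f y" by auto
    show "u + v \<in> ?K" using f_add[OF xy(1,2)] xy by (metis image_eqI a_closed)
    show "u * v \<in> ?K" using f_mult[OF xy(1,2)] xy by (metis image_eqI m_closed)
    show "inverse u \<in> ?K"
    proof (cases "x = \<zero>")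
      case True
      then show ?thesis using xy f_0 by auto
    next
      case False
      then show ?thesis using f_inv[OF xy(1)] xy by auto
    qed
  qed
  have minus: "\<ominus> x = x" if "x \<in> carrier R" for x
    using add_self_R[OF that] that by (simp add: add.inv_equality)
  have mem: "(a, b, c, d) \<in> carrier (SL2 R) \<longleftrightarrow> a \<in> carrier R \<and> b \<in> carrier R \<and> c \<in> carrier R \<and> d \<in> carrier R
      \<and> f a * f d + f b * f c = 1" for a b c d
  proof -
    have "a \<otimes> d \<ominus> b \<otimes> c = \<one> \<longleftrightarrow> f a * f d + f b * f c = 1"
      if cl: "a \<in> carrier R" "b \<in> carrier R" "c \<in> carrier R" "d \<in> carrier R"
    proof -
      have "f (a \<otimes> d \<ominus> b \<otimes> c) = f a * f d + f b * f c"
        using cl by (simp add: a_minus_def minus f_add f_mult)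
      then show ?thesis using inj_on_eq_iff[OF f(2), of "a \<otimes> d \<ominus> b \<otimes> c" \<one>] cl f_1 by simp
    qed
    then show ?thesis by (auto simp: SL2_def)
  qed
  let ?F = "\<lambda>(a, b, c, d). (f a, f b, f c, f d)"
  show "?F \<in> iso (SL2 R) (SL\<lparr>carrier := sl2 ?K\<rparr>)"
  proof (rule isoI)
    show "?F \<in> hom (SL2 R) (SL\<lparr>carrier := sl2 ?K\<rparr>)"
    proof (rule homI)
      fix x assume "x \<in> carrier (SL2 R)"
      then show "?F x \<in> carrier (SL\<lparr>carrier := sl2 ?K\<rparr>)" by (cases x) (auto simp: mem)
    next
      fix x y assume xy: "x \<in> carrier (SL2 R)" "y \<in> carrier (SL2 R)"
      obtain a b c d a' b' c' d' where e: "x = (a, b, c, d)" "y = (a', b', c', d')" by (metis prod_cases4)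
      show "?F (x \<otimes>\<^bsub>SL2 R\<^esub> y) = ?F x \<otimes>\<^bsub>SL\<lparr>carrier := sl2 ?K\<rparr>\<^esub> ?F y"
        using xy unfolding e mem by (simp add: SL2_def f_add f_mult)
    qed
    show "bij_betw ?F (carrier (SL2 R)) (carrier (SL\<lparr>carrier := sl2 ?K\<rparr>))"
      unfolding bij_betw_def
    proof
      show "inj_on ?F (carrier (SL2 R))"
        using f(2) by (auto simp: inj_on_def mem)
      show "?F ` carrier (SL2 R) = carrier (SL\<lparr>carrier := sl2 ?K\<rparr>)"
      proof (intro equalityI subsetI)
        fix y assume "y \<in> ?F ` carrier (SL2 R)"
        then show "y \<in> carrier (SL\<lparr>carrier := sl2 ?K\<rparr>)" by (auto simp: mem)
      next
        fix y assume "y \<in> carrier (SL\<lparr>carrier := sl2 ?K\<rparr>)"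
        moreover obtain p q r s where e: "y = (p, q, r, s)" by (rule quad_cases)
        ultimately obtain a b c d where "(a, b, c, d) \<in> carrier (SL2 R)" "y = (f a, f b, f c, f d)"
          by (auto simp: mem)
        then show "y \<in> ?F ` carrier (SL2 R)" by (intro image_eqI[of _ _ "(a, b, c, d)"]) auto
      qed
    qed
  qed
qed

lemma GF_power_two:
  assumes "k > 0"
  shows "field (GF (2 ^ k))" "card (carrier (GF (2 ^ k))) = 2 ^ k" "finite (carrier (GF (2 ^ k)))"
proof -
  have "field (GF (2 ^ k)) \<and> card (carrier (GF (2 ^ k))) = 2 ^ k"
    unfolding GF_def
    using someI_ex[of "\<lambda>F :: nat ring. field F \<and> card (carrier F) = 2 ^ k"] exists_nat_field[OF assms]
    by blast
  then show "field (GF (2 ^ k))" and card: "card (carrier (GF (2 ^ k))) = 2 ^ k" by auto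
  show "finite (carrier (GF (2 ^ k)))" by (rule card_ge_0_finite) (simp add: card)
qed

lemma L2_chain_length:
  assumes "unrefinable_chain (L2 (2 ^ (3 ^ b))) t C"
  shows "b \<le> t"
proof -
  define q :: nat where "q = 2 ^ (3 ^ b)"
  have F: "field (GF q)" "card (carrier (GF q)) = 2 ^ (3 ^ b)" and fin: "finite (carrier (GF q))"
    unfolding q_def by (rule GF_power_two, simp)+
  interpret F: field_char_two "GF q" by (rule field_char_two_if_card[OF F])
  obtain f :: "nat \<Rightarrow> bit alg_closure"
    where f: "f \<in> ring_hom (GF q) ring_of_type_algebra" "inj_on f (carrier (GF q))"
    using finite_field_embeds[OF F.field_char_two_axioms fin] by blast
  define K where "K = f ` carrier (GF q)"
  have K: "is_subfield K" "finite K" "card K = 2 ^ (3 ^ b)"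
    using F.SL2_iso_sl2(1)[OF f] fin F(2) f(2) by (auto simp: K_def card_image)
  define \<psi> where "\<psi> = (\<lambda>(a, b, c, d). (f a, f b, f c, f d))"
  have \<psi>: "\<psi> \<in> iso (SL2 (GF q)) (SL\<lparr>carrier := sl2 K\<rparr>)"
    using F.SL2_iso_sl2(2)[OF f] by (simp add: \<psi>_def K_def)
  interpret S: group "SL2 (GF q)" by (rule SL2_group[OF F(1)])
  interpret H: group "SL\<lparr>carrier := sl2 K\<rparr>" by (rule SL.subgroup_imp_group[OF subgroup_sl2[OF K(1)]])
  have center: "group_center (SL2 (GF q)) = {\<one>\<^bsub>SL2 (GF q)\<^esub>}"
  proof -
    have "\<psi> ` group_center (SL2 (GF q)) = {\<one>\<^sub>S}"
      using group_center_iso[OF S.is_group \<psi>] group_center_sl2[OF K(1)] by simp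
    also have "\<one>\<^sub>S = \<psi> \<one>\<^bsub>SL2 (GF q)\<^esub>"
      using hom_one[of \<psi> "SL2 (GF q)" "SL\<lparr>carrier := sl2 K\<rparr>"] \<psi> S.is_group H.is_group by (simp add: iso_def)
    finally have img: "\<psi> ` group_center (SL2 (GF q)) = \<psi> ` {\<one>\<^bsub>SL2 (GF q)\<^esub>}" by simp
    have sub: "group_center (SL2 (GF q)) \<subseteq> carrier (SL2 (GF q))" "{\<one>\<^bsub>SL2 (GF q)\<^esub>} \<subseteq> carrier (SL2 (GF q))"
      by (auto simp: group_center_def)
    have "inj_on \<psi> (carrier (SL2 (GF q)))" using \<psi> by (auto simp: iso_def bij_betw_def)
    from inj_on_image_eq_iff[OF this sub] show ?thesis using img by blast
  qed
  have iso1: "(\<lambda>x. {x}) \<in> iso (SL2 (GF q)) (L2 q)"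
    using S.iso_Mod_one unfolding L2_def PSL2_def center .
  have "inv_into (carrier (SL2 (GF q))) (\<lambda>x. {x}) \<in> iso (L2 q) (SL2 (GF q))"
    by (rule S.iso_set_sym[OF iso1])
  then have iso2: "\<psi> \<circ> inv_into (carrier (SL2 (GF q))) (\<lambda>x. {x}) \<in> iso (L2 q) (SL\<lparr>carrier := sl2 K\<rparr>)"
    using \<psi> by (rule iso_set_trans)
  have L2: "group (L2 q)" unfolding L2_def by (rule PSL2_group[OF F(1)])
  have chain: "unrefinable_chain (L2 q) t C" using assms by (simp only: q_def)
  show ?thesis
    by (rule sl2_chain_length[OF K group.unrefinable_chain_iso_image[OF L2 H.is_group iso2 chain]])
qed

lemma finite_L2: "finite (carrier (L2 (2 ^ (3 ^ b))))" "group (L2 (2 ^ (3 ^ b)))"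
proof -
  define q :: nat where "q = 2 ^ (3 ^ b)"
  have F: "field (GF q)" "finite (carrier (GF q))"
    unfolding q_def by (rule GF_power_two, simp)+
  have "finite (carrier (SL2 (GF q)))"
    by (rule finite_subset[of _ "carrier (GF q) \<times> carrier (GF q) \<times> carrier (GF q) \<times> carrier (GF q)"])
      (use F(2) in \<open>auto simp: SL2_def\<close>)
  then have "finite (carrier (L2 q))"
    unfolding L2_def PSL2_def FactGroup_def RCOSETS_def by simp
  then show "finite (carrier (L2 (2 ^ (3 ^ b))))" by (simp add: q_def)
  show "group (L2 (2 ^ (3 ^ b)))" using PSL2_group[OF F(1)] unfolding L2_def q_def .
qed

theorem theorem3:
  fixes n :: nat
  shows "\<exists>q::nat. primepow q \<and> depth (L2 q) > n"
proof -
  define q :: nat where "q = 2 ^ (3 ^ Suc n)"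
  have "primepow q" unfolding q_def by (subst primepow_prime_power) simp_all
  moreover have "\<exists>t H. unrefinable_chain (L2 q) t H"
    unfolding q_def using finite_L2[of "Suc n"] by (intro unrefinable_chain_exists)
  then have "\<exists>H. unrefinable_chain (L2 q) (depth (L2 q)) H"
    unfolding depth_def by (rule LeastI_ex[of "\<lambda>t. \<exists>H. unrefinable_chain (L2 q) t H"])
  then obtain H where "unrefinable_chain (L2 q) (depth (L2 q)) H" by blast
  then have "Suc n \<le> depth (L2 q)" unfolding q_def by (rule L2_chain_length)
  ultimately show ?thesis by (intro exI[of _ q]) simp
qed

end
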